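(* Let $\mathbb{K}$ be a field, let $D$ be a weighted oriented graph such that every vertex of $V^+$ is a sink, and let $I=I(D)$. Let $\mathcal{F}$ be the family of all three-element sets $S$ of vertices such that the induced subgraph of the underlying simple graph $G$ of $D$ on $S$ is a triangle. Then $$\operatorname{reg}(I^2)\in\Big\{\operatorname{reg}(I^{(2)}),\ \max_{S\in\mathcal{F}}\Big\{\operatorname{reg}(I(D\setminus N[S]))+\sum_{x\in N[S]}w(x)-|N[S]|+\sum_{x\in S}w(x)\Big\}\Big\}.$$
   Context: A weighted oriented graph is a triple $D=(V(D),E(D),w)$ with finite vertex set $V(D)=\{x_1,\dots,x_n\}$, a set $E(D)$ of directed edges (where $(u,v)$ is an edge from $u$ to $v$), without loops or parallel edges (at most one of $(u,v),(v,u)$ is in $E(D)$), and a weight function $w$ from $V(D)$ to the positive integers. The underlying simple graph $G$ of $D$ has vertex set $V(D)$ and edges $\{u,v\}$ with $(u,v)$ or $(v,u)$ in $E(D)$. A vertex $v$ is a source if no edge ends at $v$, and a sink if no edge starts at $v$; by convention $w(v)=1$ whenever $v$ is a source. $V^+=\{x\in V(D): w(x)\ge 2\}$. For a vertex $x$, $N[x]$ is the set consisting of $x$ and all its neighbours (in-neighbours and out-neighbours); for a set $S$ of vertices $N[S]=\bigcup_{x\in S}N[x]$. $D\setminus S$ denotes the induced weighted oriented subgraph on $V(D)\setminus S$. The edge ideal of $D$ is $I(D)=(x_ix_j^{w(x_j)} : (x_i,x_j)\in E(D))\subset R=\mathbb{K}[x_1,\dots,x_n]$. The $k$-th symbolic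 power of an ideal $I$ is $I^{(k)}=\bigcap_{P\in \operatorname{Ass}(R/I)}(I^kR_P\cap R)$. For a nonzero homogeneous ideal $I$, $\operatorname{reg}(I)=\max\{j-i : \beta_{i,j}(I)\ne 0\}$ is the Castelnuovo–Mumford regularity; if $D\setminus N[S]$ has no edges, so that its edge ideal is $0$, one sets $\operatorname{reg}(0)=1$. If $\mathcal{F}$ is empty, the maximum over $\mathcal{F}$ is omitted. *)

theory Defs
  imports "HOL-Algebra.Ideal_Product" "HOL-Library.Poly_Mapping"
begin

section \<open>Polynomial rings\<close>

text \<open>A monomial is its exponent vector, a finitely supported function from variables to
  \<^typ>\<open>nat\<close>; a polynomial is a finitely supported function from monomials to coefficients.\<close>

type_synonym ('v, 'k) mpoly = "('v \<Rightarrow>\<^sub>0 nat) \<Rightarrow>\<^sub>0 'k"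

text \<open>The ring \<open>K[V]\<close> whose variables are the elements of \<open>V\<close>, for the field \<open>K\<close> given by the
  type \<open>'k\<close>.  Elements of \<open>'v\<close> outside \<open>V\<close> are not variables of this ring.\<close>

definition poly_ring :: "'v set \<Rightarrow> ('v, 'k::field) mpoly ring" where
  "poly_ring V = \<lparr> carrier = {p. \<forall>m \<in> Poly_Mapping.keys p. Poly_Mapping.keys m \<subseteq> V},
                   mult = (*), one = 1, zero = 0, add = (+) \<rparr>"

lemma poly_ring_simps [simp]:
  "\<one>\<^bsub>poly_ring V\<^esub> = 1" "\<zero>\<^bsub>poly_ring V\<^esub> = 0"
  "p \<otimes>\<^bsub>poly_ring V\<^esub> q = p * q" "p \<oplus>\<^bsub>poly_ring V\<^esub> q = p + q"
  by (simp_all add: poly_ring_def)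

lemma cring_poly_ring: "cring (poly_ring V :: ('v, 'k::field) mpoly ring)"
proof (rule cringI)
  let ?R = "poly_ring V :: ('v, 'k) mpoly ring"
  have carr: "p \<in> carrier ?R \<longleftrightarrow> (\<forall>m \<in> Poly_Mapping.keys p. Poly_Mapping.keys m \<subseteq> V)" for p
    by (simp add: poly_ring_def)
  have add: "p + q \<in> carrier ?R" if "p \<in> carrier ?R" "q \<in> carrier ?R" for p q
    using that keys_add[of p q] unfolding carr by blast
  have neg: "- p \<in> carrier ?R" if "p \<in> carrier ?R" for p
    using that unfolding carr by simp
  have mult: "p * q \<in> carrier ?R" if "p \<in> carrier ?R" "q \<in> carrier ?R" for p q
    unfolding carr
  proof
    fix m assume "m \<in> Poly_Mapping.keys (p * q)"
    then obtain a b where "a \<in> Poly_Mapping.keys p" "b \<in> Poly_Mapping.keys q" "m = a + b"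
      using keys_mult[of p q] by blast
    then show "Poly_Mapping.keys m \<subseteq> V"
      using that keys_add[of a b] unfolding carr by blast
  qed
  have one: "1 \<in> carrier ?R"
    unfolding carr by (simp add: single_one [symmetric] del: single_one)
  have zero: "0 \<in> carrier ?R"
    unfolding carr by simp
  show "abelian_group ?R"
  proof (rule abelian_groupI)
    show "\<exists>q \<in> carrier ?R. q \<oplus>\<^bsub>?R\<^esub> p = \<zero>\<^bsub>?R\<^esub>" if "p \<in> carrier ?R" for p
      using neg[OF that] by (intro bexI[of _ "- p"]) simp_all
  qed (simp_all add: add zero add.assoc add.commute)
  show "comm_monoid ?R"
    using mult one by (intro comm_monoidI) (simp_all add: mult.assoc mult.commute)
  show "(p \<oplus>\<^bsub>?R\<^esub> q) \<otimes>\<^bsub>?R\<^esub> r = p \<otimes>\<^bsub>?R\<^esub> r \<oplus>\<^bsub>?R\<^esub> q \<otimes>\<^bsub>?R\<^esub> r" for p q r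
    by (simp add: distrib_right)
qed

definition mdeg :: "('v \<Rightarrow>\<^sub>0 nat) \<Rightarrow> nat" where
  "mdeg m = (\<Sum>v \<in> Poly_Mapping.keys m. Poly_Mapping.lookup m v)"

text \<open>The zero polynomial is homogeneous of every degree, and it is the only homogeneous
  polynomial of negative degree.\<close>

definition homogeneous :: "int \<Rightarrow> ('v, 'k::zero) mpoly \<Rightarrow> bool" where
  "homogeneous j p \<longleftrightarrow> (\<forall>m \<in> Poly_Mapping.keys p. int (mdeg m) = j)"


section \<open>Ordinary and symbolic powers\<close>

definition ideal_power :: "('a, 'b) ring_scheme \<Rightarrow> 'a set \<Rightarrow> nat \<Rightarrow> 'a set" where
  "ideal_power R I k = I [^]\<^bsub>ideals_set R\<^esub> k"

text \<open>The associated primes of \<open>R/I\<close>: the prime ideals that are the annihilator of the class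
  \<open>f + I\<close> of some \<open>f\<close> in \<open>R\<close>.\<close>

definition Ass_quot :: "('a, 'b) ring_scheme \<Rightarrow> 'a set \<Rightarrow> 'a set set" where
  "Ass_quot R I = {P. primeideal P R \<and>
      (\<exists>f \<in> carrier R. P = {r \<in> carrier R. r \<otimes>\<^bsub>R\<^esub> f \<in> I})}"

text \<open>The contraction \<open>J R\<^sub>P \<inter> R\<close>.  The elements of \<open>J R\<^sub>P\<close> are the fractions \<open>a/s\<close> with \<open>a \<in> J\<close>
  and \<open>s \<in> R - P\<close>, and \<open>f/1 = a/s\<close> holds in \<open>R\<^sub>P\<close> iff \<open>t (s f - a) = 0\<close> for some \<open>t \<in> R - P\<close>.\<close>

definition loc_contraction :: "('a, 'b) ring_scheme \<Rightarrow> 'a set \<Rightarrow> 'a set \<Rightarrow> 'a set" where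
  "loc_contraction R P J = {f \<in> carrier R. \<exists>a \<in> J. \<exists>s \<in> carrier R - P. \<exists>t \<in> carrier R - P.
      t \<otimes>\<^bsub>R\<^esub> (s \<otimes>\<^bsub>R\<^esub> f \<ominus>\<^bsub>R\<^esub> a) = \<zero>\<^bsub>R\<^esub>}"

definition symbolic_power :: "('a, 'b) ring_scheme \<Rightarrow> 'a set \<Rightarrow> nat \<Rightarrow> 'a set" where
  "symbolic_power R I k = (\<Inter>P \<in> Ass_quot R I. loc_contraction R P (ideal_power R I k))"


section \<open>Minimal graded free resolutions and regularity\<close>

text \<open>The free module of rank \<open>n\<close> over \<open>K[V]\<close>; its elements are padded with zeros.\<close>

definition free_mod :: "'v set \<Rightarrow> nat \<Rightarrow> (nat \<Rightarrow> ('v, 'k::field) mpoly) set" where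
  "free_mod V n = {u. (\<forall>r<n. u r \<in> carrier (poly_ring V)) \<and> (\<forall>r\<ge>n. u r = 0)}"

text \<open>The map from the free module of rank \<open>n\<close> to the one of rank \<open>m\<close> with matrix \<open>A\<close>.\<close>

definition mat_app ::
  "nat \<Rightarrow> nat \<Rightarrow> (nat \<Rightarrow> nat \<Rightarrow> 'a) \<Rightarrow> (nat \<Rightarrow> 'a) \<Rightarrow> (nat \<Rightarrow> 'a::comm_ring_1)" where
  "mat_app m n A u = (\<lambda>r. if r < m then \<Sum>c<n. A r c * u c else 0)"

text \<open>A minimal graded free resolution
  \<open>\<dots> \<rightarrow> F\<^sub>2 \<rightarrow> F\<^sub>1 \<rightarrow> F\<^sub>0 \<rightarrow> I \<rightarrow> 0\<close> over \<open>R = K[V]\<close>.  The list \<open>d i\<close> consists of the degrees of the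
  basis of \<open>F\<^sub>i\<close>, so \<open>F\<^sub>i\<close> is the direct sum of the \<open>R(-j)\<close> for \<open>j\<close> in \<open>d i\<close>; the augmentation
  sends the \<open>c\<close>-th basis element of \<open>F\<^sub>0\<close> to \<open>g c\<close>; and \<open>A i\<close> is the matrix of
  \<open>F\<^sub>i\<^sub>+\<^sub>1 \<rightarrow> F\<^sub>i\<close>.  A map is graded iff its entries are homogeneous of the indicated degrees, and
  the resolution is minimal iff no entry of any \<open>A i\<close> has a constant term, that is, iff
  \<open>F\<^sub>i\<^sub>+\<^sub>1\<close> is mapped into \<open>\<mm> F\<^sub>i\<close> for the ideal \<open>\<mm>\<close> generated by the variables.\<close>

definition minimal_graded_free_resolution ::
  "'v set \<Rightarrow> ('v, 'k::field) mpoly set \<Rightarrow> (nat \<Rightarrow> int list) \<Rightarrow> (nat \<Rightarrow> ('v, 'k) mpoly)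
    \<Rightarrow> (nat \<Rightarrow> nat \<Rightarrow> nat \<Rightarrow> ('v, 'k) mpoly) \<Rightarrow> bool" where
  "minimal_graded_free_resolution V I d g A \<longleftrightarrow>
    (let R = poly_ring V;
         n = (\<lambda>i. length (d i));
         F = (\<lambda>i. free_mod V (n i));
         \<epsilon> = (\<lambda>u. \<Sum>c<n 0. u c * g c);
         \<delta> = (\<lambda>i. mat_app (n i) (n (Suc i)) (A i))
     in (\<forall>c<n 0. g c \<in> carrier R \<and> homogeneous (d 0 ! c) (g c)) \<and>
        (\<forall>i. \<forall>r<n i. \<forall>c<n (Suc i). A i r c \<in> carrier R \<and>
            homogeneous (d (Suc i) ! c - d i ! r) (A i r c) \<and>
            Poly_Mapping.lookup (A i r c) 0 = 0) \<and>
        \<epsilon> ` F 0 = I \<and>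
        \<delta> 0 ` F 1 = {u \<in> F 0. \<epsilon> u = 0} \<and>
        (\<forall>i. \<delta> (Suc i) ` F (Suc (Suc i)) = {u \<in> F (Suc i). \<delta> i u = (\<lambda>_. 0)}))"

text \<open>The graded Betti number \<open>\<beta>\<^sub>i\<^sub>,\<^sub>j(I)\<close> of a homogeneous ideal \<open>I\<close> of \<open>K[V]\<close>, \<open>V\<close> finite: the
  multiplicity of \<open>R(-j)\<close> in \<open>F\<^sub>i\<close>, which is the same for all minimal graded free resolutions.\<close>

definition graded_betti :: "'v set \<Rightarrow> ('v, 'k::field) mpoly set \<Rightarrow> nat \<Rightarrow> int \<Rightarrow> nat" where
  "graded_betti V I i j =
    (THE b. \<exists>d g A. minimal_graded_free_resolution V I d g A \<and> b = count_list (d i) j)"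

text \<open>Castelnuovo-Mumford regularity, with the convention \<open>reg 0 = 1\<close>.\<close>

definition reg :: "'v set \<Rightarrow> ('v, 'k::field) mpoly set \<Rightarrow> int" where
  "reg V I = (if I = {0} then 1 else Max {j - int i | i j. graded_betti V I i j \<noteq> 0})"


section \<open>Weighted oriented graphs\<close>

record 'v wograph =
  verts :: "'v set"
  arcs :: "('v \<times> 'v) set"
  weight :: "'v \<Rightarrow> nat"

definition is_source :: "'v wograph \<Rightarrow> 'v \<Rightarrow> bool" where
  "is_source D v \<longleftrightarrow> v \<in> verts D \<and> (\<forall>u. (u, v) \<notin> arcs D)"

definition is_sink :: "'v wograph \<Rightarrow> 'v \<Rightarrow> bool" where
  "is_sink D v \<longleftrightarrow> v \<in> verts D \<and> (\<forall>u. (v, u) \<notin> arcs D)"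

definition weighted_oriented_graph :: "'v wograph \<Rightarrow> bool" where
  "weighted_oriented_graph D \<longleftrightarrow>
     finite (verts D) \<and> arcs D \<subseteq> verts D \<times> verts D \<and>
     (\<forall>v. (v, v) \<notin> arcs D) \<and>
     (\<forall>u v. (u, v) \<in> arcs D \<longrightarrow> (v, u) \<notin> arcs D) \<and>
     (\<forall>v \<in> verts D. weight D v \<ge> 1) \<and>
     (\<forall>v. is_source D v \<longrightarrow> weight D v = 1)"

definition Vplus :: "'v wograph \<Rightarrow> 'v set" where
  "Vplus D = {x \<in> verts D. weight D x \<ge> 2}"

text \<open>The edge set of the underlying simple graph.\<close>

definition und_edges :: "'v wograph \<Rightarrow> 'v set set" where
  "und_edges D = {{u, v} | u v. (u, v) \<in> arcs D}"

definition closed_nbhd :: "'v wograph \<Rightarrow> 'v set \<Rightarrow> 'v set" where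
  "closed_nbhd D S = (\<Union>x \<in> S. insert x {y. (x, y) \<in> arcs D \<or> (y, x) \<in> arcs D})"

text \<open>The induced subgraph on the complement of \<open>S\<close> keeps the weights of \<open>D\<close>.  A vertex may
  become a source in it without having weight 1; this does not matter for the edge ideal, in
  which the weight of a vertex occurs only through the edges that end at this vertex.\<close>

definition delete_verts :: "'v wograph \<Rightarrow> 'v set \<Rightarrow> 'v wograph" where
  "delete_verts D S = \<lparr> verts = verts D - S,
     arcs = arcs D \<inter> ((verts D - S) \<times> (verts D - S)), weight = weight D \<rparr>"

definition triangles :: "'v wograph \<Rightarrow> 'v set set" where
  "triangles D = {S. S \<subseteq> verts D \<and> card S = 3 \<and>
     (\<forall>u \<in> S. \<forall>v \<in> S. u \<noteq> v \<longrightarrow> {u, v} \<in> und_edges D)}"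

definition edge_monomial :: "'v wograph \<Rightarrow> 'v \<times> 'v \<Rightarrow> ('v, 'k::field) mpoly" where
  "edge_monomial D e = Poly_Mapping.single
     (Poly_Mapping.single (fst e) 1 + Poly_Mapping.single (snd e) (weight D (snd e))) 1"

definition edge_ideal :: "'v wograph \<Rightarrow> ('v, 'k::field) mpoly set" where
  "edge_ideal D = Idl\<^bsub>poly_ring (verts D)\<^esub> (edge_monomial D ` arcs D)"

end

theory Submission
  imports Defs "HOL-Library.Function_Algebras" "HOL.Vector_Spaces"
begin

text \<open>Since every vertex of weight at least 2 is a sink, \<open>I\<close> arises from the edge ideal of \<open>G\<close> by
  substituting \<open>x\<^sub>v\<^bsup>w v\<^esup>\<close> for \<open>x\<^sub>v\<close>.  Hence \<open>I\<^sup>(\<^sup>2\<^sup>)\<close> is \<open>I\<^sup>2\<close> together with the products \<open>x\<^sup>S\<close> of the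
  \<open>x\<^sub>v\<^bsup>w v\<^esup>\<close> over the vertices of a triangle \<open>S\<close>, and \<open>I\<^sup>(\<^sup>2\<^sup>) / I\<^sup>2\<close> is the direct sum over the triangles
  of \<open>R / ((x\<^sub>v\<^bsup>w v\<^esup> : v \<in> N[S]) + I(D - N[S]))\<close>, shifted by \<open>x\<^sup>S\<close>.  Its regularity is \<open>M - 1\<close>, where
  \<open>M\<close> is the maximum in the theorem, so the long exact sequence gives
  \<open>reg I\<^sup>2 \<le> max (reg I\<^sup>(\<^sup>2\<^sup>)) M\<close> and \<open>reg I\<^sup>(\<^sup>2\<^sup>) \<le> max (reg I\<^sup>2) (M - 1)\<close>.  In the top degrees of
  each summand the connecting homomorphism is injective, which gives \<open>M \<le> reg I\<^sup>2\<close>; the three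
  inequalities leave only the two values.

  Graded Betti numbers are dimensions of Koszul homology, by dimension shifting along the syzygy
  modules of a minimal resolution.  For a monomial ideal the Koszul complex splits into strands of
  multidegree \<open>\<alpha>\<close>, which are the chain complexes of the simplicial complexes of all squarefree
  \<open>\<sigma>\<close> with \<open>x\<^bsup>\<alpha> - \<sigma>\<^esup>\<close> in the ideal.\<close>

text \<open>The terms of M come from a tensor product. The complete intersection of the x_v^(w v), v
  \<in> N[S], has a quotient whose regularity is the sum of the w v - 1 over N[S]; the remaining
  variables contribute reg (R/J) = reg J - 1 for J = I(D - N[S]), where reg 0 = 1 is the value that
  makes this hold for J = 0; the shift by x^S adds its degree. The sum over the triangles is direct
  because a monomial above x^S and x^T for two different triangles already lies in I^2. Betti
  numbers are given by a definite description over all minimal resolutions, so a resolution must be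
  shown to exist and its degrees to be independent of choices. Koszul homology answers both
  questions, being attached to the ideal alone. After that, regularity only asks where homology
  vanishes, so the long exact sequence is used one exact triple at a time, in each multidegree
  separately. If reg I^2 exceeds M, the two upper bounds give reg I^2 \<le> reg I^(2) \<le> reg I^2;
  otherwise the lower bound gives reg I^2 = M.\<close>

abbreviation lookup :: "('a \<Rightarrow>\<^sub>0 'b::zero) \<Rightarrow> 'a \<Rightarrow> 'b" where "lookup \<equiv> Poly_Mapping.lookup"
abbreviation keys :: "('a \<Rightarrow>\<^sub>0 'b::zero) \<Rightarrow> 'a set" where "keys \<equiv> Poly_Mapping.keys"
abbreviation single :: "'a \<Rightarrow> 'b \<Rightarrow> ('a \<Rightarrow>\<^sub>0 'b::zero)" where "single \<equiv> Poly_Mapping.single"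

section \<open>Dimensions of quotient spaces\<close>

text \<open>Elimination by induction on the equations: one that is not identically zero is solved
  for the unknown \<open>q\<close> and substituted into the others, which removes one equation and
  one unknown.\<close>

lemma homogeneous_system_solution:
  fixes m :: "'r \<Rightarrow> 's \<Rightarrow> 'k::field"
  assumes "finite J" "finite I" "card J < card I"
  shows "\<exists>a. (\<exists>r\<in>I. a r \<noteq> 0) \<and> (\<forall>s\<in>J. (\<Sum>r\<in>I. a r * m r s) = 0)"
  using assms
proof (induction J arbitrary: I m rule: finite_induct)
  case empty
  then have "I \<noteq> {}" by auto
  then show ?case by (intro exI[of _ "\<lambda>_. 1"]) auto
next
  case (insert s J)
  show ?case
  proof (cases "\<forall>r\<in>I. m r s = 0")
    case True
    have "card J < card I" using insert by simp
    from insert.IH[OF insert.prems(1) this, of m] True show ?thesis by fastforce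
  next
    case False
    then obtain q where q: "q \<in> I" "m q s \<noteq> 0" by blast
    let ?I = "I - {q}"
    have "card J < card ?I" using insert q by simp
    from insert.IH[OF _ this, of "\<lambda>r t. m r t - m r s / m q s * m q t"] insert.prems(1)
    obtain a where a: "\<exists>r\<in>?I. a r \<noteq> 0"
      "\<forall>t\<in>J. (\<Sum>r\<in>?I. a r * (m r t - m r s / m q s * m q t)) = 0" by auto
    define b where "b = a(q := - (\<Sum>r\<in>?I. a r * m r s / m q s))"
    have split: "(\<Sum>r\<in>I. b r * m r t) = b q * m q t + (\<Sum>r\<in>?I. a r * m r t)" for t
    proof -
      have "(\<Sum>r\<in>?I. b r * m r t) = (\<Sum>r\<in>?I. a r * m r t)"
        by (rule sum.cong) (auto simp: b_def)
      then show ?thesis using sum.remove[OF insert.prems(1) q(1), of "\<lambda>r. b r * m r t"] by simp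
    qed
    have "(\<Sum>r\<in>I. b r * m r s) = 0"
      using q(2) unfolding split by (simp add: b_def sum_distrib_right)
    moreover have "(\<Sum>r\<in>I. b r * m r t) = 0" if "t \<in> J" for t
    proof -
      have "(\<Sum>r\<in>?I. a r * (m r t - m r s / m q s * m q t))
          = (\<Sum>r\<in>?I. a r * m r t) - (\<Sum>r\<in>?I. a r * m r s / m q s) * m q t"
        by (simp add: right_diff_distrib sum_subtractf sum_distrib_right mult.assoc)
      then show ?thesis unfolding split using a(2) that by (simp add: b_def)
    qed
    moreover have "\<exists>r\<in>I. b r \<noteq> 0" using a(1) q by (auto simp: b_def)
    ultimately show ?thesis by blast
  qed
qed

context vector_space
begin

definition quot_basis :: "'b set \<Rightarrow> 'b set \<Rightarrow> nat set \<Rightarrow> (nat \<Rightarrow> 'b) \<Rightarrow> bool" where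
  "quot_basis W B I f \<longleftrightarrow> finite I \<and> f ` I \<subseteq> W \<and>
     (\<forall>w\<in>W. \<exists>a. w - (\<Sum>r\<in>I. a r *s f r) \<in> B) \<and>
     (\<forall>a. (\<Sum>r\<in>I. a r *s f r) \<in> B \<longrightarrow> (\<forall>r\<in>I. a r = 0))"

text \<open>A relation rather than a function: a dimension exists only when \<open>W\<close> is
  finite-dimensional modulo \<open>B\<close>, and this has to be shown for each space of
  cycles.\<close>

definition quot_dim :: "'b set \<Rightarrow> 'b set \<Rightarrow> nat \<Rightarrow> bool" where
  "quot_dim W B n \<longleftrightarrow> (\<exists>I f. quot_basis W B I f \<and> card I = n)"

lemma quot_basisD:
  assumes "quot_basis W B I f"
  shows "finite I" "r \<in> I \<Longrightarrow> f r \<in> W"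
    "w \<in> W \<Longrightarrow> \<exists>a. w - (\<Sum>r\<in>I. a r *s f r) \<in> B"
    "(\<Sum>r\<in>I. a r *s f r) \<in> B \<Longrightarrow> r \<in> I \<Longrightarrow> a r = 0"
  using assms by (auto simp: quot_basis_def image_subset_iff)

text \<open>With more f than g, the matrix that expresses the f by the g modulo \<open>B\<close> has
  a nontrivial left kernel, that is, a relation among the f modulo \<open>B\<close>.\<close>

lemma quot_basis_card_le:
  assumes B: "subspace B" and f: "quot_basis W B I f" and g: "quot_basis W B J g"
  shows "card I \<le> card J"
proof (rule ccontr)
  assume "\<not> card I \<le> card J"
  then have less: "card J < card I" by simp
  have "\<forall>r\<in>I. \<exists>a. f r - (\<Sum>s\<in>J. a s *s g s) \<in> B"
    using quot_basisD(2)[OF f] quot_basisD(3)[OF g] by simp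
  then obtain m where m: "\<forall>r\<in>I. f r - (\<Sum>s\<in>J. m r s *s g s) \<in> B" by metis
  obtain a where a: "\<exists>r\<in>I. a r \<noteq> 0" "\<forall>s\<in>J. (\<Sum>r\<in>I. a r * m r s) = 0"
    using homogeneous_system_solution[OF quot_basisD(1)[OF g] quot_basisD(1)[OF f] less, of m] by blast
  have "(\<Sum>r\<in>I. a r *s (f r - (\<Sum>s\<in>J. m r s *s g s))) \<in> B"
    using m by (intro subspace_sum[OF B] subspace_scale[OF B]) auto
  also have "(\<Sum>r\<in>I. a r *s (f r - (\<Sum>s\<in>J. m r s *s g s)))
      = (\<Sum>r\<in>I. a r *s f r) - (\<Sum>r\<in>I. \<Sum>s\<in>J. (a r * m r s) *s g s)"
    by (simp add: scale_right_diff_distrib sum_subtractf scale_sum_right)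
  also have "(\<Sum>r\<in>I. \<Sum>s\<in>J. (a r * m r s) *s g s) = (\<Sum>s\<in>J. (\<Sum>r\<in>I. a r * m r s) *s g s)"
    by (subst sum.swap) (simp add: scale_sum_left)
  also have "\<dots> = 0" using a(2) by simp
  finally show False using quot_basisD(4)[OF f, of a] a(1) by auto
qed

lemma quot_dim_unique:
  assumes "subspace B" "quot_dim W B m" "quot_dim W B n" shows "m = n"
  using assms quot_basis_card_le unfolding quot_dim_def by (metis le_antisym)

lemma quot_dim_0_iff:
  assumes "subspace B" "subspace W" "quot_dim W B n"
  shows "n = 0 \<longleftrightarrow> W \<subseteq> B"
proof
  assume "n = 0"
  then show "W \<subseteq> B" using assms unfolding quot_dim_def quot_basis_def by auto
next
  assume WB: "W \<subseteq> B"
  obtain I f where f: "quot_basis W B I f" "card I = n" using assms unfolding quot_dim_def by blast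
  have "(\<Sum>r\<in>I. 1 *s f r) \<in> B"
    using quot_basisD(2)[OF f(1)] WB by (intro subspace_sum[OF assms(1)]) auto
  then have "I = {}" using quot_basisD(4)[OF f(1), of "\<lambda>_. 1"] by auto
  then show "n = 0" using f by simp
qed

text \<open>Finitely many functionals separate the points of \<open>W\<close>, so a family that is
  independent modulo \<open>B\<close> has at most \<open>card T\<close> members, and one of greatest
  size also spans.\<close>

lemma quot_dim_exists:
  fixes ev :: "'t \<Rightarrow> 'b \<Rightarrow> 'a"
  assumes B: "subspace B" and W: "subspace W" and T: "finite T"
    and ev: "\<And>t. t \<in> T \<Longrightarrow> Vector_Spaces.linear scale (*) (ev t)"
    and inj: "\<And>w. w \<in> W \<Longrightarrow> (\<forall>t\<in>T. ev t w = 0) \<Longrightarrow> w = 0"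
  shows "\<exists>n. quot_dim W B n"
proof -
  define P where "P n \<longleftrightarrow> (\<exists>I f. finite (I::nat set) \<and> f ` I \<subseteq> W \<and>
    (\<forall>a. (\<Sum>r\<in>I. a r *s f r) \<in> B \<longrightarrow> (\<forall>r\<in>I. a r = 0)) \<and> card I = n)" for n
  have ev': "ev t (\<Sum>r\<in>I. a r *s f r) = (\<Sum>r\<in>I. a r * ev t (f r))" if "t \<in> T" for t a f and I :: "nat set"
  proof -
    interpret Vector_Spaces.linear scale "(*)" "ev t" using ev that .
    show ?thesis by (simp add: sum scale)
  qed
  have bound: "n \<le> card T" if "P n" for n
  proof (rule ccontr)
    assume n: "\<not> n \<le> card T"
    from that obtain I :: "nat set" and f where I: "finite I" "f ` I \<subseteq> W" "card I = n"
      "\<And>a. (\<Sum>r\<in>I. a r *s f r) \<in> B \<Longrightarrow> (\<forall>r\<in>I. a r = 0)" unfolding P_def by blast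
    obtain a where a: "\<exists>r\<in>I. a r \<noteq> 0" "\<forall>t\<in>T. (\<Sum>r\<in>I. a r * ev t (f r)) = 0"
      using homogeneous_system_solution[OF T I(1), of "\<lambda>r t. ev t (f r)"] n I by auto
    have "(\<Sum>r\<in>I. a r *s f r) \<in> W"
      using I by (intro subspace_sum[OF W] subspace_scale[OF W]) auto
    then have "(\<Sum>r\<in>I. a r *s f r) = 0" using a(2) ev' by (intro inj) auto
    then have "\<forall>r\<in>I. a r = 0" using I(4)[of a] subspace_0[OF B] by simp
    then show False using a(1) by blast
  qed
  have "P 0" unfolding P_def by (intro exI[of _ "{}"]) auto
  then have "P (Greatest P)" using bound by (rule GreatestI_nat)
  moreover define N where "N = Greatest P"
  ultimately have "P N" by simp
  then obtain I :: "nat set" and f where I: "finite I" "f ` I \<subseteq> W" "card I = N"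
    "\<And>a. (\<Sum>r\<in>I. a r *s f r) \<in> B \<Longrightarrow> (\<forall>r\<in>I. a r = 0)" unfolding P_def by blast
  have "\<exists>a. w - (\<Sum>r\<in>I. a r *s f r) \<in> B" if w: "w \<in> W" for w
  proof (rule ccontr)
    assume neg: "\<nexists>a. w - (\<Sum>r\<in>I. a r *s f r) \<in> B"
    obtain q where q: "q \<notin> I" using I(1) ex_new_if_finite[OF infinite_UNIV_nat] by blast
    let ?f = "f(q := w)"
    have "P (Suc N)" unfolding P_def
    proof (intro exI[of _ "insert q I"] exI[of _ ?f] conjI allI impI)
      fix a assume "(\<Sum>r\<in>insert q I. a r *s ?f r) \<in> B"
      moreover have "(\<Sum>r\<in>I. a r *s ?f r) = (\<Sum>r\<in>I. a r *s f r)" using q by (intro sum.cong) auto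
      ultimately have *: "a q *s w + (\<Sum>r\<in>I. a r *s f r) \<in> B" using q I by simp
      have aq: "a q = 0"
      proof (rule ccontr)
        assume "a q \<noteq> 0"
        then have "w - (\<Sum>r\<in>I. (- a r / a q) *s f r) = (1 / a q) *s (a q *s w + (\<Sum>r\<in>I. a r *s f r))"
          by (simp add: scale_right_distrib scale_sum_right sum_negf)
        then show False using neg subspace_scale[OF B *] by metis
      qed
      with * have "\<forall>r\<in>I. a r = 0" using I(4)[of a] by simp
      with aq show "\<forall>r\<in>insert q I. a r = 0" by blast
    qed (use I q w in auto)
    then have "Suc N \<le> N" unfolding N_def using bound by (rule Greatest_le_nat)
    then show False by simp
  qed
  then have "quot_basis W B I f" using I by (auto simp: quot_basis_def)
  then show ?thesis unfolding quot_dim_def by blast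
qed

text \<open>The isomorphism of \<open>W / B\<close> with \<open>W' / B'\<close> is given by a linear
  relation, because the connecting homomorphism, for which the lemma is meant, is single-valued only
  modulo boundaries.\<close>

lemma quot_dim_transfer:
  assumes d: "quot_dim W B n"
    and add: "\<And>z w z' w'. R z w \<Longrightarrow> R z' w' \<Longrightarrow> R (z + z') (w + w')"
    and scale: "\<And>z w k. R z w \<Longrightarrow> R (k *s z) (k *s w)"
    and zero: "R 0 0"
    and total: "\<And>z. z \<in> W \<Longrightarrow> \<exists>w. R z w" and surj: "\<And>w. w \<in> W' \<Longrightarrow> \<exists>z. R z w"
    and dom: "\<And>z w. R z w \<Longrightarrow> z \<in> W \<and> w \<in> W'"
    and iff: "\<And>z w. R z w \<Longrightarrow> z \<in> B \<longleftrightarrow> w \<in> B'"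
  shows "quot_dim W' B' n"
proof -
  obtain I f where f: "quot_basis W B I f" "card I = n" using d unfolding quot_dim_def by blast
  then have "\<forall>r\<in>I. \<exists>w. R (f r) w" using total by (auto simp: quot_basis_def)
  then obtain g where g: "\<And>r. r \<in> I \<Longrightarrow> R (f r) (g r)" by metis
  have Rs: "R (\<Sum>r\<in>J. a r *s f r) (\<Sum>r\<in>J. a r *s g r)" if "J \<subseteq> I" "finite J" for a J
    using that(2,1) by (induction J) (auto intro: zero add scale g)
  have fin: "finite I" using f by (auto simp: quot_basis_def)
  have "quot_basis W' B' I g" unfolding quot_basis_def
  proof (intro conjI ballI allI impI)
    fix w assume "w \<in> W'"
    then obtain z where z: "R z w" using surj by blast
    then obtain a where a: "z - (\<Sum>r\<in>I. a r *s f r) \<in> B"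
      using quot_basisD(3)[OF f(1), of z] dom by blast
    have "R (z + (-1) *s (\<Sum>r\<in>I. a r *s f r)) (w + (-1) *s (\<Sum>r\<in>I. a r *s g r))"
      using z Rs fin by (intro add scale) auto
    then have "R (z - (\<Sum>r\<in>I. a r *s f r)) (w - (\<Sum>r\<in>I. a r *s g r))" by simp
    then show "\<exists>a. w - (\<Sum>r\<in>I. a r *s g r) \<in> B'" using a iff by blast
  next
    fix a r assume "(\<Sum>r\<in>I. a r *s g r) \<in> B'" "r \<in> I"
    then show "a r = 0" using quot_basisD(4)[OF f(1), of a r] iff[OF Rs[of I a]] fin by simp
  qed (use fin g dom in auto)
  then show ?thesis using f unfolding quot_dim_def by blast
qed

end

section \<open>Polynomials and homogeneous components\<close>

lemma lookup_monom_mult: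
  fixes p :: "('v, 'k::field) mpoly"
  shows "lookup (single t k * p) m = (if \<exists>n. m = t + n then k * lookup p (m - t) else 0)"
proof -
  have "lookup (single t k * p) m = (\<Sum>l. (k when t = l) * (\<Sum>q. lookup p q when m = l + q))"
    by (simp add: lookup_mult lookup_single)
  also have "\<dots> = (\<Sum>l. (k * (\<Sum>q. lookup p q when m = l + q)) when t = l)"
    by (rule Sum_any.cong) (auto simp: when_def)
  also have "\<dots> = k * (\<Sum>q. lookup p q when m = t + q)" by simp
  also have "\<dots> = (if \<exists>n. m = t + n then k * lookup p (m - t) else 0)"
  proof (cases "\<exists>n. m = t + n")
    case True
    then obtain n where n: "m = t + n" by blast
    have "(\<Sum>q. lookup p q when m = t + q) = (\<Sum>q. lookup p q when q = n)"
      by (rule Sum_any.cong) (auto simp: n when_def)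
    then show ?thesis using True n by simp
  next
    case False
    then have "(m = t + q) = False" for q by blast
    then show ?thesis using False by simp
  qed
  finally show ?thesis .
qed

lemma lookup_const_mult [simp]:
  fixes p :: "('v, 'k::field) mpoly"
  shows "lookup (single 0 k * p) m = k * lookup p m"
  by (simp add: lookup_monom_mult)

definition var :: "'v \<Rightarrow> ('v, 'k::field) mpoly" where
  "var v = single (single v 1) 1"

lemma lookup_var_mult:
  fixes p :: "('v, 'k::field) mpoly"
  shows "lookup (var v * p) m = (if 0 < lookup m v then lookup p (m - single v 1) else 0)"
proof -
  have "(\<exists>n. m = single v 1 + n) \<longleftrightarrow> 0 < lookup m v"
  proof
    assume *: "0 < lookup m v"
    have "m = single v 1 + (m - single v 1)"
      by (rule poly_mapping_eqI) (use * in \<open>auto simp: lookup_add lookup_minus lookup_single when_def\<close>)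
    then show "\<exists>n. m = single v 1 + n" by blast
  qed (auto simp: lookup_add)
  then show ?thesis by (simp add: var_def lookup_monom_mult)
qed

lemma monom_add_eq_0_iff: "(m::'v \<Rightarrow>\<^sub>0 nat) + n = 0 \<longleftrightarrow> m = 0 \<and> n = 0"
  by (auto simp: poly_mapping_eq_iff fun_eq_iff lookup_add)

lemma lookup_mult_zero:
  fixes p q :: "('v, 'k::field) mpoly"
  shows "lookup (p * q) 0 = lookup p 0 * lookup q 0"
proof -
  have "lookup (p * q) 0 = (\<Sum>l. lookup p l * (\<Sum>r. lookup q r when 0 = l + r))"
    by (simp add: lookup_mult)
  also have "\<dots> = (\<Sum>l. lookup p l * (\<Sum>r. lookup q r when r = 0) when l = 0)"
  proof (rule Sum_any.cong)
    fix l :: "'v \<Rightarrow>\<^sub>0 nat"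
    have "(\<Sum>r. lookup q r when 0 = l + r) = ((\<Sum>r. lookup q r when r = 0) when l = 0)"
    proof (cases "l = 0")
      case False
      then have "(0 = l + r) = False" for r by (metis monom_add_eq_0_iff)
      then show ?thesis using False by simp
    qed (simp add: eq_commute[of 0])
    then show "lookup p l * (\<Sum>r. lookup q r when 0 = l + r)
      = (lookup p l * (\<Sum>r. lookup q r when r = 0) when l = 0)" by (simp add: mult_when)
  qed
  also have "\<dots> = lookup p 0 * lookup q 0" by simp
  finally show ?thesis .
qed

lemma mdeg_eq_sum:
  assumes "finite A" "keys m \<subseteq> A" shows "mdeg m = sum (lookup m) A"
  unfolding mdeg_def using assms by (intro sum.mono_neutral_left) (auto simp: in_keys_iff)

lemma mdeg_0 [simp]: "mdeg 0 = 0" by (simp add: mdeg_def)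

lemma mdeg_add: "mdeg (m + n) = mdeg m + mdeg n"
proof -
  let ?A = "keys m \<union> keys n"
  have "mdeg (m + n) = sum (lookup (m + n)) ?A" by (rule mdeg_eq_sum) (auto simp: keys_add)
  then show ?thesis
    using mdeg_eq_sum[of ?A m] mdeg_eq_sum[of ?A n] by (simp add: lookup_add sum.distrib)
qed

lemma mdeg_single [simp]: "mdeg (single v k) = k"
  by (simp add: mdeg_def)

lemma mdeg_eq_0_iff: "mdeg m = 0 \<longleftrightarrow> m = 0"
  by (auto simp: mdeg_def in_keys_iff intro!: poly_mapping_eqI)

lemma finite_monomials_of_degree:
  assumes "finite V" shows "finite {m. keys m \<subseteq> V \<and> mdeg m = n}"
proof -
  let ?F = "PiE V (\<lambda>_. {..n})"
  have "inj_on (\<lambda>m. restrict (lookup m) V) {m. keys m \<subseteq> V \<and> mdeg m = n}"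
  proof (rule inj_onI)
    fix a b :: "'a \<Rightarrow>\<^sub>0 nat"
    assume *: "a \<in> {m. keys m \<subseteq> V \<and> mdeg m = n}" "b \<in> {m. keys m \<subseteq> V \<and> mdeg m = n}"
      "restrict (lookup a) V = restrict (lookup b) V"
    show "a = b"
    proof (rule poly_mapping_eqI)
      fix v show "lookup a v = lookup b v"
      proof (cases "v \<in> V")
        case True then show ?thesis using *(3) by (metis restrict_apply')
      next
        case False
        then have "v \<notin> keys a" "v \<notin> keys b" using * by auto
        then show ?thesis by (simp add: in_keys_iff)
      qed
    qed
  qed
  moreover have "(\<lambda>m. restrict (lookup m) V) ` {m. keys m \<subseteq> V \<and> mdeg m = n} \<subseteq> ?F"
  proof
    fix f assume "f \<in> (\<lambda>m. restrict (lookup m) V) ` {m. keys m \<subseteq> V \<and> mdeg m = n}"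
    then obtain m where m: "keys m \<subseteq> V" "mdeg m = n" "f = restrict (lookup m) V" by blast
    have "lookup m v \<le> n" if "v \<in> V" for v
      using member_le_sum[of v V "lookup m"] that mdeg_eq_sum[OF assms m(1)] m(2) assms by simp
    then show "f \<in> ?F" using m by auto
  qed
  ultimately show ?thesis using finite_PiE[OF assms, of "\<lambda>_. {..n}"]
    by (meson finite_atMost finite_imageD finite_subset)
qed

abbreviation polys :: "'v set \<Rightarrow> ('v, 'k::field) mpoly set" where
  "polys V \<equiv> carrier (poly_ring V)"

lemma polys_iff: "p \<in> polys V \<longleftrightarrow> (\<forall>m\<in>keys p. keys m \<subseteq> V)"
  by (simp add: poly_ring_def)

lemma polys_closed [simp, intro]:
  fixes p q :: "('v, 'k::field) mpoly"
  shows
  "(0 :: ('v, 'k) mpoly) \<in> polys V" "(1 :: ('v, 'k) mpoly) \<in> polys V"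
  "p \<in> polys V \<Longrightarrow> q \<in> polys V \<Longrightarrow> p + q \<in> polys V"
  "p \<in> polys V \<Longrightarrow> q \<in> polys V \<Longrightarrow> p * q \<in> polys V"
  "p \<in> polys V \<Longrightarrow> - p \<in> polys V"
  "p \<in> polys V \<Longrightarrow> q \<in> polys V \<Longrightarrow> p - q \<in> polys V"
proof -
  interpret cring "poly_ring V :: ('v, 'k) mpoly ring" by (rule cring_poly_ring)
  show "(0 :: ('v, 'k) mpoly) \<in> polys V" "(1 :: ('v, 'k) mpoly) \<in> polys V"
    "p \<in> polys V \<Longrightarrow> q \<in> polys V \<Longrightarrow> p + q \<in> polys V"
    "p \<in> polys V \<Longrightarrow> q \<in> polys V \<Longrightarrow> p * q \<in> polys V"
    using zero_closed one_closed add.m_closed[of p q] m_closed[of p q] by simp_all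
  show neg: "p \<in> polys V \<Longrightarrow> - p \<in> polys V" for p :: "('v, 'k) mpoly"
    by (simp add: polys_iff keys_def)
  show "p \<in> polys V \<Longrightarrow> q \<in> polys V \<Longrightarrow> p - q \<in> polys V"
    using add.m_closed[of p "- q"] neg[of q] by simp
qed

lemma polys_sum: "(\<And>x. x \<in> A \<Longrightarrow> f x \<in> polys V) \<Longrightarrow> sum f A \<in> polys V"
  by (induction A rule: infinite_finite_induct) auto

lemma single_in_polys [simp]: "keys m \<subseteq> V \<Longrightarrow> single m k \<in> polys V"
  by (auto simp: polys_iff)

lemma var_in_polys [simp]: "v \<in> V \<Longrightarrow> var v \<in> polys V"
  unfolding var_def by (rule single_in_polys) auto

lemma homogeneous_0 [simp]: "homogeneous j 0"
  by (simp add: homogeneous_def)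

lemma homogeneous_add: "homogeneous j p \<Longrightarrow> homogeneous j q \<Longrightarrow> homogeneous j (p + q)"
  using keys_add[of p q] unfolding homogeneous_def by blast

lemma homogeneous_mult:
  assumes "homogeneous i p" "homogeneous j q" shows "homogeneous (i + j) (p * q)"
  unfolding homogeneous_def
proof
  fix m assume "m \<in> keys (p * q)"
  then obtain a b where "a \<in> keys p" "b \<in> keys q" "m = a + b" using keys_mult[of p q] by blast
  then show "int (mdeg m) = i + j" using assms by (simp add: homogeneous_def mdeg_add)
qed

lemma homogeneous_single: "int (mdeg m) = j \<Longrightarrow> homogeneous j (single m k)"
  by (auto simp: homogeneous_def)

lemma homogeneous_const_mult: "homogeneous j p \<Longrightarrow> homogeneous j (single 0 k * p)"
  using homogeneous_mult[OF homogeneous_single[of 0 0 k], of j p] by simp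

lemma homogeneous_var [simp]: "homogeneous 1 (var v)"
  by (simp add: var_def homogeneous_single)

definition hpart :: "int \<Rightarrow> ('v, 'k::field) mpoly \<Rightarrow> ('v, 'k) mpoly" where
  "hpart j p = Poly_Mapping.mapp (\<lambda>m c. if int (mdeg m) = j then c else 0) p"

lemma lookup_hpart: "lookup (hpart j p) m = (if int (mdeg m) = j then lookup p m else 0)"
  by (simp add: hpart_def lookup_mapp in_keys_iff when_def)

lemma keys_hpart: "keys (hpart j p) = {m \<in> keys p. int (mdeg m) = j}"
  by (auto simp: in_keys_iff lookup_hpart split: if_splits)

lemma hpart_0 [simp]: "hpart j 0 = 0"
  by (rule poly_mapping_eqI) (simp add: lookup_hpart)

lemma hpart_in_polys [simp]: "p \<in> polys V \<Longrightarrow> hpart j p \<in> polys V"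
  by (auto simp: polys_iff keys_hpart)

lemma homogeneous_hpart [simp]: "homogeneous j (hpart j p)"
  by (simp add: homogeneous_def keys_hpart)

lemma hpart_homogeneous: "homogeneous i p \<Longrightarrow> hpart j p = (if i = j then p else 0)"
proof (rule poly_mapping_eqI)
  fix m
  assume "homogeneous i p"
  then have "lookup p m = 0 \<or> int (mdeg m) = i" by (auto simp: homogeneous_def in_keys_iff)
  then show "lookup (hpart j p) m = lookup (if i = j then p else 0) m" by (auto simp: lookup_hpart)
qed

lemma hpart_add: "hpart j (p + q) = hpart j p + hpart j q"
  by (rule poly_mapping_eqI) (simp add: lookup_hpart lookup_add)

lemma hpart_sum: "hpart j (sum f A) = (\<Sum>x\<in>A. hpart j (f x))"
  by (induction A rule: infinite_finite_induct) (auto simp: hpart_add)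

lemma sum_hpart:
  assumes "finite T" "(\<lambda>m. int (mdeg m)) ` keys p \<subseteq> T"
  shows "(\<Sum>j\<in>T. hpart j p) = p"
proof (rule poly_mapping_eqI)
  fix m
  have "(\<Sum>j\<in>T. lookup (hpart j p) m) = (if int (mdeg m) \<in> T then lookup p m else 0)"
    using assms(1) by (simp add: lookup_hpart)
  then show "lookup (\<Sum>j\<in>T. hpart j p) m = lookup p m"
    using assms(2) by (cases "m \<in> keys p") (auto simp: lookup_sum in_keys_iff)
qed

lemma hpart_mult_homogeneous:
  fixes p q :: "('v, 'k::field) mpoly"
  assumes "homogeneous i q" shows "hpart j (q * p) = q * hpart (j - i) p"
proof -
  \<comment> \<open>The degree j - i is put in even if p has no term of that degree, so that the sum
    over \<open>T\<close> below picks out exactly one summand.\<close>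
  define T where "T = (\<lambda>m. int (mdeg m)) ` keys p \<union> {j - i}"
  have T: "finite T" "(\<lambda>m. int (mdeg m)) ` keys p \<subseteq> T" "j - i \<in> T" by (auto simp: T_def)
  have "hpart j (q * p) = hpart j (q * (\<Sum>t\<in>T. hpart t p))" using sum_hpart[OF T(1,2)] by simp
  also have "\<dots> = (\<Sum>t\<in>T. hpart j (q * hpart t p))" by (simp add: sum_distrib_left hpart_sum)
  also have "\<dots> = (\<Sum>t\<in>T. if t = j - i then q * hpart t p else 0)"
    by (intro sum.cong refl)
      (auto simp: hpart_homogeneous[OF homogeneous_mult[OF assms homogeneous_hpart]])
  also have "\<dots> = q * hpart (j - i) p" using T by simp
  finally show ?thesis .
qed

section \<open>Signed boundaries\<close>

text \<open>The signs only need an orientation of every pair of variables, not a linear order.\<close>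

definition orientation :: "('v \<times> 'v) set" where
  "orientation = (SOME r. \<forall>u v. u \<noteq> v \<longrightarrow> ((u, v) \<in> r) \<noteq> ((v, u) \<in> r))"

lemma orientation: "u \<noteq> v \<Longrightarrow> (u, v) \<in> orientation \<longleftrightarrow> (v, u) \<notin> orientation"
proof -
  obtain r :: "('a \<times> 'a) set" where r: "well_order_on UNIV r"
    using well_order_on by blast
  then have "\<forall>u v. u \<noteq> v \<longrightarrow> ((u, v) \<in> r) \<noteq> ((v, u) \<in> r)"
    unfolding well_order_on_def linear_order_on_def partial_order_on_def total_on_def antisym_def
    by blast
  from someI[of "\<lambda>r. \<forall>u v. u \<noteq> v \<longrightarrow> ((u, v) \<in> r) \<noteq> ((v, u) \<in> r)", OF this]
  show "u \<noteq> v \<Longrightarrow> ?thesis" unfolding orientation_def by blast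
qed

definition ksgn :: "'v \<Rightarrow> 'v set \<Rightarrow> 'a::comm_ring_1" where
  "ksgn v \<sigma> = (- 1) ^ card {u \<in> \<sigma>. (u, v) \<in> orientation}"

lemma ksgn_square [simp]:
  fixes a :: "'a::comm_ring_1"
  shows "ksgn v \<sigma> * ksgn v \<sigma> = (1::'a)" "ksgn v \<sigma> * (ksgn v \<sigma> * a) = a"
proof -
  show *: "ksgn v \<sigma> * ksgn v \<sigma> = (1::'a)"
    by (simp add: ksgn_def power_add[symmetric] mult_2[symmetric])
  show "ksgn v \<sigma> * (ksgn v \<sigma> * a) = a" by (simp add: mult.assoc[symmetric] *)
qed

lemma ksgn_empty [simp]: "ksgn v {} = 1"
  by (simp add: ksgn_def)

lemma ksgn_Un:
  assumes "finite \<sigma>" "finite \<tau>" "\<sigma> \<inter> \<tau> = {}"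
  shows "(ksgn v (\<sigma> \<union> \<tau>) :: 'a::comm_ring_1) = ksgn v \<sigma> * ksgn v \<tau>"
proof -
  have "{u \<in> \<sigma> \<union> \<tau>. (u, v) \<in> orientation}
      = {u \<in> \<sigma>. (u, v) \<in> orientation} \<union> {u \<in> \<tau>. (u, v) \<in> orientation}" by auto
  moreover have "card \<dots> = card {u \<in> \<sigma>. (u, v) \<in> orientation} + card {u \<in> \<tau>. (u, v) \<in> orientation}"
    using assms by (intro card_Un_disjoint) auto
  ultimately show ?thesis by (simp add: ksgn_def power_add)
qed

lemma ksgn_insert:
  assumes "finite \<sigma>" "u \<notin> \<sigma>"
  shows "(ksgn v (insert u \<sigma>) :: 'a::comm_ring_1) = (if (u, v) \<in> orientation then - ksgn v \<sigma> else ksgn v \<sigma>)"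
proof -
  have "ksgn v {u} = (if (u, v) \<in> orientation then - 1 else (1::'a))"
  proof (cases "(u, v) \<in> orientation")
    case True
    then have "{w \<in> {u}. (w, v) \<in> orientation} = {u}" by auto
    then show ?thesis using True by (simp add: ksgn_def)
  next
    case False
    then have "card {w \<in> {u}. (w, v) \<in> orientation} = 0" by (simp add: card_eq_0_iff)
    then show ?thesis using False by (simp only: ksgn_def power_0 if_False)
  qed
  then show ?thesis using ksgn_Un[of "{u}" \<sigma> v, where 'a = 'a] assms by simp
qed

text \<open>Exactly one of (u, v) and (v, u) is in \<open>orientation\<close>, so exactly one of the
  two orders of insertion changes a sign. This makes the boundary square to zero.\<close>

lemma ksgn_swap:
  assumes "finite \<sigma>" "u \<noteq> v" "u \<notin> \<sigma>" "v \<notin> \<sigma>"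
  shows "ksgn v \<sigma> * ksgn u (insert v \<sigma>) = - (ksgn u \<sigma> * ksgn v (insert u \<sigma>) :: 'a::comm_ring_1)"
  using assms orientation[of u v] by (simp add: ksgn_insert mult.commute)

text \<open>The coefficient of the boundary of c at \<rho>, collected from the faces with one more
  vertex. Leaving x open covers both complexes in use: x = \<open>var\<close> gives the Koszul
  differential, x = 1 the simplicial boundary.\<close>

definition kbd :: "('v \<Rightarrow> 'a::comm_ring_1) \<Rightarrow> 'v set \<Rightarrow> ('v set \<Rightarrow> 'a) \<Rightarrow> 'v set \<Rightarrow> 'a" where
  "kbd x V c \<rho> = (\<Sum>v\<in>V - \<rho>. ksgn v \<rho> * x v * c (insert v \<rho>))"

lemma kbd_eq_0: "(\<And>v. v \<in> V - \<rho> \<Longrightarrow> c (insert v \<rho>) = 0) \<Longrightarrow> kbd x V c \<rho> = 0"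
  unfolding kbd_def by (rule sum.neutral) simp

lemma kbd_nonzero: "kbd x V c \<rho> \<noteq> 0 \<Longrightarrow> \<exists>v\<in>V - \<rho>. c (insert v \<rho>) \<noteq> 0"
  using kbd_eq_0[of V \<rho> c x] by auto

lemma kbd_cong:
  "(\<And>v. v \<in> V - \<rho> \<Longrightarrow> c (insert v \<rho>) = d (insert v \<rho>)) \<Longrightarrow> kbd x V c \<rho> = kbd x V d \<rho>"
  unfolding kbd_def by (rule sum.cong) simp_all

lemma kbd_add: "kbd x V (\<lambda>\<sigma>. c \<sigma> + d \<sigma>) \<rho> = kbd x V c \<rho> + kbd x V d \<rho>"
  by (simp add: kbd_def algebra_simps sum.distrib)

lemma kbd_diff: "kbd x V (\<lambda>\<sigma>. c \<sigma> - d \<sigma>) \<rho> = kbd x V c \<rho> - kbd x V d \<rho>"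
  by (simp add: kbd_def algebra_simps sum_subtractf)

lemma kbd_mult: "kbd x V (\<lambda>\<sigma>. a * c \<sigma>) \<rho> = a * kbd x V c \<rho>"
  by (simp add: kbd_def algebra_simps sum_distrib_left)

lemma kbd_sum: "kbd x V (\<lambda>\<sigma>. \<Sum>i\<in>A. c i \<sigma>) \<rho> = (\<Sum>i\<in>A. kbd x V (c i) \<rho>)"
  by (induction A rule: infinite_finite_induct) (auto simp: kbd_add kbd_eq_0)

lemma sum_antisymmetric:
  fixes g :: "'v \<Rightarrow> 'v \<Rightarrow> 'a::ab_group_add"
  assumes "finite A" "\<And>v. v \<in> A \<Longrightarrow> g v v = 0"
    "\<And>u v. u \<in> A \<Longrightarrow> v \<in> A \<Longrightarrow> u \<noteq> v \<Longrightarrow> g u v = - g v u"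
  shows "(\<Sum>v\<in>A. \<Sum>u\<in>A. g v u) = 0"
  using assms
proof (induction A rule: finite_induct)
  case empty
  show ?case by (rule sum.empty)
next
  case (insert a A)
  have "(\<Sum>v\<in>A. g v a) = (\<Sum>v\<in>A. - g a v)"
    by (intro sum.cong refl insert.prems(2)) (use insert.hyps in auto)
  moreover have "(\<Sum>v\<in>A. \<Sum>u\<in>A. g v u) = 0"
    by (rule insert.IH) (blast intro: insert.prems)+
  ultimately show ?case
    using insert.hyps insert.prems(1)[of a] by (simp add: sum.distrib sum_negf)
qed

lemma kbd_kbd:
  fixes c :: "'v set \<Rightarrow> 'a::comm_ring_1"
  assumes V: "finite V" and \<rho>: "finite \<rho>"
  shows "kbd x V (kbd x V c) \<rho> = 0"
proof -
  \<comment> \<open>The diagonal is filled with 0 so that both indices run over the same set and the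
    double sum is antisymmetric.\<close>
  define g where "g v u = (if u = v then 0 else
    ksgn v \<rho> * x v * (ksgn u (insert v \<rho>) * x u * c (insert u (insert v \<rho>))))" for v u
  have "ksgn v \<rho> * x v * kbd x V c (insert v \<rho>) = (\<Sum>u\<in>V - \<rho>. g v u)" if v: "v \<in> V - \<rho>" for v
  proof -
    have "(\<Sum>u\<in>V - \<rho>. g v u) = g v v + (\<Sum>u\<in>V - \<rho> - {v}. g v u)"
      using v V by (intro sum.remove) auto
    moreover have "V - insert v \<rho> = V - \<rho> - {v}" by auto
    ultimately show ?thesis
      unfolding kbd_def sum_distrib_left by (auto simp: g_def intro!: sum.cong)
  qed
  then have "kbd x V (kbd x V c) \<rho> = (\<Sum>v\<in>V - \<rho>. \<Sum>u\<in>V - \<rho>. g v u)"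
    unfolding kbd_def[of x V "kbd x V c"] by simp
  also have "\<dots> = 0"
  proof (rule sum_antisymmetric)
    fix u v assume *: "u \<in> V - \<rho>" "v \<in> V - \<rho>" "u \<noteq> v"
    have "g u v = (ksgn u \<rho> * ksgn v (insert u \<rho>)) * (x u * x v * c (insert u (insert v \<rho>)))"
      using * by (simp add: g_def insert_commute algebra_simps)
    also have "\<dots> = - (ksgn v \<rho> * ksgn u (insert v \<rho>)) * (x u * x v * c (insert u (insert v \<rho>)))"
      using ksgn_swap[OF \<rho>, of v u, where 'a = 'a] * by simp
    also have "\<dots> = - g v u"
      using * by (simp add: g_def insert_commute algebra_simps)
    finally show "g u v = - g v u" .
  qed (use V in \<open>auto simp: g_def\<close>)
  finally show ?thesis .
qed

section \<open>Homology of families of faces\<close>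

abbreviation bd :: "'v set \<Rightarrow> ('v set \<Rightarrow> 'k::comm_ring_1) \<Rightarrow> 'v set \<Rightarrow> 'k" where
  "bd \<equiv> kbd (\<lambda>_. 1)"

definition kchains :: "'v set set \<Rightarrow> nat \<Rightarrow> ('v set \<Rightarrow> 'k::comm_ring_1) set" where
  "kchains X i = {a. \<forall>\<sigma>. a \<sigma> \<noteq> 0 \<longrightarrow> \<sigma> \<in> X \<and> card \<sigma> = i}"

text \<open>Faces are graded by cardinality, so the empty face sits in degree 0.  The family \<open>X\<close> need not
  be a simplicial complex: for a difference of two complexes this is relative homology.\<close>

definition exact_at :: "'k::field itself \<Rightarrow> 'v set \<Rightarrow> 'v set set \<Rightarrow> nat \<Rightarrow> bool" where
  "exact_at K V X i \<longleftrightarrow> (\<forall>a::'v set \<Rightarrow> 'k. a \<in> kchains X i \<and> (\<forall>\<rho>\<in>X. bd V a \<rho> = 0) \<longrightarrow>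
     (\<exists>b\<in>kchains X (Suc i). \<forall>\<rho>\<in>X. bd V b \<rho> = a \<rho>))"

lemma exact_atI:
  assumes "\<And>a::'v set \<Rightarrow> 'k::field. a \<in> kchains X i \<Longrightarrow> (\<And>\<rho>. \<rho> \<in> X \<Longrightarrow> bd V a \<rho> = 0) \<Longrightarrow>
     \<exists>b\<in>kchains X (Suc i). \<forall>\<rho>\<in>X. bd V b \<rho> = a \<rho>"
  shows "exact_at TYPE('k) V X i"
  using assms unfolding exact_at_def by blast

lemma exact_atE:
  fixes a :: "'v set \<Rightarrow> 'k::field"
  assumes "exact_at TYPE('k) V X i" "a \<in> kchains X i" "\<forall>\<rho>\<in>X. bd V a \<rho> = 0"
  shows "\<exists>b. b \<in> kchains X (Suc i) \<and> (\<forall>\<rho>. \<rho> \<in> X \<longrightarrow> bd V b \<rho> = a \<rho>)"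
  using assms unfolding exact_at_def by blast

lemma kchainsD: "a \<in> kchains X i \<Longrightarrow> a \<sigma> \<noteq> 0 \<Longrightarrow> \<sigma> \<in> X \<and> card \<sigma> = i"
  by (simp add: kchains_def)

lemma kchains_add: "a \<in> kchains X i \<Longrightarrow> b \<in> kchains X i \<Longrightarrow> (\<lambda>\<sigma>. a \<sigma> + b \<sigma>) \<in> kchains X i"
  unfolding kchains_def mem_Collect_eq by (metis add_0 diff_zero)

lemma kchains_diff: "a \<in> kchains X i \<Longrightarrow> b \<in> kchains X i \<Longrightarrow> (\<lambda>\<sigma>. a \<sigma> - b \<sigma>) \<in> kchains X i"
  unfolding kchains_def mem_Collect_eq by (metis diff_zero)

lemma kchains_mono: "a \<in> kchains X i \<Longrightarrow> X \<subseteq> Y \<Longrightarrow> a \<in> kchains Y i"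
  by (auto simp: kchains_def)

definition face_closed :: "'v set set \<Rightarrow> bool" where
  "face_closed X \<longleftrightarrow> (\<forall>\<sigma>\<in>X. \<forall>\<rho>\<subseteq>\<sigma>. \<rho> \<in> X)"

lemma bd_kchains:
  assumes "finite V" "X \<subseteq> Pow V" "a \<in> kchains X (Suc i)" "bd V a \<rho> \<noteq> 0"
  shows "\<exists>v\<in>V - \<rho>. insert v \<rho> \<in> X" "card \<rho> = i" "finite \<rho>"
proof -
  obtain v where v: "v \<in> V - \<rho>" "a (insert v \<rho>) \<noteq> 0" using kbd_nonzero[OF assms(4)] by blast
  then have *: "insert v \<rho> \<in> X" "card (insert v \<rho>) = Suc i" using assms(3) by (auto simp: kchains_def)
  then show "\<exists>v\<in>V - \<rho>. insert v \<rho> \<in> X" using v by blast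
  have "insert v \<rho> \<subseteq> V" using * assms(2) by auto
  then show "finite \<rho>" using assms(1) by (auto dest: finite_subset)
  then show "card \<rho> = i" using * v by auto
qed

lemma bd_kchains_0:
  assumes "finite V" "X \<subseteq> Pow V" "a \<in> kchains X 0" shows "bd V a \<rho> = 0"
proof (rule ccontr)
  assume "bd V a \<rho> \<noteq> 0"
  then obtain v where "a (insert v \<rho>) \<noteq> 0" using kbd_nonzero by blast
  then have *: "insert v \<rho> \<in> X" "card (insert v \<rho>) = 0" using assms(3) by (auto simp: kchains_def)
  then have "insert v \<rho> \<subseteq> V" using assms(2) by auto
  then have "finite (insert v \<rho>)" using assms(1) by (rule finite_subset)
  then show False using * by simp
qed

section \<open>The long exact sequence of a pair of complexes\<close>

locale face_pair =
  fixes K :: "'k::field itself" and V :: "'v set" and A B :: "'v set set"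
  assumes finV: "finite V" and AB: "A \<subseteq> B" and BV: "B \<subseteq> Pow V"
    and closedA: "face_closed A" and closedB: "face_closed B"
begin

lemma subfaceA: "\<sigma> \<in> A \<Longrightarrow> \<rho> \<subseteq> \<sigma> \<Longrightarrow> \<rho> \<in> A" and subfaceB: "\<sigma> \<in> B \<Longrightarrow> \<rho> \<subseteq> \<sigma> \<Longrightarrow> \<rho> \<in> B"
  using closedA closedB by (auto simp: face_closed_def)

lemma AV: "A \<subseteq> Pow V" and QV: "B - A \<subseteq> Pow V" using AB BV by auto

lemma bd_bd: "\<rho> \<in> B \<Longrightarrow> bd V (bd V a) \<rho> = (0::'k)"
  using BV finV by (intro kbd_kbd) (auto intro: finite_subset)

lemma bd_supp:
  fixes a :: "'v set \<Rightarrow> 'k"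
  shows "a \<in> kchains A (Suc i) \<Longrightarrow> bd V a \<in> kchains A i" "a \<in> kchains B (Suc i) \<Longrightarrow> bd V a \<in> kchains B i"
proof -
  show "bd V a \<in> kchains A i" if a: "a \<in> kchains A (Suc i)"
    using bd_kchains[OF finV AV a] subfaceA unfolding kchains_def by blast
  show "bd V a \<in> kchains B i" if a: "a \<in> kchains B (Suc i)"
    using bd_kchains[OF finV BV a] subfaceB unfolding kchains_def by blast
qed

text \<open>Chains on \<open>B - A\<close> stand for chains on \<open>B\<close> modulo chains on
  \<open>A\<close>; this is the projection.\<close>

definition rel :: "('v set \<Rightarrow> 'k) \<Rightarrow> 'v set \<Rightarrow> 'k" where
  "rel b \<sigma> = (if \<sigma> \<in> A then 0 else b \<sigma>)"

lemma rel_kchains: "b \<in> kchains B i \<Longrightarrow> rel b \<in> kchains (B - A) i"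
  by (auto simp: kchains_def rel_def)

lemma bd_rel: "\<rho> \<in> B - A \<Longrightarrow> bd V (rel b) \<rho> = bd V b \<rho>"
  by (rule kbd_cong) (auto simp: rel_def dest: subfaceA[of _ \<rho>])

lemma bd_kchains_A: "(a::'v set \<Rightarrow> 'k) \<in> kchains A i \<Longrightarrow> \<rho> \<in> B - A \<Longrightarrow> bd V a \<rho> = 0"
  by (rule kbd_eq_0) (auto simp: kchains_def dest: subfaceA[of _ \<rho>])

lemma kchains_A_iff: "a \<in> kchains A i \<longleftrightarrow> a \<in> kchains B i \<and> (\<forall>\<sigma>\<in>B - A. a \<sigma> = 0)"
  using AB by (auto simp: kchains_def)

text \<open>The piece H_(i+1)(B, A) -> H_i(A) -> H_i(B). A primitive b of the cycle on
  \<open>B\<close> is a relative cycle; subtracting the boundary of a relative primitive q pushes b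
  into \<open>A\<close>.\<close>

lemma exact_at_sub:
  assumes "exact_at TYPE('k) V B i" "exact_at TYPE('k) V (B - A) (Suc i)"
  shows "exact_at TYPE('k) V A i"
proof (rule exact_atI)
  fix a :: "'v set \<Rightarrow> 'k"
  assume a: "a \<in> kchains A i" "\<And>\<rho>. \<rho> \<in> A \<Longrightarrow> bd V a \<rho> = 0"
  have "a \<in> kchains B i" "\<And>\<rho>. \<rho> \<in> B \<Longrightarrow> bd V a \<rho> = 0"
    using a kchains_A_iff bd_kchains_A by blast+
  then obtain b where b: "b \<in> kchains B (Suc i)" "\<And>\<rho>. \<rho> \<in> B \<Longrightarrow> bd V b \<rho> = a \<rho>"
    using exact_atE[OF assms(1)] by blast
  have "bd V (rel b) \<rho> = 0" if "\<rho> \<in> B - A" for \<rho>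
    using that b(2) a(1) by (auto simp: bd_rel kchains_A_iff)
  with rel_kchains[OF b(1)]
  obtain q where q: "q \<in> kchains (B - A) (Suc (Suc i))" "\<And>\<rho>. \<rho> \<in> B - A \<Longrightarrow> bd V q \<rho> = rel b \<rho>"
    using exact_atE[OF assms(2)] by blast
  then have "q \<in> kchains B (Suc (Suc i))" by (auto intro: kchains_mono)
  then have "(\<lambda>\<sigma>. b \<sigma> - bd V q \<sigma>) \<in> kchains B (Suc i)" by (intro kchains_diff b bd_supp)
  then have "(\<lambda>\<sigma>. b \<sigma> - bd V q \<sigma>) \<in> kchains A (Suc i)"
    using q(2) by (auto simp: kchains_A_iff rel_def)
  moreover have "bd V (\<lambda>\<sigma>. b \<sigma> - bd V q \<sigma>) \<rho> = a \<rho>" if "\<rho> \<in> A" for \<rho>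
    using that b(2) bd_bd[of \<rho> q] AB by (auto simp: kbd_diff)
  ultimately show "\<exists>b\<in>kchains A (Suc i). \<forall>\<rho>\<in>A. bd V b \<rho> = a \<rho>" by blast
qed

text \<open>The piece H_i(A) -> H_i(B) -> H_i(B, A). A cycle on \<open>B\<close> is first moved into
  \<open>A\<close> by the boundary of a relative primitive and then bounded there.\<close>

lemma exact_at_total:
  assumes "exact_at TYPE('k) V A i" "exact_at TYPE('k) V (B - A) i"
  shows "exact_at TYPE('k) V B i"
proof (rule exact_atI)
  fix a :: "'v set \<Rightarrow> 'k"
  assume a: "a \<in> kchains B i" "\<And>\<rho>. \<rho> \<in> B \<Longrightarrow> bd V a \<rho> = 0"
  have "bd V (rel a) \<rho> = 0" if "\<rho> \<in> B - A" for \<rho> using a that by (simp add: bd_rel)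
  with rel_kchains[OF a(1)]
  obtain q where q: "q \<in> kchains (B - A) (Suc i)" "\<And>\<rho>. \<rho> \<in> B - A \<Longrightarrow> bd V q \<rho> = rel a \<rho>"
    using exact_atE[OF assms(2)] by blast
  have qB: "q \<in> kchains B (Suc i)" using q by (auto intro: kchains_mono)
  have "(\<lambda>\<sigma>. a \<sigma> - bd V q \<sigma>) \<in> kchains B i" by (intro kchains_diff a bd_supp qB)
  then have "(\<lambda>\<sigma>. a \<sigma> - bd V q \<sigma>) \<in> kchains A i"
    using q(2) by (auto simp: kchains_A_iff rel_def)
  moreover have "bd V (\<lambda>\<sigma>. a \<sigma> - bd V q \<sigma>) \<rho> = 0" if "\<rho> \<in> A" for \<rho>
    using that a(2) bd_bd[of \<rho> q] AB by (auto simp: kbd_diff)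
  ultimately obtain b where b: "b \<in> kchains A (Suc i)" "\<And>\<rho>. \<rho> \<in> A \<Longrightarrow> bd V b \<rho> = a \<rho> - bd V q \<rho>"
    using exact_atE[OF assms(1)] by blast
  have "(\<lambda>\<sigma>. q \<sigma> + b \<sigma>) \<in> kchains B (Suc i)"
    using qB b(1) kchains_A_iff by (blast intro: kchains_add)
  moreover have "bd V (\<lambda>\<sigma>. q \<sigma> + b \<sigma>) \<rho> = a \<rho>" if "\<rho> \<in> B" for \<rho>
    using that b q(2)[of \<rho>] bd_kchains_A[OF b(1), of \<rho>] by (cases "\<rho> \<in> A") (auto simp: kbd_add rel_def)
  ultimately show "\<exists>b\<in>kchains B (Suc i). \<forall>\<rho>\<in>B. bd V b \<rho> = a \<rho>" by blast
qed

text \<open>The piece H_(i+1)(B) -> H_(i+1)(B, A) -> H_i(A): the boundary of q is a cycle on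
  \<open>A\<close>, and subtracting a chain on \<open>A\<close> with the same boundary makes q an
  absolute cycle. Read backwards, a relative cycle without a lift detects homology of
  \<open>A\<close>.\<close>

lemma lift_relative_cycle:
  assumes "exact_at TYPE('k) V A i" "q \<in> kchains (B - A) (Suc i)" "\<And>\<rho>. \<rho> \<in> B - A \<Longrightarrow> bd V q \<rho> = 0"
  shows "\<exists>b\<in>kchains B (Suc i). (\<forall>\<rho>\<in>B. bd V b \<rho> = (0::'k)) \<and> (\<forall>\<sigma>\<in>B - A. b \<sigma> = q \<sigma>)"
proof -
  have qB: "q \<in> kchains B (Suc i)" using assms by (auto intro: kchains_mono)
  have "bd V q \<in> kchains A i" using bd_supp(2)[OF qB] assms(3) by (auto simp: kchains_A_iff)
  moreover have "bd V (bd V q) \<rho> = 0" if "\<rho> \<in> A" for \<rho> using that AB bd_bd by auto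
  ultimately obtain a where a: "a \<in> kchains A (Suc i)" "\<And>\<rho>. \<rho> \<in> A \<Longrightarrow> bd V a \<rho> = bd V q \<rho>"
    using exact_atE[OF assms(1)] by blast
  have "(\<lambda>\<sigma>. q \<sigma> - a \<sigma>) \<in> kchains B (Suc i)"
    using qB a(1) kchains_A_iff by (blast intro: kchains_diff)
  moreover have "bd V (\<lambda>\<sigma>. q \<sigma> - a \<sigma>) \<rho> = 0" if "\<rho> \<in> B" for \<rho>
    using that a assms(3)[of \<rho>] bd_kchains_A[OF a(1), of \<rho>] by (cases "\<rho> \<in> A") (auto simp: kbd_diff)
  moreover have "q \<sigma> - a \<sigma> = q \<sigma>" if "\<sigma> \<in> B - A" for \<sigma>
    using a(1) that by (auto simp: kchains_def)
  ultimately show ?thesis by blast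
qed

text \<open>The piece H_i(B) -> H_i(B, A) -> H_(i-1)(A). For i = 0 the last term is zero, hence the
  guarded hypothesis.\<close>

lemma exact_at_quot:
  assumes "exact_at TYPE('k) V B i" "i \<noteq> 0 \<Longrightarrow> exact_at TYPE('k) V A (i - 1)"
  shows "exact_at TYPE('k) V (B - A) i"
proof (rule exact_atI)
  fix q :: "'v set \<Rightarrow> 'k"
  assume q: "q \<in> kchains (B - A) i" "\<And>\<rho>. \<rho> \<in> B - A \<Longrightarrow> bd V q \<rho> = 0"
  have "\<exists>b\<in>kchains B i. (\<forall>\<rho>\<in>B. bd V b \<rho> = 0) \<and> (\<forall>\<sigma>\<in>B - A. b \<sigma> = q \<sigma>)"
  proof (cases i)
    case 0
    then have "q \<in> kchains B 0" using q by (auto intro: kchains_mono)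
    then show ?thesis using bd_kchains_0[OF finV BV] 0 by blast
  next
    case (Suc j)
    then show ?thesis using lift_relative_cycle[of j q] assms(2) q by simp
  qed
  then obtain b where b: "b \<in> kchains B i" "\<And>\<rho>. \<rho> \<in> B \<Longrightarrow> bd V b \<rho> = 0"
    "\<And>\<sigma>. \<sigma> \<in> B - A \<Longrightarrow> b \<sigma> = q \<sigma>" by blast
  from b(1,2) obtain c where c: "c \<in> kchains B (Suc i)" "\<And>\<rho>. \<rho> \<in> B \<Longrightarrow> bd V c \<rho> = b \<rho>"
    using exact_atE[OF assms(1)] by blast
  have "bd V (rel c) \<rho> = q \<rho>" if "\<rho> \<in> B - A" for \<rho>
    using that b(3)[of \<rho>] c(2)[of \<rho>] bd_rel[of \<rho> c] by simp
  then show "\<exists>b\<in>kchains (B - A) (Suc i). \<forall>\<rho>\<in>B - A. bd V b \<rho> = q \<rho>"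
    using rel_kchains[OF c(1)] by blast
qed

end

section \<open>Acyclic families: cones, disjoint unions and joins\<close>

lemma bd_cone:
  fixes a :: "'v set \<Rightarrow> 'k::comm_ring_1"
  assumes V: "finite V" "u \<in> V" and \<rho>: "finite \<rho>" and cycle: "u \<in> \<rho> \<Longrightarrow> bd V a (\<rho> - {u}) = 0"
  shows "bd V (\<lambda>\<sigma>. if u \<in> \<sigma> then ksgn u (\<sigma> - {u}) * a (\<sigma> - {u}) else 0) \<rho> = a \<rho>"
    (is "bd V ?b \<rho> = _")
proof (cases "u \<in> \<rho>")
  case False
  have "bd V ?b \<rho> = ksgn u \<rho> * 1 * ?b (insert u \<rho>)
      + (\<Sum>v\<in>V - \<rho> - {u}. ksgn v \<rho> * 1 * ?b (insert v \<rho>))"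
    unfolding kbd_def using V False by (intro sum.remove) auto
  also have "(\<Sum>v\<in>V - \<rho> - {u}. ksgn v \<rho> * 1 * ?b (insert v \<rho>)) = 0"
    using False by (intro sum.neutral) auto
  finally show ?thesis using False by simp
next
  case True
  define \<tau> where "\<tau> = \<rho> - {u}"
  have \<tau>: "\<rho> = insert u \<tau>" "u \<notin> \<tau>" "finite \<tau>" using True \<rho> by (auto simp: \<tau>_def)
  \<comment> \<open>The cycle condition at \<rho> - {u} expresses the value of a at \<rho> by its
    values at faces without u, and these are the values that the cone records.\<close>
  have "0 = ksgn u \<tau> * bd V a \<tau>" using cycle True by (simp add: \<tau>_def)
  also have "\<dots> = ksgn u \<tau> * (ksgn u \<tau> * 1 * a (insert u \<tau>)
      + (\<Sum>v\<in>V - \<tau> - {u}. ksgn v \<tau> * 1 * a (insert v \<tau>)))"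
    unfolding kbd_def using V \<tau> by (subst sum.remove[of _ u]) auto
  also have "\<dots> = a \<rho> + (\<Sum>v\<in>V - \<rho>. ksgn u \<tau> * ksgn v \<tau> * a (insert v \<tau>))"
  proof -
    have "V - \<tau> - {u} = V - \<rho>" using \<tau> by auto
    then show ?thesis using \<tau> by (simp add: distrib_left sum_distrib_left mult.assoc)
  qed
  also have "(\<Sum>v\<in>V - \<rho>. ksgn u \<tau> * ksgn v \<tau> * a (insert v \<tau>)) = - bd V ?b \<rho>"
    unfolding kbd_def sum_negf[symmetric]
  proof (rule sum.cong)
    fix v assume v: "v \<in> V - \<rho>"
    then have nv: "v \<noteq> u" "v \<notin> \<tau>" using \<tau> by auto
    then have eq: "insert v \<rho> - {u} = insert v \<tau>" "u \<in> insert v \<rho>" using \<tau> by auto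
    have "ksgn u \<tau> * ksgn v \<tau> = - (ksgn v \<rho> * ksgn u (insert v \<tau>) :: 'k)"
      using nv \<tau> orientation[of u v] by (simp add: ksgn_insert mult.commute)
    moreover have "u \<in> \<rho>" using \<tau> by simp
    ultimately show "ksgn u \<tau> * ksgn v \<tau> * a (insert v \<tau>) = - (ksgn v \<rho> * 1 * ?b (insert v \<rho>))"
      unfolding eq by (simp add: eq mult.assoc)
  qed simp
  finally show ?thesis by (simp add: eq_neg_iff_add_eq_0 add_eq_0_iff)
qed

text \<open>Coning off u is a contracting homotopy. The closure conditions say only that u can be
  switched on and off, a form that also fits families such as
  \<open>faces V (summand S) \<alpha>\<close>, which are differences of complexes.\<close>

lemma exact_at_cone:
  fixes V :: "'v set"
  assumes V: "finite V" "u \<in> V" "X \<subseteq> Pow V"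
    and X: "\<And>\<rho>. \<rho> \<in> X \<Longrightarrow> insert u \<rho> \<in> X" "\<And>\<rho>. \<rho> \<in> X \<Longrightarrow> \<rho> - {u} \<in> X"
  shows "exact_at TYPE('k::field) V X i"
proof (rule exact_atI)
  fix a :: "'v set \<Rightarrow> 'k"
  assume a: "a \<in> kchains X i" "\<And>\<rho>. \<rho> \<in> X \<Longrightarrow> bd V a \<rho> = 0"
  let ?b = "\<lambda>\<sigma>. if u \<in> \<sigma> then ksgn u (\<sigma> - {u}) * a (\<sigma> - {u}) else 0"
  have "?b \<in> kchains X (Suc i)" unfolding kchains_def
  proof (intro CollectI allI impI)
    fix \<sigma> assume "?b \<sigma> \<noteq> 0"
    then have *: "u \<in> \<sigma>" "a (\<sigma> - {u}) \<noteq> 0" by (auto split: if_splits)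
    then have **: "\<sigma> - {u} \<in> X" "card (\<sigma> - {u}) = i" using a by (auto simp: kchains_def)
    then have "\<sigma> \<in> X" using X(1)[of "\<sigma> - {u}"] * by (simp add: insert_absorb)
    then have "finite \<sigma>" using V by (auto intro: finite_subset)
    then show "\<sigma> \<in> X \<and> card \<sigma> = Suc i" using \<open>\<sigma> \<in> X\<close> **(2) *(1) card_Suc_Diff1[of \<sigma> u] by metis
  qed
  moreover have "bd V ?b \<rho> = a \<rho>" if "\<rho> \<in> X" for \<rho>
  proof (rule bd_cone)
    show "finite \<rho>" using that V by (auto intro: finite_subset)
    show "bd V a (\<rho> - {u}) = 0" using a(2) X(2)[OF that] by blast
  qed (use V in auto)
  ultimately show "\<exists>b\<in>kchains X (Suc i). \<forall>\<rho>\<in>X. bd V b \<rho> = a \<rho>" by blast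
qed

lemma exact_at_no_faces:
  fixes V :: "'v set"
  assumes "\<And>\<sigma>. \<sigma> \<in> X \<Longrightarrow> card \<sigma> \<noteq> i" shows "exact_at TYPE('k::field) V X i"
proof (rule exact_atI)
  fix a :: "'v set \<Rightarrow> 'k" assume "a \<in> kchains X i"
  then have "a = (\<lambda>_. 0)" using assms by (auto simp: kchains_def fun_eq_iff)
  then show "\<exists>b\<in>kchains X (Suc i). \<forall>\<rho>\<in>X. bd V b \<rho> = a \<rho>"
    by (intro bexI[of _ "\<lambda>_. 0"]) (auto simp: kchains_def kbd_eq_0)
qed

text \<open>No face of one part is contained in a face of another, so the boundary map is block
  diagonal and a primitive can be chosen in each part separately.\<close>

lemma exact_at_disjoint_union:
  fixes V :: "'v set"
  assumes X: "X = (\<Union>s\<in>T. Y s)"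
    and comp: "\<And>s \<rho> \<sigma>. s \<in> T \<Longrightarrow> \<rho> \<in> Y s \<Longrightarrow> \<sigma> \<in> X \<Longrightarrow> \<rho> \<subseteq> \<sigma> \<or> \<sigma> \<subseteq> \<rho> \<Longrightarrow> \<sigma> \<in> Y s"
    and disj: "\<And>s t \<rho>. s \<in> T \<Longrightarrow> t \<in> T \<Longrightarrow> \<rho> \<in> Y s \<Longrightarrow> \<rho> \<in> Y t \<Longrightarrow> s = t"
    and ex: "\<And>s. s \<in> T \<Longrightarrow> exact_at TYPE('k::field) V (Y s) i"
  shows "exact_at TYPE('k) V X i"
proof (rule exact_atI)
  fix a :: "'v set \<Rightarrow> 'k"
  assume a: "a \<in> kchains X i" "\<And>\<rho>. \<rho> \<in> X \<Longrightarrow> bd V a \<rho> = 0"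
  define r where "r s \<sigma> = (if \<sigma> \<in> Y s then a \<sigma> else 0)" for s \<sigma>
  have r: "bd V (\<lambda>\<sigma>. if \<sigma> \<in> Y s then c \<sigma> else 0) \<rho> = bd V c \<rho>"
    if "s \<in> T" "\<rho> \<in> Y s" "c \<in> kchains X j" for s \<rho> j and c :: "'v set \<Rightarrow> 'k"
    using that comp[OF that(1,2)] by (intro kbd_cong) (auto simp: kchains_def)
  have "\<exists>b\<in>kchains (Y s) (Suc i). \<forall>\<rho>\<in>Y s. bd V b \<rho> = a \<rho>" if s: "s \<in> T" for s
  proof -
    have "r s \<in> kchains (Y s) i" using a(1) by (auto simp: r_def kchains_def)
    moreover have "bd V (r s) \<rho> = 0" if "\<rho> \<in> Y s" for \<rho>
      using r[OF s that a(1)] a(2)[of \<rho>] that s X unfolding r_def by auto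
    ultimately obtain b where "b \<in> kchains (Y s) (Suc i)" "\<And>\<rho>. \<rho> \<in> Y s \<Longrightarrow> bd V b \<rho> = r s \<rho>"
      using exact_atE[OF ex[OF s]] by blast
    then show ?thesis by (auto simp: r_def)
  qed
  then obtain b where b: "\<And>s. s \<in> T \<Longrightarrow> b s \<in> kchains (Y s) (Suc i)"
    "\<And>s \<rho>. s \<in> T \<Longrightarrow> \<rho> \<in> Y s \<Longrightarrow> bd V (b s) \<rho> = a \<rho>" by metis
  define c where "c \<sigma> = (if \<sigma> \<in> X then b (THE s. s \<in> T \<and> \<sigma> \<in> Y s) \<sigma> else 0)" for \<sigma>
  have c: "c \<sigma> = b s \<sigma>" if "s \<in> T" "\<sigma> \<in> Y s" for s \<sigma>
  proof -
    have "(THE s. s \<in> T \<and> \<sigma> \<in> Y s) = s" using that disj by (intro the_equality) auto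
    then show ?thesis using that X by (auto simp: c_def)
  qed
  have "c \<in> kchains X (Suc i)" unfolding kchains_def
  proof (intro CollectI allI impI)
    fix \<sigma> assume ne: "c \<sigma> \<noteq> 0"
    then have "\<sigma> \<in> X" by (auto simp: c_def split: if_splits)
    then obtain s where s: "s \<in> T" "\<sigma> \<in> Y s" using X by blast
    then have "b s \<sigma> \<noteq> 0" using c ne by simp
    then show "\<sigma> \<in> X \<and> card \<sigma> = Suc i" using b(1)[OF s(1)] \<open>\<sigma> \<in> X\<close> by (auto simp: kchains_def)
  qed
  moreover have "bd V c \<rho> = a \<rho>" if "\<rho> \<in> X" for \<rho>
  proof -
    obtain s where s: "s \<in> T" "\<rho> \<in> Y s" using X \<open>\<rho> \<in> X\<close> by blast
    have "bd V c \<rho> = bd V (b s) \<rho>"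
    proof (rule kbd_cong)
      fix v
      show "c (insert v \<rho>) = b s (insert v \<rho>)"
      proof (cases "insert v \<rho> \<in> X")
        case True
        then have "insert v \<rho> \<in> Y s" using comp[OF s, of "insert v \<rho>"] by auto
        then show ?thesis using c s by simp
      next
        case False
        then have "b s (insert v \<rho>) = 0" using b(1)[OF s(1)] X s by (auto simp: kchains_def)
        then show ?thesis using False by (simp add: c_def)
      qed
    qed
    then show ?thesis using b(2)[OF s] by simp
  qed
  ultimately show "\<exists>b\<in>kchains X (Suc i). \<forall>\<rho>\<in>X. bd V b \<rho> = a \<rho>" by blast
qed

text \<open>Joining a fixed face \<open>\<tau>\<close> changes the signs of the boundary map by this coboundary.\<close>

definition join_sgn :: "'v set \<Rightarrow> 'v set \<Rightarrow> 'a::comm_ring_1" where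
  "join_sgn \<tau> \<rho> = (\<Prod>v\<in>\<rho>. ksgn v \<tau>)"

lemma join_sgn_square [simp]:
  fixes a :: "'a::comm_ring_1"
  shows "join_sgn \<tau> \<rho> * (join_sgn \<tau> \<rho> * a) = a"
proof -
  have "join_sgn \<tau> \<rho> * join_sgn \<tau> \<rho> = (1::'a)"
    by (simp add: join_sgn_def prod.distrib[symmetric])
  then show ?thesis by (simp add: mult.assoc[symmetric])
qed

lemma join_sgn_insert: "finite \<rho> \<Longrightarrow> v \<notin> \<rho> \<Longrightarrow> join_sgn \<tau> (insert v \<rho>) = ksgn v \<tau> * join_sgn \<tau> \<rho>"
  by (simp add: join_sgn_def)

lemma bd_join:
  fixes a :: "'v set \<Rightarrow> 'k::comm_ring_1"
  assumes "finite V" "\<tau> \<subseteq> V" "\<rho> \<subseteq> V - \<tau>"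
  shows "bd (V - \<tau>) (\<lambda>\<rho>. join_sgn \<tau> \<rho> * a (\<tau> \<union> \<rho>)) \<rho> = join_sgn \<tau> \<rho> * bd V a (\<tau> \<union> \<rho>)"
proof -
  have fin: "finite \<rho>" "finite \<tau>" using assms by (auto intro: finite_subset)
  have eq: "V - \<tau> - \<rho> = V - (\<tau> \<union> \<rho>)" by auto
  show ?thesis unfolding kbd_def sum_distrib_left eq
  proof (rule sum.cong)
    fix v assume v: "v \<in> V - (\<tau> \<union> \<rho>)"
    have "\<tau> \<inter> \<rho> = {}" using assms by auto
    then show "ksgn v \<rho> * 1 * (join_sgn \<tau> (insert v \<rho>) * a (\<tau> \<union> insert v \<rho>))
      = join_sgn \<tau> \<rho> * (ksgn v (\<tau> \<union> \<rho>) * 1 * a (insert v (\<tau> \<union> \<rho>)))"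
      using v fin by (simp add: join_sgn_insert ksgn_Un algebra_simps)
  qed simp
qed

text \<open>After rescaling by \<open>join_sgn \<tau>\<close>, the map \<rho> to
  \<open>\<tau> \<union> \<rho>\<close> is an isomorphism of complexes that raises the degree by
  \<open>card \<tau>\<close>.\<close>

lemma exact_at_join:
  fixes V :: "'v set"
  assumes V: "finite V" "\<tau> \<subseteq> V" and Y: "Y \<subseteq> Pow (V - \<tau>)"
    and ex: "exact_at TYPE('k::field) (V - \<tau>) Y i"
  shows "exact_at TYPE('k) V ((\<union>) \<tau> ` Y) (card \<tau> + i)"
proof (rule exact_atI)
  fix a :: "'v set \<Rightarrow> 'k"
  assume a: "a \<in> kchains ((\<union>) \<tau> ` Y) (card \<tau> + i)" "\<And>\<rho>. \<rho> \<in> (\<union>) \<tau> ` Y \<Longrightarrow> bd V a \<rho> = 0"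
  have inY: "\<rho> \<in> Y \<longleftrightarrow> \<tau> \<union> \<rho> \<in> (\<union>) \<tau> ` Y" if "\<rho> \<subseteq> V - \<tau>" for \<rho>
  proof
    assume "\<tau> \<union> \<rho> \<in> (\<union>) \<tau> ` Y"
    then obtain \<rho>' where "\<rho>' \<in> Y" "\<tau> \<union> \<rho> = \<tau> \<union> \<rho>'" by auto
    moreover have "\<rho>' \<subseteq> V - \<tau>" using \<open>\<rho>' \<in> Y\<close> Y by blast
    ultimately have "\<rho> = \<rho>'" using that by blast
    then show "\<rho> \<in> Y" using \<open>\<rho>' \<in> Y\<close> by simp
  qed simp
  have card: "card (\<tau> \<union> \<rho>) = card \<tau> + card \<rho>" if "\<rho> \<subseteq> V - \<tau>" for \<rho>
    using that V by (intro card_Un_disjoint) (auto intro: finite_subset)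
  define a' where "a' \<rho> = (if \<rho> \<subseteq> V - \<tau> then join_sgn \<tau> \<rho> * a (\<tau> \<union> \<rho>) else 0)" for \<rho>
  have bd_if: "bd (V - \<tau>) (\<lambda>\<rho>. if \<rho> \<subseteq> V - \<tau> then c \<rho> else 0) \<rho> = bd (V - \<tau>) c \<rho>"
    if "\<rho> \<subseteq> V - \<tau>" for \<rho> and c :: "'v set \<Rightarrow> 'k"
    using that by (intro kbd_cong) auto
  have "a' \<in> kchains Y i" unfolding kchains_def
  proof (intro CollectI allI impI)
    fix \<rho> assume "a' \<rho> \<noteq> 0"
    then have \<rho>: "\<rho> \<subseteq> V - \<tau>" and ne: "a (\<tau> \<union> \<rho>) \<noteq> 0" by (auto simp: a'_def split: if_splits)
    show "\<rho> \<in> Y \<and> card \<rho> = i" using kchainsD[OF a(1) ne] inY[OF \<rho>] card[OF \<rho>] by simp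
  qed
  moreover have "bd (V - \<tau>) a' \<rho> = 0" if "\<rho> \<in> Y" for \<rho>
  proof -
    have "\<rho> \<subseteq> V - \<tau>" using that Y by blast
    then show ?thesis unfolding a'_def using bd_if bd_join[OF V, of \<rho> a] a(2)[of "\<tau> \<union> \<rho>"] that by simp
  qed
  ultimately obtain b' where b': "b' \<in> kchains Y (Suc i)" "\<And>\<rho>. \<rho> \<in> Y \<Longrightarrow> bd (V - \<tau>) b' \<rho> = a' \<rho>"
    using exact_atE[OF ex] by blast
  define b where "b \<sigma> = (if \<tau> \<subseteq> \<sigma> then join_sgn \<tau> (\<sigma> - \<tau>) * b' (\<sigma> - \<tau>) else 0)" for \<sigma>
  have b: "b (\<tau> \<union> \<rho>) = join_sgn \<tau> \<rho> * b' \<rho>" if "\<rho> \<subseteq> V - \<tau>" for \<rho>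
  proof -
    have "\<tau> \<union> \<rho> - \<tau> = \<rho>" using that by auto
    then show ?thesis by (simp add: b_def)
  qed
  have "b \<in> kchains ((\<union>) \<tau> ` Y) (Suc (card \<tau> + i))" unfolding kchains_def
  proof (intro CollectI allI impI)
    fix \<sigma> assume "b \<sigma> \<noteq> 0"
    then have *: "\<tau> \<subseteq> \<sigma>" "b' (\<sigma> - \<tau>) \<noteq> 0" by (auto simp: b_def split: if_splits)
    then have "\<sigma> - \<tau> \<in> Y" "card (\<sigma> - \<tau>) = Suc i" using b' by (auto simp: kchains_def)
    moreover have "\<sigma> = \<tau> \<union> (\<sigma> - \<tau>)" using * by auto
    ultimately show "\<sigma> \<in> (\<union>) \<tau> ` Y \<and> card \<sigma> = Suc (card \<tau> + i)"
      using card[of "\<sigma> - \<tau>"] Y by auto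
  qed
  moreover have "bd V b \<sigma> = a \<sigma>" if \<sigma>: "\<sigma> \<in> (\<union>) \<tau> ` Y" for \<sigma>
  proof -
    obtain \<rho> where \<rho>: "\<rho> \<in> Y" "\<sigma> = \<tau> \<union> \<rho>" using \<sigma> by blast
    then have sub: "\<rho> \<subseteq> V - \<tau>" using Y by blast
    have "join_sgn \<tau> \<rho> * bd V b (\<tau> \<union> \<rho>) = bd (V - \<tau>) (\<lambda>\<rho>. join_sgn \<tau> \<rho> * b (\<tau> \<union> \<rho>)) \<rho>"
      using bd_join[OF V sub, of b] by simp
    also have "\<dots> = bd (V - \<tau>) b' \<rho>" using sub by (intro kbd_cong) (simp add: b del: Un_insert_right)
    also have "\<dots> = join_sgn \<tau> \<rho> * a (\<tau> \<union> \<rho>)" using b'(2)[OF \<rho>(1)] sub by (simp add: a'_def)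
    finally show ?thesis using join_sgn_square[of \<tau> \<rho>] \<rho>(2) by metis
  qed
  ultimately show "\<exists>b\<in>kchains ((\<union>) \<tau> ` Y) (Suc (card \<tau> + i)). \<forall>\<rho>\<in>(\<union>) \<tau> ` Y. bd V b \<rho> = a \<rho>" by blast
qed

section \<open>Multigraded strands\<close>

definition face_mon :: "'v set \<Rightarrow> ('v \<Rightarrow>\<^sub>0 nat)" where
  "face_mon \<sigma> = (\<Sum>v\<in>\<sigma>. single v 1)"

lemma lookup_face_mon: "finite \<sigma> \<Longrightarrow> lookup (face_mon \<sigma>) v = of_bool (v \<in> \<sigma>)"
  by (simp add: face_mon_def lookup_sum lookup_single when_def)

lemma face_mon_empty [simp]: "face_mon {} = 0" by (simp add: face_mon_def)

lemma face_mon_insert: "finite \<sigma> \<Longrightarrow> v \<notin> \<sigma> \<Longrightarrow> face_mon (insert v \<sigma>) = single v 1 + face_mon \<sigma>"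
  by (simp add: face_mon_def)

lemma keys_face_mon: "finite \<sigma> \<Longrightarrow> keys (face_mon \<sigma>) = \<sigma>"
  by (auto simp: in_keys_iff lookup_face_mon)

lemma mdeg_face_mon: "finite \<sigma> \<Longrightarrow> mdeg (face_mon \<sigma>) = card \<sigma>"
  by (induction \<sigma> rule: finite_induct) (auto simp: face_mon_insert mdeg_add)

lemma minus_face_mon_add:
  assumes "\<sigma> \<subseteq> keys \<alpha>" shows "\<alpha> - face_mon \<sigma> + face_mon \<sigma> = \<alpha>"
proof -
  have "finite \<sigma>" using assms by (auto intro: finite_subset[OF _ finite_keys])
  then show ?thesis using assms
    by (intro poly_mapping_eqI) (force simp: lookup_add lookup_minus lookup_face_mon in_keys_iff)
qed

lemma mdeg_minus_face_mon: "\<sigma> \<subseteq> keys \<alpha> \<Longrightarrow> int (mdeg (\<alpha> - face_mon \<sigma>)) = int (mdeg \<alpha>) - int (card \<sigma>)"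
  using minus_face_mon_add[of \<sigma> \<alpha>] mdeg_add[of "\<alpha> - face_mon \<sigma>" "face_mon \<sigma>"] mdeg_face_mon[of \<sigma>]
    finite_subset[of \<sigma> "keys \<alpha>"] by simp

lemma keys_minus_nat: "keys (\<alpha> - \<beta> :: 'v \<Rightarrow>\<^sub>0 nat) \<subseteq> keys \<alpha>"
  by (auto simp: in_keys_iff lookup_minus)

lemma minus_face_mon_insert:
  "finite \<rho> \<Longrightarrow> v \<notin> \<rho> \<Longrightarrow> \<alpha> - face_mon \<rho> - single v 1 = \<alpha> - face_mon (insert v \<rho>)"
  by (intro poly_mapping_eqI) (simp add: face_mon_insert lookup_add lookup_minus)

text \<open>The part of multidegree \<open>\<alpha>\<close> of a chain of the Koszul complex of a free module of rank 1.\<close>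

definition strand :: "('v \<Rightarrow>\<^sub>0 nat) \<Rightarrow> ('v set \<Rightarrow> ('v, 'k::field) mpoly) \<Rightarrow> 'v set \<Rightarrow> 'k" where
  "strand \<alpha> c \<sigma> = (if \<sigma> \<subseteq> keys \<alpha> then lookup (c \<sigma>) (\<alpha> - face_mon \<sigma>) else 0)"

lemma lookup_strand: "finite \<sigma> \<Longrightarrow> lookup (c \<sigma>) m = strand (m + face_mon \<sigma>) c \<sigma>"
proof -
  assume "finite \<sigma>"
  then have "\<sigma> \<subseteq> keys (m + face_mon \<sigma>)" by (auto simp: in_keys_iff lookup_add lookup_face_mon)
  then show ?thesis by (simp add: strand_def)
qed

lemma ksgn_mpoly: "(ksgn v \<sigma> :: ('v, 'k::field) mpoly) = single 0 (ksgn v \<sigma>)"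
proof -
  have "(- 1 :: ('v, 'k) mpoly) ^ n = single 0 ((- 1) ^ n)" for n
    by (induction n) (simp_all add: mult_single[symmetric] single_uminus)
  then show ?thesis by (simp add: ksgn_def)
qed

text \<open>Multiplication by the variable v takes the exponent
  \<open>\<alpha> - face_mon (insert v \<rho>)\<close> to \<open>\<alpha> - face_mon \<rho>\<close>.
  So the Koszul differential preserves multidegrees, and on a strand it is the simplicial
  boundary.\<close>

lemma strand_kbd:
  assumes "finite \<rho>"
  shows "strand \<alpha> (kbd var V c) \<rho> = (if \<rho> \<subseteq> keys \<alpha> then bd V (strand \<alpha> c) \<rho> else 0)"
proof (cases "\<rho> \<subseteq> keys \<alpha>")
  case True
  have "lookup (ksgn v \<rho> * var v * c (insert v \<rho>)) (\<alpha> - face_mon \<rho>) = ksgn v \<rho> * strand \<alpha> c (insert v \<rho>)"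
    if "v \<notin> \<rho>" for v
  proof -
    have "0 < lookup (\<alpha> - face_mon \<rho>) v \<longleftrightarrow> v \<in> keys \<alpha>"
      using that assms by (simp add: lookup_minus lookup_face_mon in_keys_iff)
    then show ?thesis
      using True minus_face_mon_insert[OF assms that, of \<alpha>]
      by (simp add: ksgn_mpoly mult.assoc lookup_var_mult strand_def)
  qed
  then show ?thesis
    using True by (simp add: strand_def[of _ "kbd var V c"] kbd_def lookup_sum)
next
  case False
  then show ?thesis by (simp add: strand_def)
qed

section \<open>Graded submodules of free modules and their Koszul homology\<close>

type_synonym ('v, 'k) mvec = "nat \<Rightarrow> ('v, 'k) mpoly"

lemma sum_fun_apply [simp]: "(sum f A) x = (\<Sum>i\<in>A. f i x)" for f :: "'i \<Rightarrow> 'x \<Rightarrow> 'b::comm_monoid_add"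
  by (induction A rule: infinite_finite_induct) auto

definition smul :: "('v, 'k::field) mpoly \<Rightarrow> ('v, 'k) mvec \<Rightarrow> ('v, 'k) mvec" where
  "smul p u = (\<lambda>r. p * u r)"

lemma smul_apply [simp]: "smul p u r = p * u r"
  by (simp add: smul_def)

text \<open>The vectors of degree j in the direct sum of the R(-e_r), the free module whose basis
  elements have the degrees \<open>e\<close>.\<close>

definition hvec :: "int list \<Rightarrow> int \<Rightarrow> ('v, 'k::field) mvec \<Rightarrow> bool" where
  "hvec e j u \<longleftrightarrow> (\<forall>r<length e. homogeneous (j - e ! r) (u r))"

definition hcomp :: "int list \<Rightarrow> int \<Rightarrow> ('v, 'k::field) mvec \<Rightarrow> ('v, 'k) mvec" where
  "hcomp e j u = (\<lambda>r. if r < length e then hpart (j - e ! r) (u r) else 0)"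

lemma hvec_hcomp [simp]: "hvec e j (hcomp e j u)"
  by (simp add: hvec_def hcomp_def)

lemma hvec_0 [simp]: "hvec e j 0"
  by (simp add: hvec_def)

lemma hvec_add: "hvec e j u \<Longrightarrow> hvec e j w \<Longrightarrow> hvec e j (u + w)"
  by (simp add: hvec_def homogeneous_add)

lemma hvec_smul: "homogeneous i p \<Longrightarrow> hvec e j u \<Longrightarrow> hvec e (i + j) (smul p u)"
proof -
  assume *: "homogeneous i p" "hvec e j u"
  show "hvec e (i + j) (smul p u)" unfolding hvec_def
  proof (intro allI impI)
    fix r assume "r < length e"
    then have "homogeneous (i + (j - e ! r)) (p * u r)"
      using * by (intro homogeneous_mult) (auto simp: hvec_def)
    then show "homogeneous (i + j - e ! r) (smul p u r)" by (simp add: algebra_simps)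
  qed
qed

lemma hvec_sum: "(\<And>x. x \<in> A \<Longrightarrow> hvec e j (f x)) \<Longrightarrow> hvec e j (sum f A)"
  by (induction A rule: infinite_finite_induct) (auto intro: hvec_add)

lemma free_mod_closed [intro, simp]:
  "0 \<in> free_mod V n"
  "u \<in> free_mod V n \<Longrightarrow> w \<in> free_mod V n \<Longrightarrow> u + w \<in> free_mod V n"
  "p \<in> polys V \<Longrightarrow> u \<in> free_mod V n \<Longrightarrow> smul p u \<in> free_mod V n"
  by (simp_all add: free_mod_def)

lemma hcomp_free_mod [simp]: "u \<in> free_mod V (length e) \<Longrightarrow> hcomp e j u \<in> free_mod V (length e)"
  by (simp add: free_mod_def hcomp_def)

lemma hcomp_hvec: "u \<in> free_mod V (length e) \<Longrightarrow> hvec e j u \<Longrightarrow> hcomp e j u = u"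
  by (auto simp: free_mod_def hcomp_def hvec_def fun_eq_iff hpart_homogeneous)

lemma sum_hcomp:
  assumes "u \<in> free_mod V (length e)"
  shows "\<exists>T. finite T \<and> u = (\<Sum>j\<in>T. hcomp e j u)"
proof -
  define T where "T = (\<Union>r<length e. (\<lambda>m. int (mdeg m) + e ! r) ` keys (u r))"
  have fin: "finite T" by (simp add: T_def)
  have "u r = (\<Sum>j\<in>T. hcomp e j u r)" for r
  proof (cases "r < length e")
    case True
    have "(\<Sum>j\<in>T. hpart (j - e ! r) (u r)) = (\<Sum>i\<in>(\<lambda>j. j - e ! r) ` T. hpart i (u r))"
      by (subst sum.reindex) (auto intro: inj_onI)
    also have "\<dots> = u r"
    proof (rule sum_hpart)
      show "(\<lambda>m. int (mdeg m)) ` keys (u r) \<subseteq> (\<lambda>j. j - e ! r) ` T"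
      proof
        fix x assume "x \<in> (\<lambda>m. int (mdeg m)) ` keys (u r)"
        then have "x + e ! r \<in> T" using True by (auto simp: T_def)
        then show "x \<in> (\<lambda>j. j - e ! r) ` T" by (force intro: image_eqI[of _ _ "x + e ! r"])
      qed
    qed (use fin in simp)
    finally show ?thesis using True by (simp add: hcomp_def)
  next
    case False
    then show ?thesis using assms by (simp add: hcomp_def free_mod_def)
  qed
  then have "u = (\<Sum>j\<in>T. hcomp e j u)" by (simp add: fun_eq_iff)
  then show ?thesis using fin by blast
qed

definition graded_submodule :: "'v set \<Rightarrow> int list \<Rightarrow> ('v, 'k::field) mvec set \<Rightarrow> bool" where
  "graded_submodule V e Z \<longleftrightarrow> Z \<subseteq> free_mod V (length e) \<and> 0 \<in> Z \<and>
     (\<forall>u\<in>Z. \<forall>w\<in>Z. u + w \<in> Z) \<and> (\<forall>p\<in>polys V. \<forall>u\<in>Z. smul p u \<in> Z) \<and>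
     (\<forall>u\<in>Z. \<forall>j. hcomp e j u \<in> Z)"

lemma graded_submoduleD:
  assumes "graded_submodule V e Z"
  shows "u \<in> Z \<Longrightarrow> u \<in> free_mod V (length e)" "0 \<in> Z" "u \<in> Z \<Longrightarrow> w \<in> Z \<Longrightarrow> u + w \<in> Z"
    "p \<in> polys V \<Longrightarrow> u \<in> Z \<Longrightarrow> smul p u \<in> Z" "u \<in> Z \<Longrightarrow> hcomp e j u \<in> Z"
  using assms unfolding graded_submodule_def by auto

lemma graded_submodule_sum:
  "graded_submodule V e Z \<Longrightarrow> (\<And>x. x \<in> A \<Longrightarrow> f x \<in> Z) \<Longrightarrow> sum f A \<in> Z"
  by (induction A rule: infinite_finite_induct) (auto intro: graded_submoduleD)

lemma graded_submodule_free_mod: "graded_submodule V e (free_mod V (length e))"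
  by (simp add: graded_submodule_def)

type_synonym ('v, 'k) mchain = "'v set \<Rightarrow> ('v, 'k) mvec"

definition cscale :: "'k::field \<Rightarrow> ('v, 'k) mchain \<Rightarrow> ('v, 'k) mchain" where
  "cscale k c = (\<lambda>\<sigma>. smul (single 0 k) (c \<sigma>))"

lemma cscale_apply [simp]: "cscale k c \<sigma> = smul (single 0 k) (c \<sigma>)"
  by (simp add: cscale_def)

interpretation mchain: vector_space "cscale :: 'k::field \<Rightarrow> ('v, 'k) mchain \<Rightarrow> ('v, 'k) mchain"
proof
  fix a b :: 'k and x y :: "('v, 'k) mchain"
  show "cscale a (x + y) = cscale a x + cscale a y"
    by (simp add: cscale_def smul_def fun_eq_iff distrib_left)
  show "cscale (a + b) x = cscale a x + cscale b x"
    by (simp add: cscale_def smul_def fun_eq_iff distrib_right single_add)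
  show "cscale a (cscale b x) = cscale (a * b) x"
    by (simp add: cscale_def smul_def fun_eq_iff mult_single flip: mult.assoc)
  show "cscale 1 x = x"
    by (simp add: cscale_def smul_def fun_eq_iff)
qed

definition koszul_d :: "'v set \<Rightarrow> ('v, 'k::field) mchain \<Rightarrow> ('v, 'k) mchain" where
  "koszul_d V c = (\<lambda>\<rho> r. kbd var V (\<lambda>\<sigma>. c \<sigma> r) \<rho>)"

lemma koszul_d_add: "koszul_d V (c + d) = koszul_d V c + koszul_d V d"
  by (simp add: koszul_d_def fun_eq_iff kbd_add)

lemma koszul_d_diff: "koszul_d V (c - d) = koszul_d V c - koszul_d V d"
  by (simp add: koszul_d_def fun_eq_iff kbd_diff)

lemma koszul_d_cscale: "koszul_d V (cscale k c) = cscale k (koszul_d V c)"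
  by (simp add: koszul_d_def fun_eq_iff kbd_mult)

lemma koszul_d_0 [simp]: "koszul_d V 0 = 0"
  by (simp add: koszul_d_def fun_eq_iff kbd_eq_0)

lemma koszul_d_eq_sum: "koszul_d V c \<rho> = (\<Sum>v\<in>V - \<rho>. smul (ksgn v \<rho> * var v) (c (insert v \<rho>)))"
  by (simp add: koszul_d_def fun_eq_iff kbd_def)

text \<open>Chains of internal degree \<open>j\<close>; the \<open>p\<close> variables of a face account for the shift.\<close>

definition mchains :: "'v set \<Rightarrow> int list \<Rightarrow> ('v, 'k::field) mvec set \<Rightarrow> nat \<Rightarrow> int \<Rightarrow> ('v, 'k) mchain set" where
  "mchains V e Z p j =
    {c. \<forall>\<sigma>. c \<sigma> \<in> Z \<and> hvec e (j - int p) (c \<sigma>) \<and> (c \<sigma> \<noteq> 0 \<longrightarrow> \<sigma> \<subseteq> V \<and> card \<sigma> = p)}"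

definition mcycles :: "'v set \<Rightarrow> int list \<Rightarrow> ('v, 'k::field) mvec set \<Rightarrow> nat \<Rightarrow> int \<Rightarrow> ('v, 'k) mchain set" where
  "mcycles V e Z p j = {c \<in> mchains V e Z p j. koszul_d V c = 0}"

definition mbounds :: "'v set \<Rightarrow> int list \<Rightarrow> ('v, 'k::field) mvec set \<Rightarrow> nat \<Rightarrow> int \<Rightarrow> ('v, 'k) mchain set" where
  "mbounds V e Z p j = koszul_d V ` mchains V e Z (Suc p) j"

lemma mchainsD:
  assumes "c \<in> mchains V e Z p j"
  shows "c \<sigma> \<in> Z" "hvec e (j - int p) (c \<sigma>)" "c \<sigma> \<noteq> 0 \<Longrightarrow> \<sigma> \<subseteq> V" "c \<sigma> \<noteq> 0 \<Longrightarrow> card \<sigma> = p"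
  using assms by (auto simp: mchains_def)

lemma mchains_mono: "c \<in> mchains V e Z p j \<Longrightarrow> Z \<subseteq> Z' \<Longrightarrow> c \<in> mchains V e Z' p j"
  unfolding mchains_def by blast

lemma mchains_subset_iff:
  "c \<in> mchains V e Z p j \<longleftrightarrow> c \<in> mchains V e Z' p j \<and> (\<forall>\<sigma>. c \<sigma> \<in> Z)" if "Z \<subseteq> Z'"
  using that unfolding mchains_def by blast

lemma subspace_mchains: "graded_submodule V e Z \<Longrightarrow> mchain.subspace (mchains V e Z p j)"
proof (rule mchain.subspaceI)
  assume Z: "graded_submodule V e Z"
  show "0 \<in> mchains V e Z p j" using graded_submoduleD(2)[OF Z] by (simp add: mchains_def)
  show "x + y \<in> mchains V e Z p j" if "x \<in> mchains V e Z p j" "y \<in> mchains V e Z p j" for x y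
    unfolding mchains_def mem_Collect_eq
  proof (intro allI conjI)
    fix \<sigma>
    show "(x + y) \<sigma> \<in> Z" "hvec e (j - int p) ((x + y) \<sigma>)"
      using mchainsD[OF that(1)] mchainsD[OF that(2)] graded_submoduleD(3)[OF Z] by (auto intro: hvec_add)
    show "(x + y) \<sigma> \<noteq> 0 \<longrightarrow> \<sigma> \<subseteq> V \<and> card \<sigma> = p"
      using mchainsD(3,4)[OF that(1), of \<sigma>] mchainsD(3,4)[OF that(2), of \<sigma>] by fastforce
  qed
  show "cscale k x \<in> mchains V e Z p j" if "x \<in> mchains V e Z p j" for k x
    unfolding mchains_def mem_Collect_eq
  proof (intro allI conjI)
    fix \<sigma>
    show "cscale k x \<sigma> \<in> Z" using mchainsD[OF that] graded_submoduleD(4)[OF Z] by simp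
    show "hvec e (j - int p) (cscale k x \<sigma>)"
      using hvec_smul[OF homogeneous_single[of 0 0 k] mchainsD(2)[OF that]] by simp
    show "cscale k x \<sigma> \<noteq> 0 \<longrightarrow> \<sigma> \<subseteq> V \<and> card \<sigma> = p"
      using mchainsD(3,4)[OF that, of \<sigma>] by (cases "x \<sigma> = 0") (auto simp: fun_eq_iff)
  qed
qed

lemma subspace_mcycles: "graded_submodule V e Z \<Longrightarrow> mchain.subspace (mcycles V e Z p j)"
  using subspace_mchains[of V e Z p j] unfolding mcycles_def mchain.subspace_def
  by (auto simp: koszul_d_add koszul_d_cscale)

lemma subspace_mbounds: "graded_submodule V e Z \<Longrightarrow> mchain.subspace (mbounds V e Z p j)"
proof (rule mchain.subspaceI)
  assume "graded_submodule V e Z"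
  note sub = subspace_mchains[OF this, of "Suc p" j]
  show "0 \<in> mbounds V e Z p j" using mchain.subspace_0[OF sub] koszul_d_0 unfolding mbounds_def by force
  show "x + y \<in> mbounds V e Z p j" if "x \<in> mbounds V e Z p j" "y \<in> mbounds V e Z p j" for x y
    using that mchain.subspace_add[OF sub] unfolding mbounds_def by (auto simp flip: koszul_d_add)
  show "cscale k x \<in> mbounds V e Z p j" if "x \<in> mbounds V e Z p j" for k x
    using that mchain.subspace_scale[OF sub] unfolding mbounds_def by (auto simp flip: koszul_d_cscale)
qed

section \<open>Koszul homology of graded submodules over finitely many variables\<close>

locale finite_vars =
  fixes V :: "'v set"
  assumes finV: "finite V"
begin

lemma koszul_d_koszul_d:
  assumes "c \<in> mchains V e Z p j" shows "koszul_d V (koszul_d V c) = 0"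
proof -
  have "kbd var V (kbd var V (\<lambda>\<sigma>. c \<sigma> r)) \<rho> = 0" for \<rho> r
  proof (cases "finite \<rho>")
    case False
    have "c \<sigma> = 0" if "infinite \<sigma>" for \<sigma>
      using mchainsD(3)[OF assms, of \<sigma>] that finV finite_subset by auto
    then show ?thesis using False by (intro kbd_eq_0) simp
  qed (rule kbd_kbd[OF finV])
  then show ?thesis by (simp add: koszul_d_def fun_eq_iff)
qed

lemma koszul_d_mchains:
  assumes Z: "graded_submodule V e Z" and c: "c \<in> mchains V e Z (Suc p) j"
  shows "koszul_d V c \<in> mchains V e Z p j"
  unfolding mchains_def mem_Collect_eq
proof (intro allI conjI impI)
  fix \<rho>
  have poly: "ksgn v \<rho> * var v \<in> polys V" if "v \<in> V - \<rho>" for v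
    using that by (simp add: ksgn_mpoly)
  show "koszul_d V c \<rho> \<in> Z" unfolding koszul_d_eq_sum
    using poly mchainsD(1)[OF c] by (intro graded_submodule_sum[OF Z] graded_submoduleD(4)[OF Z]) auto
  have "homogeneous 1 (ksgn v \<rho> * var v)" for v
    unfolding ksgn_mpoly by (rule homogeneous_const_mult) simp
  from hvec_smul[OF this mchainsD(2)[OF c]]
  show "hvec e (j - int p) (koszul_d V c \<rho>)" unfolding koszul_d_eq_sum by (intro hvec_sum) simp
next
  fix \<rho> assume "koszul_d V c \<rho> \<noteq> 0"
  moreover have "koszul_d V c \<rho> = 0" if "\<forall>v\<in>V - \<rho>. c (insert v \<rho>) = 0"
    using that by (auto simp: koszul_d_def fun_eq_iff intro!: kbd_eq_0)
  ultimately obtain v where v: "v \<in> V - \<rho>" "c (insert v \<rho>) \<noteq> 0" by blast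
  then have *: "insert v \<rho> \<subseteq> V" "card (insert v \<rho>) = Suc p" using mchainsD(3,4)[OF c] by auto
  then have "finite \<rho>" using finV finite_subset by auto
  then show "\<rho> \<subseteq> V" "card \<rho> = p" using * v by auto
qed

text \<open>In a fixed internal degree a chain has only finitely many coefficients, since V is
  finite; reading them off gives the separating functionals.\<close>

lemma quot_dim_koszul_exists:
  fixes Z :: "('v, 'k::field) mvec set"
  assumes Z: "graded_submodule V e Z"
  shows "\<exists>n. mchain.quot_dim (mcycles V e Z p j) (mbounds V e Z p j) n"
proof (rule mchain.quot_dim_exists)
  let ?M = "\<lambda>r. {m. keys m \<subseteq> V \<and> mdeg m = nat (j - int p - e ! r)}"
  let ?T = "Pow V \<times> {..<length e} \<times> (\<Union>r<length e. ?M r)"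
  let ?ev = "\<lambda>t (c :: ('v, 'k) mchain). lookup (c (fst t) (fst (snd t))) (snd (snd t))"
  show "finite ?T" using finV finite_monomials_of_degree[OF finV] by auto
  show "Vector_Spaces.linear cscale (*) (?ev t)" for t
  proof -
    have "vector_space ((*) :: 'k \<Rightarrow> 'k \<Rightarrow> 'k)" by unfold_locales (simp_all add: algebra_simps)
    then show ?thesis by (simp add: linear_iff lookup_add mchain.vector_space_axioms)
  qed
  fix c assume c: "c \<in> mcycles V e Z p j" and 0: "\<forall>t\<in>?T. ?ev t c = 0"
  then have c': "c \<in> mchains V e Z p j" by (simp add: mcycles_def)
  have "lookup (c \<sigma> r) m = 0" for \<sigma> r m
  proof (rule ccontr)
    assume ne: "lookup (c \<sigma> r) m \<noteq> 0"
    then have "c \<sigma> \<noteq> 0" by (metis lookup_zero zero_fun_apply)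
    then have \<sigma>: "\<sigma> \<subseteq> V" using mchainsD[OF c'] by blast
    have free: "c \<sigma> \<in> free_mod V (length e)" using mchainsD[OF c'] graded_submoduleD[OF Z] by blast
    then have r: "r < length e" using ne by (cases "r < length e") (auto simp: free_mod_def)
    then have "keys m \<subseteq> V" using free ne by (auto simp: free_mod_def polys_iff in_keys_iff)
    moreover have "int (mdeg m) = j - int p - e ! r"
      using mchainsD(2)[OF c', of \<sigma>] r ne by (simp add: hvec_def homogeneous_def in_keys_iff)
    ultimately have "m \<in> ?M r" by (simp flip: nat_int)
    then have "(\<sigma>, r, m) \<in> ?T" using \<sigma> r by blast
    then show False using 0 ne by fastforce
  qed
  then show "c = 0" by (simp add: fun_eq_iff poly_mapping_eq_iff)
qed (intro subspace_mbounds subspace_mcycles Z)+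

text \<open>A chain of internal degree j carries no more than its strands: finitely many monomials
  are possible at each face, so prescribed strands can be summed up. This brings primitives found in
  each multidegree back to the Koszul complex.\<close>

lemma assemble_strands:
  fixes b :: "('v \<Rightarrow>\<^sub>0 nat) \<Rightarrow> nat \<Rightarrow> 'v set \<Rightarrow> 'k::field"
  assumes b: "\<And>\<alpha> r \<sigma>. keys \<alpha> \<subseteq> V \<Longrightarrow> b \<alpha> r \<sigma> \<noteq> 0 \<Longrightarrow> \<sigma> \<subseteq> V \<inter> keys \<alpha> \<and> card \<sigma> = q"
  shows "\<exists>y\<in>mchains V e (free_mod V (length e)) q j.
    \<forall>r<length e. \<forall>\<alpha>. keys \<alpha> \<subseteq> V \<longrightarrow> int (mdeg \<alpha>) = j - e ! r \<longrightarrow> strand \<alpha> (\<lambda>\<sigma>. y \<sigma> r) = b \<alpha> r"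
proof -
  define M where "M r = {m. keys m \<subseteq> V \<and> int (mdeg m) = j - int q - e ! r}" for r
  have finM: "finite (M r)" for r
  proof (rule finite_subset)
    show "M r \<subseteq> {m. keys m \<subseteq> V \<and> mdeg m = nat (j - int q - e ! r)}" by (auto simp: M_def)
  qed (rule finite_monomials_of_degree[OF finV])
  define y where "y = (\<lambda>\<sigma> r. if \<sigma> \<subseteq> V \<and> card \<sigma> = q \<and> r < length e
    then \<Sum>m\<in>M r. single m (b (m + face_mon \<sigma>) r \<sigma>) else 0)"
  have lookup_y: "lookup (y \<sigma> r) m = (if \<sigma> \<subseteq> V \<and> card \<sigma> = q \<and> r < length e \<and> m \<in> M r
     then b (m + face_mon \<sigma>) r \<sigma> else 0)" for \<sigma> r m
  proof -
    have "(\<Sum>x\<in>M r. lookup (single x (b (x + face_mon \<sigma>) r \<sigma>)) m)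
        = (\<Sum>x\<in>M r. if x = m then b (m + face_mon \<sigma>) r \<sigma> else 0)"
      by (rule sum.cong) (auto simp: lookup_single when_def)
    then show ?thesis using finM by (simp add: y_def lookup_sum)
  qed
  have "y \<in> mchains V e (free_mod V (length e)) q j"
    unfolding mchains_def mem_Collect_eq
  proof (intro allI conjI impI)
    fix \<sigma>
    have keys_y: "m \<in> M r" if "m \<in> keys (y \<sigma> r)" for m r
      using that lookup_y[of \<sigma> r m] by (auto simp: in_keys_iff split: if_splits)
    show "y \<sigma> \<in> free_mod V (length e)"
      using keys_y by (auto simp: free_mod_def polys_iff M_def) (simp add: y_def)
    show "hvec e (j - int q) (y \<sigma>)"
      using keys_y by (auto simp: hvec_def homogeneous_def M_def)
    show "\<sigma> \<subseteq> V" "card \<sigma> = q" if "y \<sigma> \<noteq> 0"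
      using that by (auto simp: y_def fun_eq_iff split: if_splits)
  qed
  moreover have "strand \<alpha> (\<lambda>\<sigma>. y \<sigma> r) \<sigma> = b \<alpha> r \<sigma>"
    if r: "r < length e" and \<alpha>: "keys \<alpha> \<subseteq> V" "int (mdeg \<alpha>) = j - e ! r" for r \<alpha> \<sigma>
  proof (cases "\<sigma> \<subseteq> V \<inter> keys \<alpha> \<and> card \<sigma> = q")
    case True
    have "\<alpha> - face_mon \<sigma> \<in> M r"
      using mdeg_minus_face_mon[of \<sigma> \<alpha>] True \<alpha> keys_minus_nat[of \<alpha> "face_mon \<sigma>"] by (auto simp: M_def)
    then show ?thesis using True r minus_face_mon_add[of \<sigma> \<alpha>] by (simp add: strand_def lookup_y)
  next
    case False
    then have "b \<alpha> r \<sigma> = 0" using b[OF \<alpha>(1)] by blast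
    then show ?thesis using False by (auto simp: strand_def lookup_y)
  qed
  ultimately show ?thesis by (intro bexI[of _ y]) (auto simp: fun_eq_iff)
qed

lemma mchains_eqI:
  fixes c c' :: "('v, 'k::field) mchain"
  assumes c: "c \<in> mchains V e (free_mod V (length e)) p j" "c' \<in> mchains V e (free_mod V (length e)) p j"
    and strands: "\<And>r \<alpha> \<rho>. r < length e \<Longrightarrow> keys \<alpha> \<subseteq> V \<Longrightarrow> int (mdeg \<alpha>) = j - e ! r \<Longrightarrow>
      \<rho> \<subseteq> V \<Longrightarrow> \<rho> \<subseteq> keys \<alpha> \<Longrightarrow> strand \<alpha> (\<lambda>\<sigma>. c \<sigma> r) \<rho> = strand \<alpha> (\<lambda>\<sigma>. c' \<sigma> r) \<rho>"
  shows "c = c'"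
proof -
  have zero: "lookup (u \<rho> r) m = 0"
    if u: "u \<in> mchains V e (free_mod V (length e)) p j"
      and ne: "\<not> (\<rho> \<subseteq> V \<and> card \<rho> = p \<and> r < length e \<and> keys m \<subseteq> V \<and> int (mdeg m) = j - int p - e ! r)"
    for u :: "('v, 'k) mchain" and \<rho> r m
  proof (rule ccontr)
    assume 0: "lookup (u \<rho> r) m \<noteq> 0"
    then have m: "m \<in> keys (u \<rho> r)" by (simp add: in_keys_iff)
    have "u \<rho> \<noteq> 0" using 0 by (metis lookup_zero zero_fun_apply)
    note 1 = mchainsD[OF u, of \<rho>]
    have "r < length e" using 0 1(1) by (cases "r < length e") (auto simp: free_mod_def)
    then show False
      using ne m 1(1,2) 1(3,4)[OF \<open>u \<rho> \<noteq> 0\<close>] by (auto simp: free_mod_def polys_iff hvec_def homogeneous_def)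
  qed
  have "lookup (c \<rho> r) m = lookup (c' \<rho> r) m" for \<rho> r m
  proof (cases "\<rho> \<subseteq> V \<and> card \<rho> = p \<and> r < length e \<and> keys m \<subseteq> V \<and> int (mdeg m) = j - int p - e ! r")
    case True
    then have \<rho>: "finite \<rho>" using finV by (auto intro: finite_subset)
    let ?\<alpha> = "m + face_mon \<rho>"
    have "\<rho> \<subseteq> keys ?\<alpha>" using \<rho> by (auto simp: in_keys_iff lookup_add lookup_face_mon)
    moreover have "int (mdeg ?\<alpha>) = j - e ! r" using \<rho> True by (simp add: mdeg_add mdeg_face_mon)
    moreover have "keys ?\<alpha> \<subseteq> V" using True \<rho> keys_add[of m "face_mon \<rho>"] by (auto simp: keys_face_mon)
    ultimately have "strand ?\<alpha> (\<lambda>\<sigma>. c \<sigma> r) \<rho> = strand ?\<alpha> (\<lambda>\<sigma>. c' \<sigma> r) \<rho>"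
      using True by (intro strands) auto
    then show ?thesis
      using lookup_strand[OF \<rho>, of "\<lambda>\<sigma>. c \<sigma> r" m] lookup_strand[OF \<rho>, of "\<lambda>\<sigma>. c' \<sigma> r" m] by simp
  next
    case False
    then show ?thesis using zero c by metis
  qed
  then show ?thesis by (simp add: fun_eq_iff poly_mapping_eq_iff)
qed

lemma strand_koszul_d:
  "\<rho> \<subseteq> V \<Longrightarrow> \<rho> \<subseteq> keys \<alpha> \<Longrightarrow> strand \<alpha> (\<lambda>\<sigma>. koszul_d V c \<sigma> r) \<rho> = bd V (strand \<alpha> (\<lambda>\<sigma>. c \<sigma> r)) \<rho>"
  using strand_kbd[of \<rho> \<alpha> V "\<lambda>\<sigma>. c \<sigma> r"] finV by (simp add: koszul_d_def finite_subset)

text \<open>In a multidegree \<alpha> \<noteq> 0 the strand is the chain complex of a full simplex,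
  a cone. In multidegree 0 only the empty face is left, with the constant terms as coefficients, and
  \<open>const\<close> makes these vanish.\<close>

lemma koszul_free_acyclic:
  fixes c :: "('v, 'k::field) mchain"
  assumes c: "c \<in> mcycles V e (free_mod V (length e)) p j"
    and const: "p = 0 \<Longrightarrow> \<forall>r. lookup (c {} r) 0 = 0"
  shows "c \<in> mbounds V e (free_mod V (length e)) p j"
proof -
  have c': "c \<in> mchains V e (free_mod V (length e)) p j" and cyc: "koszul_d V c = 0"
    using c by (auto simp: mcycles_def)
  have csupp: "\<sigma> \<subseteq> V" "card \<sigma> = p" if "c \<sigma> r \<noteq> 0" for \<sigma> r
    using that mchainsD(3,4)[OF c', of \<sigma>] by (auto simp: fun_eq_iff)
  have "\<exists>b. b \<in> kchains (Pow (V \<inter> keys \<alpha>)) (Suc p) \<and>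
      (\<forall>\<rho>. \<rho> \<in> Pow (V \<inter> keys \<alpha>) \<longrightarrow> bd V b \<rho> = strand \<alpha> (\<lambda>\<sigma>. c \<sigma> r) \<rho>)"
    if keys: "keys \<alpha> \<subseteq> V" for \<alpha> r
  proof -
    let ?X = "Pow (V \<inter> keys \<alpha>)" and ?a = "strand \<alpha> (\<lambda>\<sigma>. c \<sigma> r)"
    have a: "?a \<in> kchains ?X p" unfolding kchains_def
    proof (intro CollectI allI impI)
      fix \<sigma> assume "?a \<sigma> \<noteq> 0"
      then have "\<sigma> \<subseteq> keys \<alpha>" "c \<sigma> r \<noteq> 0" by (auto simp: strand_def split: if_splits)
      then show "\<sigma> \<in> ?X \<and> card \<sigma> = p" using csupp by auto
    qed
    have cyc': "bd V ?a \<rho> = 0" if "\<rho> \<in> ?X" for \<rho>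
      using strand_koszul_d[of \<rho> \<alpha> c r] that cyc by (auto simp: strand_def)
    show ?thesis
    proof (cases "\<alpha> = 0")
      case False
      then obtain u where u: "u \<in> keys \<alpha>" by (metis keys_eq_empty ex_in_conv)
      have "exact_at TYPE('k) V ?X p"
        by (rule exact_at_cone[of _ u]) (use finV u keys in auto)
      then show ?thesis using exact_atE[of V ?X p ?a] a cyc' by blast
    next
      case True
      have "?a \<rho> = 0" if "\<rho> \<in> ?X" for \<rho>
      proof (cases "c {} r = 0")
        case False
        then have "p = 0" using csupp(2)[of "{}" r] by simp
        then show ?thesis using const that True by (auto simp: strand_def)
      next
        case True
        then show ?thesis using that \<open>\<alpha> = 0\<close> by (simp add: strand_def)
      qed
      then show ?thesis by (intro exI[of _ "\<lambda>_. 0"]) (auto simp: kchains_def kbd_eq_0)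
    qed
  qed
  then obtain b where b: "\<And>\<alpha> r. keys \<alpha> \<subseteq> V \<Longrightarrow> b \<alpha> r \<in> kchains (Pow (V \<inter> keys \<alpha>)) (Suc p)"
    "\<And>\<alpha> r \<rho>. keys \<alpha> \<subseteq> V \<Longrightarrow> \<rho> \<in> Pow (V \<inter> keys \<alpha>) \<Longrightarrow> bd V (b \<alpha> r) \<rho> = strand \<alpha> (\<lambda>\<sigma>. c \<sigma> r) \<rho>"
    by metis
  obtain y where y: "y \<in> mchains V e (free_mod V (length e)) (Suc p) j"
    "\<And>r \<alpha>. r < length e \<Longrightarrow> keys \<alpha> \<subseteq> V \<Longrightarrow> int (mdeg \<alpha>) = j - e ! r \<Longrightarrow> strand \<alpha> (\<lambda>\<sigma>. y \<sigma> r) = b \<alpha> r"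
    using assemble_strands[of b "Suc p" e j] kchainsD[OF b(1)] by (metis PowD)
  have "koszul_d V y = c"
  proof (rule mchains_eqI)
    show "koszul_d V y \<in> mchains V e (free_mod V (length e)) p j"
      using y(1) by (rule koszul_d_mchains[OF graded_submodule_free_mod])
  qed (use c' y(2) b(2) strand_koszul_d[of _ _ y] in auto)
  then show ?thesis using y(1) unfolding mbounds_def by blast
qed

end

section \<open>Minimal covers and dimension shifting\<close>

definition graded_matrix :: "'v set \<Rightarrow> int list \<Rightarrow> int list \<Rightarrow> (nat \<Rightarrow> nat \<Rightarrow> ('v, 'k::field) mpoly) \<Rightarrow> bool" where
  "graded_matrix V e d A \<longleftrightarrow> (\<forall>r<length e. \<forall>c<length d. A r c \<in> polys V \<and> homogeneous (d ! c - e ! r) (A r c))"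

abbreviation amap :: "int list \<Rightarrow> int list \<Rightarrow> (nat \<Rightarrow> nat \<Rightarrow> ('v, 'k::field) mpoly) \<Rightarrow> ('v, 'k) mvec \<Rightarrow> ('v, 'k) mvec" where
  "amap e d A \<equiv> mat_app (length e) (length d) A"

definition syzygies :: "'v set \<Rightarrow> int list \<Rightarrow> int list \<Rightarrow> (nat \<Rightarrow> nat \<Rightarrow> ('v, 'k::field) mpoly) \<Rightarrow> ('v, 'k) mvec set" where
  "syzygies V e d A = {u \<in> free_mod V (length d). amap e d A u = 0}"

text \<open>One step of a minimal resolution: a free module F mapping onto Z with kernel inside
  \<mm>F. Stated on the kernel, minimality makes sense for a single step, before the next matrix is
  chosen.\<close>

definition minimal_cover :: "'v set \<Rightarrow> int list \<Rightarrow> ('v, 'k::field) mvec set \<Rightarrow> int list \<Rightarrow> (nat \<Rightarrow> nat \<Rightarrow> ('v, 'k) mpoly) \<Rightarrow> bool" where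
  "minimal_cover V e Z d A \<longleftrightarrow> graded_matrix V e d A \<and> amap e d A ` free_mod V (length d) = Z \<and>
     (\<forall>u\<in>syzygies V e d A. \<forall>c. lookup (u c) 0 = 0)"

lemma amap_add: "amap e d A (u + w) = amap e d A u + amap e d A w"
  by (auto simp: mat_app_def fun_eq_iff algebra_simps sum.distrib)

lemma amap_smul: "amap e d A (smul p u) = smul p (amap e d A u)"
  by (auto simp: mat_app_def fun_eq_iff algebra_simps sum_distrib_left)

lemma amap_0 [simp]: "amap e d A 0 = 0"
  by (auto simp: mat_app_def fun_eq_iff)

lemma amap_diff: "amap e d A (u - w) = amap e d A u - amap e d A w"
  by (auto simp: mat_app_def fun_eq_iff algebra_simps sum_subtractf)

lemma amap_sum: "amap e d A (sum f S) = (\<Sum>x\<in>S. amap e d A (f x))"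
  by (induction S rule: infinite_finite_induct) (simp_all only: sum.infinite sum.empty sum.insert amap_add amap_0 not_False_eq_True)

lemma hcomp_amap:
  assumes "graded_matrix V e d A"
  shows "hcomp e j (amap e d A u) = amap e d A (hcomp d j u)"
proof -
  have "hpart (j - e ! r) (A r c * u c) = A r c * hpart (j - d ! c) (u c)"
    if "r < length e" "c < length d" for r c
    using hpart_mult_homogeneous[of "d ! c - e ! r" "A r c" "j - e ! r" "u c"] assms that
    by (simp add: graded_matrix_def)
  then show ?thesis by (auto simp: hcomp_def mat_app_def fun_eq_iff hpart_sum)
qed

lemma hvec_amap:
  assumes "graded_matrix V e d A" "u \<in> free_mod V (length d)" "hvec d j u"
  shows "hvec e j (amap e d A u)"
  using hvec_hcomp[of e j "amap e d A u"] hcomp_amap[OF assms(1), of j u] hcomp_hvec[OF assms(2,3)] by simp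

lemma graded_submodule_syzygies: "graded_matrix V e d A \<Longrightarrow> graded_submodule V d (syzygies V e d A)"
  unfolding graded_submodule_def syzygies_def
  by (auto simp: amap_add amap_smul simp flip: hcomp_amap) (auto simp: hcomp_def fun_eq_iff)

definition chain_map :: "int list \<Rightarrow> int list \<Rightarrow> (nat \<Rightarrow> nat \<Rightarrow> ('v, 'k::field) mpoly) \<Rightarrow> ('v, 'k) mchain \<Rightarrow> ('v, 'k) mchain" where
  "chain_map e d A c = (\<lambda>\<sigma>. amap e d A (c \<sigma>))"

lemma koszul_d_chain_map: "koszul_d V (chain_map e d A c) = chain_map e d A (koszul_d V c)"
  by (auto simp: koszul_d_def chain_map_def mat_app_def fun_eq_iff kbd_sum kbd_mult kbd_eq_0)

lemma chain_map_linear: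
  "chain_map e d A (c + c') = chain_map e d A c + chain_map e d A c'"
  "chain_map e d A (c - c') = chain_map e d A c - chain_map e d A c'"
  "chain_map e d A (cscale k c) = cscale k (chain_map e d A c)"
  "chain_map e d A 0 = 0"
  by (auto simp: chain_map_def fun_eq_iff amap_add amap_diff amap_smul amap_0[unfolded fun_eq_iff])

definition vchain :: "('v, 'k::field) mvec \<Rightarrow> ('v, 'k) mchain" where
  "vchain u = (\<lambda>\<sigma>. if \<sigma> = {} then u else 0)"

lemma koszul_d_vchain [simp]: "koszul_d V (vchain u) = 0"
  by (auto simp: koszul_d_def vchain_def fun_eq_iff intro: kbd_eq_0)

lemma vchain_mcycles:
  assumes "graded_submodule V e Z" "u \<in> Z" "hvec e j u"
  shows "vchain u \<in> mcycles V e Z 0 j"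
  using assms graded_submoduleD(2)[OF assms(1)] unfolding mcycles_def by (simp add: mchains_def) (simp add: vchain_def)

section \<open>Koszul homology along a minimal cover\<close>

context finite_vars
begin

lemma mchains_0_vchain: "w \<in> mchains V e Z 0 j \<Longrightarrow> w = vchain (w {})"
proof -
  assume w: "w \<in> mchains V e Z 0 j"
  have "w \<sigma> = 0" if "\<sigma> \<noteq> {}" for \<sigma>
    using mchainsD(3,4)[OF w, of \<sigma>] that finV by (metis card_0_eq finite_subset)
  then show ?thesis by (auto simp: vchain_def fun_eq_iff)
qed

lemma chain_map_mchains:
  assumes A: "graded_matrix V e d A" and im: "amap e d A ` free_mod V (length d) \<subseteq> Z"
    and c: "c \<in> mchains V d (free_mod V (length d)) p j"
  shows "chain_map e d A c \<in> mchains V e Z p j"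
  unfolding mchains_def mem_Collect_eq chain_map_def
proof (intro allI conjI impI)
  fix \<sigma>
  show "amap e d A (c \<sigma>) \<in> Z" "hvec e (j - int p) (amap e d A (c \<sigma>))"
    using mchainsD(1,2)[OF c] im hvec_amap[OF A] by blast+
  show "\<sigma> \<subseteq> V" "card \<sigma> = p" if "amap e d A (c \<sigma>) \<noteq> 0"
    using that mchainsD(3,4)[OF c, of \<sigma>] by (cases "c \<sigma> = 0"; simp)+
qed

lemma chain_map_lift:
  assumes A: "graded_matrix V e d A" and im: "Z \<subseteq> amap e d A ` free_mod V (length d)"
    and Z: "graded_submodule V e Z" and t: "t \<in> mchains V e Z p j"
  shows "\<exists>y\<in>mchains V d (free_mod V (length d)) p j. chain_map e d A y = t"
proof -
  \<comment> \<open>The preimage of 0 is chosen to be 0, so that the lifted chain lives on the same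
    faces as t.\<close>
  have "\<exists>u\<in>free_mod V (length d). hvec d (j - int p) u \<and> amap e d A u = t \<sigma> \<and> (t \<sigma> = 0 \<longrightarrow> u = 0)" for \<sigma>
  proof (cases "t \<sigma> = 0")
    case False
    obtain u where u: "u \<in> free_mod V (length d)" "amap e d A u = t \<sigma>"
      using mchainsD(1)[OF t, of \<sigma>] im by auto
    have "amap e d A (hcomp d (j - int p) u) = hcomp e (j - int p) (t \<sigma>)" using hcomp_amap[OF A] u by metis
    also have "\<dots> = t \<sigma>" using mchainsD[OF t, of \<sigma>] graded_submoduleD(1)[OF Z] by (intro hcomp_hvec) auto
    finally show ?thesis using u(1) False by (intro bexI[of _ "hcomp d (j - int p) u"]) auto
  qed (intro bexI[of _ 0], auto)
  then obtain y where y: "\<And>\<sigma>. y \<sigma> \<in> free_mod V (length d)" "\<And>\<sigma>. hvec d (j - int p) (y \<sigma>)"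
    "\<And>\<sigma>. amap e d A (y \<sigma>) = t \<sigma>" "\<And>\<sigma>. t \<sigma> = 0 \<Longrightarrow> y \<sigma> = 0" by metis
  have "y \<in> mchains V d (free_mod V (length d)) p j"
    using y mchainsD(3,4)[OF t] unfolding mchains_def by blast
  moreover have "chain_map e d A y = t" using y by (simp add: chain_map_def fun_eq_iff)
  ultimately show ?thesis by blast
qed

lemma chain_map_mbounds:
  assumes A: "graded_matrix V e d A" and im: "amap e d A ` free_mod V (length d) \<subseteq> Z"
    and c: "c \<in> mbounds V d (free_mod V (length d)) p j"
  shows "chain_map e d A c \<in> mbounds V e Z p j"
  using c chain_map_mchains[OF A im] unfolding mbounds_def by (auto simp flip: koszul_d_chain_map)

text \<open>A homogeneous vector without constant terms lies in \<mm>F, so its image lies in \<mm>Z,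
  and boundaries in Koszul degree 0 are the elements of \<mm>Z.\<close>

lemma amap_vchain_mbounds:
  assumes A: "graded_matrix V e d A" and im: "amap e d A ` free_mod V (length d) \<subseteq> Z"
    and u: "u \<in> free_mod V (length d)" "hvec d j u" "\<And>c. lookup (u c) 0 = 0"
  shows "vchain (amap e d A u) \<in> mbounds V e Z 0 j"
proof -
  have "vchain u \<in> mcycles V d (free_mod V (length d)) 0 j"
    using u by (intro vchain_mcycles graded_submodule_free_mod)
  then have "vchain u \<in> mbounds V d (free_mod V (length d)) 0 j"
    by (rule koszul_free_acyclic) (use u in \<open>simp add: vchain_def\<close>)
  from chain_map_mbounds[OF A im this]
  show ?thesis by (simp add: chain_map_def vchain_def if_distrib cong: if_cong)
qed

text \<open>The connecting isomorphism for 0 -> syzygies -> F -> Z -> 0. The free module F has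
  homology only at p = 0, where it consists of constant vectors; minimality ensures that the
  syzygies map to zero there.\<close>

lemma koszul_shift:
  assumes cov: "minimal_cover V e Z d A" and Z: "graded_submodule V e Z"
  shows "mchain.quot_dim (mcycles V e Z (Suc p) j) (mbounds V e Z (Suc p) j) n \<longleftrightarrow>
    mchain.quot_dim (mcycles V d (syzygies V e d A) p j) (mbounds V d (syzygies V e d A) p j) n"
proof -
  let ?F = "free_mod V (length d)" and ?S = "syzygies V e d A"
  have A: "graded_matrix V e d A" and im: "amap e d A ` ?F = Z"
    and min: "\<And>u c. u \<in> ?S \<Longrightarrow> lookup (u c) 0 = 0"
    using cov by (auto simp: minimal_cover_def)
  have S: "graded_submodule V d ?S" using A by (rule graded_submodule_syzygies)
  have F: "graded_submodule V d ?F" by (rule graded_submodule_free_mod)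
  have SF: "?S \<subseteq> ?F" by (auto simp: syzygies_def)
  have S_iff: "w \<in> mchains V d ?S q j \<longleftrightarrow> w \<in> mchains V d ?F q j \<and> chain_map e d A w = 0" for w q
    using SF unfolding mchains_subset_iff[OF SF]
    by (auto simp: syzygies_def chain_map_def fun_eq_iff mchains_def)
  \<comment> \<open>The graph of the connecting homomorphism: lift z to a chain of F and apply the
    Koszul differential.\<close>
  define R where "R z w \<longleftrightarrow> z \<in> mcycles V e Z (Suc p) j \<and> w \<in> mcycles V d ?S p j \<and>
    (\<exists>y\<in>mchains V d ?F (Suc p) j. chain_map e d A y = z \<and> koszul_d V y = w)" for z w
  have add: "R (z + z') (w + w')" if RR: "R z w" "R z' w'" for z w z' w'
  proof -
    obtain y y' where "y \<in> mchains V d ?F (Suc p) j" "chain_map e d A y = z" "koszul_d V y = w"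
      "y' \<in> mchains V d ?F (Suc p) j" "chain_map e d A y' = z'" "koszul_d V y' = w'"
      using RR unfolding R_def by blast
    then have "y + y' \<in> mchains V d ?F (Suc p) j" "chain_map e d A (y + y') = z + z'" "koszul_d V (y + y') = w + w'"
      using mchain.subspace_add[OF subspace_mchains[OF F]] by (auto simp: chain_map_linear koszul_d_add)
    then show ?thesis using RR mchain.subspace_add[OF subspace_mcycles[OF Z]]
      mchain.subspace_add[OF subspace_mcycles[OF S]] unfolding R_def by blast
  qed
  have scale: "R (cscale k z) (cscale k w)" if RR: "R z w" for k z w
  proof -
    obtain y where "y \<in> mchains V d ?F (Suc p) j" "chain_map e d A y = z" "koszul_d V y = w"
      using RR unfolding R_def by blast
    then have "cscale k y \<in> mchains V d ?F (Suc p) j" "chain_map e d A (cscale k y) = cscale k z"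
      "koszul_d V (cscale k y) = cscale k w"
      using mchain.subspace_scale[OF subspace_mchains[OF F]] by (auto simp: chain_map_linear koszul_d_cscale)
    then show ?thesis using RR mchain.subspace_scale[OF subspace_mcycles[OF Z]]
      mchain.subspace_scale[OF subspace_mcycles[OF S]] unfolding R_def by blast
  qed
  have zero: "R 0 0"
    using mchain.subspace_0[OF subspace_mcycles[OF Z]] mchain.subspace_0[OF subspace_mcycles[OF S]]
      mchain.subspace_0[OF subspace_mchains[OF F]]
    unfolding R_def by (auto simp: chain_map_linear intro!: bexI[of _ 0])
  have total: "\<exists>w. R z w" if z: "z \<in> mcycles V e Z (Suc p) j" for z
  proof -
    have z': "z \<in> mchains V e Z (Suc p) j" "koszul_d V z = 0" using z by (auto simp: mcycles_def)
    obtain y where y: "y \<in> mchains V d ?F (Suc p) j" "chain_map e d A y = z"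
      using chain_map_lift[OF A _ Z z'(1)] im by blast
    have "chain_map e d A (koszul_d V y) = 0" using y z' by (simp flip: koszul_d_chain_map)
    then have "koszul_d V y \<in> mcycles V d ?S p j"
      using koszul_d_mchains[OF F y(1)] koszul_d_koszul_d[OF y(1)] by (simp add: mcycles_def S_iff)
    then show ?thesis using y z unfolding R_def by blast
  qed
  have surj: "\<exists>z. R z w" if w: "w \<in> mcycles V d ?S p j" for w
  proof -
    have w': "w \<in> mchains V d ?S p j" "koszul_d V w = 0" using w by (auto simp: mcycles_def)
    then have "w \<in> mcycles V d ?F p j" by (simp add: mcycles_def S_iff)
    \<comment> \<open>Minimality enters here: for p = 0 a syzygy bounds in F only because it has no
      constant terms.\<close>
    moreover have "lookup (w {} r) 0 = 0" for r using min mchainsD(1)[OF w'(1)] by blast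
    ultimately have "w \<in> mbounds V d ?F p j" by (intro koszul_free_acyclic) auto
    then obtain y where y: "y \<in> mchains V d ?F (Suc p) j" "w = koszul_d V y" by (auto simp: mbounds_def)
    have "chain_map e d A y \<in> mchains V e Z (Suc p) j" using chain_map_mchains[OF A _ y(1)] im by blast
    moreover have "koszul_d V (chain_map e d A y) = 0" using w'(1) y(2) by (simp add: koszul_d_chain_map S_iff)
    ultimately show ?thesis using y w unfolding R_def mcycles_def by blast
  qed
  have iff: "z \<in> mbounds V e Z (Suc p) j \<longleftrightarrow> w \<in> mbounds V d ?S p j" if RR: "R z w" for z w
  proof -
    obtain y where y: "y \<in> mchains V d ?F (Suc p) j" "chain_map e d A y = z" "koszul_d V y = w"
      using RR unfolding R_def by blast
    show ?thesis
    proof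
      assume "w \<in> mbounds V d ?S p j"
      then obtain y' where y': "y' \<in> mchains V d ?S (Suc p) j" "w = koszul_d V y'" by (auto simp: mbounds_def)
      have "y - y' \<in> mchains V d ?F (Suc p) j"
        using y y' S_iff by (intro mchain.subspace_diff[OF subspace_mchains[OF F]]) auto
      then have "y - y' \<in> mcycles V d ?F (Suc p) j" using y y' by (simp add: mcycles_def koszul_d_diff)
      then have "y - y' \<in> mbounds V d ?F (Suc p) j" by (rule koszul_free_acyclic) simp
      then have "chain_map e d A (y - y') \<in> mbounds V e Z (Suc p) j"
        using chain_map_mbounds[OF A] im by blast
      then show "z \<in> mbounds V e Z (Suc p) j" using y(2) y'(1) by (simp add: chain_map_linear S_iff)
    next
      assume "z \<in> mbounds V e Z (Suc p) j"
      then obtain t where t: "t \<in> mchains V e Z (Suc (Suc p)) j" "z = koszul_d V t" by (auto simp: mbounds_def)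
      obtain q where q: "q \<in> mchains V d ?F (Suc (Suc p)) j" "chain_map e d A q = t"
        using chain_map_lift[OF A _ Z t(1)] im by blast
      have "y - koszul_d V q \<in> mchains V d ?F (Suc p) j"
        by (intro mchain.subspace_diff[OF subspace_mchains[OF F]] y koszul_d_mchains[OF F] q)
      moreover have "chain_map e d A (y - koszul_d V q) = 0"
        using y t q by (simp add: chain_map_linear flip: koszul_d_chain_map)
      ultimately have "y - koszul_d V q \<in> mchains V d ?S (Suc p) j" by (simp add: S_iff)
      moreover have "koszul_d V (y - koszul_d V q) = w" using y koszul_d_koszul_d[OF q(1)] by (simp add: koszul_d_diff)
      ultimately show "w \<in> mbounds V d ?S p j" unfolding mbounds_def by blast
    qed
  qed
  have dom: "z \<in> mcycles V e Z (Suc p) j \<and> w \<in> mcycles V d ?S p j" if "R z w" for z w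
    using that by (simp add: R_def)
  show ?thesis
  proof
    assume "mchain.quot_dim (mcycles V e Z (Suc p) j) (mbounds V e Z (Suc p) j) n"
    then show "mchain.quot_dim (mcycles V d ?S p j) (mbounds V d ?S p j) n"
      by (rule mchain.quot_dim_transfer[where R = R]) (use add scale zero total surj iff dom in auto)
  next
    assume "mchain.quot_dim (mcycles V d ?S p j) (mbounds V d ?S p j) n"
    then show "mchain.quot_dim (mcycles V e Z (Suc p) j) (mbounds V e Z (Suc p) j) n"
      by (rule mchain.quot_dim_transfer[where R = "\<lambda>w z. R z w"]) (use add scale zero total surj iff dom in auto)
  qed
qed

end

section \<open>Betti numbers as dimensions of Koszul homology\<close>

definition unit_vec :: "nat \<Rightarrow> 'k::field \<Rightarrow> ('v, 'k) mvec" where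
  "unit_vec c k = (\<lambda>c'. if c' = c then single 0 k else 0)"

definition col :: "int list \<Rightarrow> (nat \<Rightarrow> nat \<Rightarrow> ('v, 'k::field) mpoly) \<Rightarrow> nat \<Rightarrow> ('v, 'k) mvec" where
  "col e A c = (\<lambda>r. if r < length e then A r c else 0)"

lemma amap_unit_vec:
  assumes "c < length d" shows "amap e d A (unit_vec c k) = smul (single 0 k) (col e A c)"
proof -
  have "(\<Sum>c'<length d. A r c' * unit_vec c k c') = A r c * single 0 k" for r
  proof -
    have "(\<Sum>c'<length d. A r c' * unit_vec c k c') = (\<Sum>c'<length d. if c' = c then A r c * single 0 k else 0)"
      by (rule sum.cong) (auto simp: unit_vec_def)
    then show ?thesis using assms by simp
  qed
  then show ?thesis by (auto simp: mat_app_def col_def fun_eq_iff mult.commute)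
qed

lemma unit_vec_free_mod: "c < n \<Longrightarrow> unit_vec c k \<in> free_mod V n"
  by (auto simp: free_mod_def unit_vec_def)

lemma hvec_unit_vec: "c < length d \<Longrightarrow> d ! c = j \<Longrightarrow> hvec d j (unit_vec c k)"
  by (auto simp: hvec_def unit_vec_def homogeneous_single)

lemma free_mod_diff: "u \<in> free_mod V n \<Longrightarrow> w \<in> free_mod V n \<Longrightarrow> u - w \<in> free_mod V n"
  by (auto simp: free_mod_def)

lemma hvec_diff: "hvec e j u \<Longrightarrow> hvec e j w \<Longrightarrow> hvec e j (u - w)"
  using hvec_add[of e j u "smul (single 0 (- 1)) w"] hvec_smul[OF homogeneous_single[of 0 0 "- 1"], of e j w]
  by (simp add: hvec_def single_uminus)

lemma free_mod_sum: "(\<And>x. x \<in> S \<Longrightarrow> f x \<in> free_mod V n) \<Longrightarrow> sum f S \<in> free_mod V n"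
  by (induction S rule: infinite_finite_induct) (simp_all only: sum.infinite sum.empty sum.insert free_mod_closed insert_iff simp_thms)

lemma const_term_homogeneous: "homogeneous j p \<Longrightarrow> j \<noteq> 0 \<Longrightarrow> lookup p 0 = 0"
  by (auto simp: homogeneous_def in_keys_iff dest: bspec[of _ _ 0])

lemma sum_unit_vec:
  assumes "finite I"
  shows "(\<Sum>c\<in>I. unit_vec c (a c) c') = (if c' \<in> I then single 0 (a c') else 0)"
proof -
  have "(\<Sum>c\<in>I. unit_vec c (a c) c') = (\<Sum>c\<in>I. if c = c' then single 0 (a c') else 0)"
    by (rule sum.cong) (auto simp: unit_vec_def)
  then show ?thesis using assms by simp
qed

lemma lookup_var_0 [simp]: "lookup (var v) 0 = 0"
  using lookup_var_mult[of v 1 0] by simp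

lemma hcomp_0 [simp]: "hcomp e j 0 = 0"
  by (simp add: hcomp_def fun_eq_iff)

lemma vchain_add: "vchain (u + w) = vchain u + vchain w"
  and vchain_diff: "vchain (u - w) = vchain u - vchain w"
  and vchain_smul: "vchain (smul (single 0 k) u) = cscale k (vchain u)"
  and vchain_0: "vchain 0 = 0"
  by (auto simp: vchain_def fun_eq_iff)

lemma vchain_sum: "vchain (sum f S) = (\<Sum>x\<in>S. vchain (f x))"
  by (induction S rule: infinite_finite_induct)
    (simp_all only: sum.infinite sum.empty sum.insert vchain_add vchain_0 not_False_eq_True)

lemma vchain_apply [simp]: "vchain u {} = u"
  by (simp add: vchain_def)

abbreviation deg_indices :: "int list \<Rightarrow> int \<Rightarrow> nat set" where
  "deg_indices d j \<equiv> {c. c < length d \<and> d ! c = j}"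

lemma card_deg_indices: "card (deg_indices d j) = count_list d j"
  by (simp add: count_list_eq_length_filter length_filter_conv_card eq_commute)

section \<open>Minimal generators and Koszul homology in degree 0\<close>

context finite_vars
begin

text \<open>Modulo \<mm>Z only the constant terms of the coefficients survive, and for a vector of
  degree j these sit at the basis elements of degree j.\<close>

lemma amap_const_part:
  fixes A :: "nat \<Rightarrow> nat \<Rightarrow> ('v, 'k::field) mpoly"
  assumes A: "graded_matrix V e d A" and im: "amap e d A ` free_mod V (length d) \<subseteq> Z"
    and x: "x \<in> free_mod V (length d)" "hvec d j x"
  shows "vchain (amap e d A x) - (\<Sum>c\<in>deg_indices d j. cscale (lookup (x c) 0) (vchain (col e A c)))
    \<in> mbounds V e Z 0 j"
proof -
  define k :: "('v, 'k) mvec" where "k = (\<Sum>c\<in>deg_indices d j. unit_vec c (lookup (x c) 0))"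
  have k: "k c = (if c \<in> deg_indices d j then single 0 (lookup (x c) 0) else 0)" for c
    by (simp add: k_def sum_unit_vec)
  have kF: "k \<in> free_mod V (length d)" unfolding k_def by (intro free_mod_sum unit_vec_free_mod) simp
  have kh: "hvec d j k" unfolding k_def by (intro hvec_sum hvec_unit_vec) auto
  have vk: "vchain (amap e d A k) = (\<Sum>c\<in>deg_indices d j. cscale (lookup (x c) 0) (vchain (col e A c)))"
  proof -
    have "vchain (amap e d A k) = (\<Sum>c\<in>deg_indices d j. vchain (amap e d A (unit_vec c (lookup (x c) 0))))"
      unfolding k_def by (simp only: amap_sum vchain_sum)
    also have "\<dots> = (\<Sum>c\<in>deg_indices d j. cscale (lookup (x c) 0) (vchain (col e A c)))"
      by (intro sum.cong refl) (simp only: amap_unit_vec vchain_smul mem_Collect_eq)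
    finally show ?thesis .
  qed
  have "lookup ((x - k) c) 0 = 0" for c
  proof (cases "c \<in> deg_indices d j")
    case True
    then show ?thesis by (simp add: lookup_minus k)
  next
    case False
    have "lookup (x c) 0 = 0"
    proof (cases "c < length d")
      case True
      then show ?thesis using x(2) False by (intro const_term_homogeneous[of "j - d ! c"]) (auto simp: hvec_def)
    qed (use x(1) in \<open>simp add: free_mod_def\<close>)
    then show ?thesis using False by (auto simp: lookup_minus k)
  qed
  then have "vchain (amap e d A (x - k)) \<in> mbounds V e Z 0 j"
    using free_mod_diff[OF x(1) kF] hvec_diff[OF x(2) kh] by (intro amap_vchain_mbounds[OF A im])
  then show ?thesis by (simp only: amap_diff vchain_diff vk)
qed

text \<open>Koszul homology in degree 0 is Z / \<mm>Z, and the images of the basis elements of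
  degree j form a basis of its part of degree j.\<close>

lemma koszul_H0:
  fixes A :: "nat \<Rightarrow> nat \<Rightarrow> ('v, 'k::field) mpoly"
  assumes cov: "minimal_cover V e Z d A" and Z: "graded_submodule V e Z"
  shows "mchain.quot_dim (mcycles V e Z 0 j) (mbounds V e Z 0 j) (count_list d j)"
proof -
  let ?F = "free_mod V (length d) :: ('v, 'k) mvec set" and ?I = "deg_indices d j"
  have A: "graded_matrix V e d A" and im: "amap e d A ` ?F = Z"
    and min: "\<And>u c. u \<in> syzygies V e d A \<Longrightarrow> lookup (u c) 0 = 0"
    using cov by (auto simp: minimal_cover_def)
  have F: "graded_submodule V d ?F" by (rule graded_submodule_free_mod)
  have fin: "finite ?I" by simp
  have col: "col e A c = amap e d A (unit_vec c 1)" if "c < length d" for c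
    using amap_unit_vec[OF that, of e A 1] by (simp add: fun_eq_iff)
  have "mchain.quot_basis (mcycles V e Z 0 j) (mbounds V e Z 0 j) ?I (\<lambda>c. vchain (col e A c))"
    unfolding mchain.quot_basis_def
  proof (intro conjI ballI allI impI fin)
    show "(\<lambda>c. vchain (col e A c)) ` ?I \<subseteq> mcycles V e Z 0 j"
    proof
      fix w assume "w \<in> (\<lambda>c. vchain (col e A c)) ` ?I"
      then obtain c where c: "c < length d" "d ! c = j" "w = vchain (col e A c)" by auto
      show "w \<in> mcycles V e Z 0 j" unfolding c(3) col[OF c(1)]
        using im unit_vec_free_mod[OF c(1)] hvec_unit_vec[OF c(1,2)]
        by (intro vchain_mcycles[OF Z] hvec_amap[OF A]) auto
    qed
  next
    fix w assume w: "w \<in> mcycles V e Z 0 j"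
    then have w': "w \<in> mchains V e Z 0 j" by (simp add: mcycles_def)
    obtain y where y: "y \<in> mchains V d ?F 0 j" "chain_map e d A y = w"
      using chain_map_lift[OF A _ Z w'] im by blast
    have "w = vchain (amap e d A (y {}))" using y(2) mchains_0_vchain[OF w'] by (metis chain_map_def)
    then show "\<exists>a. w - (\<Sum>c\<in>?I. cscale (a c) (vchain (col e A c))) \<in> mbounds V e Z 0 j"
      using amap_const_part[OF A _ mchainsD(1)[OF y(1), of "{}"], of Z j] im mchainsD(2)[OF y(1), of "{}"]
      by auto
  next
    fix a c assume 0: "(\<Sum>c\<in>?I. cscale (a c) (vchain (col e A c))) \<in> mbounds V e Z 0 j" and c: "c \<in> ?I"
    then obtain t where t: "t \<in> mchains V e Z (Suc 0) j" "(\<Sum>c\<in>?I. cscale (a c) (vchain (col e A c))) = koszul_d V t"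
      by (auto simp: mbounds_def)
    obtain y where y: "y \<in> mchains V d ?F (Suc 0) j" "chain_map e d A y = t"
      using chain_map_lift[OF A _ Z t(1)] im by blast
    \<comment> \<open>A relation modulo \<mm>Z becomes the syzygy k - v. As v is a value of the
      Koszul differential it has no constant terms, so those of k are constant terms of a syzygy and
      vanish.\<close>
    define k :: "('v, 'k) mvec" where "k = (\<Sum>c\<in>?I. unit_vec c (a c))"
    define v where "v = koszul_d V y {}"
    have v: "v \<in> ?F" unfolding v_def using koszul_d_mchains[OF F y(1)] by (rule mchainsD)
    have k: "k \<in> ?F" unfolding k_def by (intro free_mod_sum unit_vec_free_mod) simp
    have "vchain (amap e d A k) = (\<Sum>c\<in>?I. vchain (amap e d A (unit_vec c (a c))))"
      unfolding k_def by (simp only: amap_sum vchain_sum)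
    also have "\<dots> = (\<Sum>c\<in>?I. cscale (a c) (vchain (col e A c)))"
      by (intro sum.cong refl) (simp only: amap_unit_vec vchain_smul mem_Collect_eq)
    also have "\<dots> = chain_map e d A (koszul_d V y)" unfolding t(2) using y(2) koszul_d_chain_map by metis
    finally have "vchain (amap e d A k) {} = chain_map e d A (koszul_d V y) {}" by (rule arg_cong)
    then have "amap e d A k = amap e d A v" by (simp only: chain_map_def vchain_apply v_def)
    then have "k - v \<in> syzygies V e d A"
      using free_mod_diff[OF k v] unfolding syzygies_def by (simp only: amap_diff mem_Collect_eq) simp
    then have "lookup ((k - v) c) 0 = 0" by (rule min)
    moreover have "lookup (v c) 0 = 0"
      by (simp add: v_def koszul_d_def kbd_def lookup_sum lookup_mult_zero)
    ultimately have "lookup (k c) 0 = 0" by (simp add: lookup_minus)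
    moreover have "k c = single 0 (a c)" using sum_unit_vec[OF fin, of a c] c by (simp only: k_def sum_fun_apply if_True)
    ultimately show "a c = 0" by simp
  qed
  then show ?thesis unfolding mchain.quot_dim_def using card_deg_indices by blast
qed

text \<open>Graded Nakayama: representatives of bases of Z / \<mm>Z, taken over the finitely many
  degrees where this is nonzero, generate Z, and their independence modulo \<mm>Z is the minimality
  of the cover.\<close>

lemma minimal_cover_exists:
  fixes Z :: "('v, 'k::field) mvec set"
  assumes Z: "graded_submodule V e Z" and fin: "finite {j. \<not> mcycles V e Z 0 j \<subseteq> mbounds V e Z 0 j}"
  shows "\<exists>d A. minimal_cover V e Z d A"
proof -
  let ?J = "{j. \<not> mcycles V e Z 0 j \<subseteq> mbounds V e Z 0 j}"
  have "\<exists>I f. mchain.quot_basis (mcycles V e Z 0 j) (mbounds V e Z 0 j) I f" for j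
    using quot_dim_koszul_exists[OF Z] unfolding mchain.quot_dim_def by blast
  then obtain I f where If: "\<And>j. mchain.quot_basis (mcycles V e Z 0 j) (mbounds V e Z 0 j) (I j) (f j)" by metis
  note basis = mchain.quot_basisD[OF If]
  define P where "P = Sigma ?J I"
  have finP: "finite P" using fin basis(1) by (auto simp: P_def)
  then obtain h where h: "bij_betw h {0..<card P} P" using ex_bij_betw_nat_finite by blast
  define N where "N = card P"
  have hP: "h c \<in> P" if "c < N" for c using h that by (auto simp: bij_betw_def N_def)
  define d where "d = map (\<lambda>c. fst (h c)) [0..<N]"
  define A where "A r c = f (fst (h c)) (snd (h c)) {} r" for r c
  have len: "length d = N" and dc: "\<And>c. c < N \<Longrightarrow> d ! c = fst (h c)" by (auto simp: d_def)
  have gen: "f j r = vchain (f j r {})" "f j r {} \<in> Z" "hvec e j (f j r {})" if "r \<in> I j" for j r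
  proof -
    have "f j r \<in> mchains V e Z 0 j" using basis(2)[OF that] by (simp add: mcycles_def)
    then show "f j r = vchain (f j r {})" "f j r {} \<in> Z" "hvec e j (f j r {})"
      using mchains_0_vchain mchainsD(1) mchainsD(2)[of "f j r" V e Z 0 j "{}"] by auto
  qed
  have col: "col e A c = f (fst (h c)) (snd (h c)) {}" if "c < N" for c
  proof -
    have "f (fst (h c)) (snd (h c)) {} \<in> free_mod V (length e)"
      using gen(2)[of "snd (h c)" "fst (h c)"] hP[OF that] graded_submoduleD(1)[OF Z] by (auto simp: P_def)
    then show ?thesis by (auto simp: col_def A_def fun_eq_iff free_mod_def)
  qed
  have hI: "snd (h c) \<in> I (fst (h c))" if "c < N" for c using hP[OF that] by (auto simp: P_def)
  have colZ: "col e A c \<in> Z" "hvec e (d ! c) (col e A c)" if "c < N" for c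
    using gen(2,3)[OF hI[OF that]] col[OF that] dc[OF that] by auto
  have A: "graded_matrix V e d A" unfolding graded_matrix_def
  proof (intro allI impI)
    fix r c assume rc: "r < length e" "c < length d"
    then have "col e A c \<in> free_mod V (length e)" "hvec e (d ! c) (col e A c)"
      using colZ graded_submoduleD(1)[OF Z] len by auto
    then show "A r c \<in> polys V \<and> homogeneous (d ! c - e ! r) (A r c)"
      using rc by (auto simp: col_def free_mod_def hvec_def)
  qed
  let ?F = "free_mod V (length d) :: ('v, 'k) mvec set"
  define G where "G = amap e d A ` ?F"
  have GZ: "G \<subseteq> Z"
  proof
    fix w assume "w \<in> G"
    then obtain u where u: "u \<in> ?F" "w = amap e d A u" by (auto simp: G_def)
    have "w = (\<Sum>c<N. smul (u c) (col e A c))"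
      by (auto simp: u mat_app_def col_def fun_eq_iff len mult.commute)
    also have "\<dots> \<in> Z" using u(1) colZ(1) len
      by (intro graded_submodule_sum[OF Z] graded_submoduleD(4)[OF Z]) (auto simp: free_mod_def)
    finally show "w \<in> Z" .
  qed
  have Gadd: "u + w \<in> G" if "u \<in> G" "w \<in> G" for u w
    using that by (auto simp: G_def simp flip: amap_add)
  have Gsmul: "smul p u \<in> G" if "p \<in> polys V" "u \<in> G" for p u
    using that by (auto simp: G_def simp flip: amap_smul)
  have G0: "0 \<in> G" unfolding G_def by (intro image_eqI[of _ _ 0]) auto
  have Gsum: "sum g S \<in> G" if "\<And>x. x \<in> S \<Longrightarrow> g x \<in> G" for g and S :: "'s set"
    using that by (induction S rule: infinite_finite_induct)
      (simp_all only: sum.infinite sum.empty sum.insert G0 Gadd insert_iff simp_thms)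
  have Gcol: "col e A c \<in> G" if "c < N" for c
  proof -
    have "col e A c = amap e d A (unit_vec c 1)"
      using amap_unit_vec[of c d e A 1] that len by (simp add: fun_eq_iff)
    then show ?thesis using unit_vec_free_mod[of c N 1 V] that len unfolding G_def by blast
  qed
  \<comment> \<open>Below \<open>lo\<close> all homogeneous vectors are zero, which starts the
    induction on the degree; 0 is inserted so that the minimum exists for empty \<open>e\<close>. In
    the induction step, modulo generators of degree j an element lies in \<mm>Z, hence is a
    combination of elements of degree j - 1.\<close>
  define lo where "lo = Min (insert 0 (set e))"
  have hom_gen: "u \<in> G" if "u \<in> Z" "hvec e j u" for u j
    using that
  proof (induction "nat (j - lo + 1)" arbitrary: u j rule: less_induct)
    case (less j u)
    have free: "u \<in> free_mod V (length e)" using less.prems graded_submoduleD(1)[OF Z] by blast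
    show ?case
    proof (cases "j < lo")
      case True
      have "u r = 0" for r
      proof (cases "r < length e")
        case r: True
        then have "lo \<le> e ! r" unfolding lo_def by (intro Min_le) auto
        then have "j - e ! r < 0" using True by simp
        then have "keys (u r) = {}" using less.prems(2) r unfolding hvec_def homogeneous_def by fastforce
        then show ?thesis by simp
      qed (use free in \<open>simp add: free_mod_def\<close>)
      then have "u = 0" by (simp add: fun_eq_iff)
      then show ?thesis using G0 by simp
    next
      case False
      have cyc: "vchain u \<in> mcycles V e Z 0 j" using less.prems by (intro vchain_mcycles[OF Z])
      have koszul_d_G: "koszul_d V t {} \<in> G" if t: "t \<in> mchains V e Z (Suc 0) j" for t
      proof -
        have "t {v} \<in> G" for v
          by (rule less.hyps[of "j - 1"]) (use False mchainsD(1,2)[OF t, of "{v}"] in auto)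
        then show ?thesis unfolding koszul_d_eq_sum by (intro Gsum Gsmul) (auto simp: ksgn_mpoly)
      qed
      show ?thesis
      proof (cases "j \<in> ?J")
        case False
        then obtain t where "t \<in> mchains V e Z (Suc 0) j" "vchain u = koszul_d V t"
          using cyc by (auto simp: mbounds_def)
        then show ?thesis using koszul_d_G[of t] by (metis vchain_apply)
      next
        case True
        obtain a where "vchain u - (\<Sum>r\<in>I j. cscale (a r) (f j r)) \<in> mbounds V e Z 0 j"
          using basis(3)[OF cyc] by blast
        then obtain t where t: "t \<in> mchains V e Z (Suc 0) j"
          "vchain u - (\<Sum>r\<in>I j. cscale (a r) (f j r)) = koszul_d V t" by (auto simp: mbounds_def)
        then have "vchain u = koszul_d V t + (\<Sum>r\<in>I j. cscale (a r) (f j r))" by (simp add: algebra_simps)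
        then have "vchain u {} = (koszul_d V t + (\<Sum>r\<in>I j. cscale (a r) (f j r))) {}" by simp
        then have u: "u = koszul_d V t {} + (\<Sum>r\<in>I j. smul (single 0 (a r)) (f j r {}))"
          by (simp add: plus_fun_def fun_eq_iff)
        have "f j r {} \<in> G" if "r \<in> I j" for r
        proof -
          have "(j, r) \<in> P" using that True by (simp add: P_def)
          then obtain c where "c < N" "h c = (j, r)" using h unfolding bij_betw_def N_def by (metis atLeastLessThan_iff imageE)
          then show ?thesis using Gcol[of c] col[of c] by simp
        qed
        then show ?thesis unfolding u by (intro Gadd Gsum Gsmul koszul_d_G t) auto
      qed
    qed
  qed
  have "Z \<subseteq> G"
  proof
    fix u assume u: "u \<in> Z"
    obtain T where "finite T" "u = (\<Sum>j\<in>T. hcomp e j u)"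
      using sum_hcomp graded_submoduleD(1)[OF Z u] by blast
    moreover have "hcomp e j u \<in> G" for j
      using hom_gen graded_submoduleD(5)[OF Z u] by (metis hvec_hcomp)
    ultimately show "u \<in> G" using Gsum[of T "\<lambda>j. hcomp e j u"] by simp
  qed
  then have im: "amap e d A ` ?F = Z" using GZ by (simp add: G_def)
  have "lookup (u c) 0 = 0" if u: "u \<in> syzygies V e d A" for u c
  proof (cases "c < N")
    case False
    then show ?thesis using u len by (simp add: syzygies_def free_mod_def)
  next
    case c: True
    \<comment> \<open>A constant term in entry c shows up in the component of degree d ! c, so the
      syzygy may be replaced by that component. Its constant terms are then the coefficients of a
      relation modulo \<mm>Z among the chosen basis of degree j.\<close>
    define j where "j = d ! c"
    let ?x = "hcomp d j u"
    have uF: "u \<in> ?F" "amap e d A u = 0" using u by (auto simp: syzygies_def)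
    have xF: "?x \<in> ?F" using uF by simp
    have x0: "amap e d A ?x = 0"
      using hcomp_amap[OF A, of j u] unfolding uF(2) hcomp_0 by (rule sym)
    have lx: "lookup (?x c') 0 = lookup (u c') 0" if "c' \<in> deg_indices d j" for c'
      using that by (simp add: hcomp_def lookup_hpart)
    have "vchain (amap e d A ?x) - (\<Sum>c'\<in>deg_indices d j. cscale (lookup (?x c') 0) (vchain (col e A c')))
        \<in> mbounds V e Z 0 j"
      by (rule amap_const_part[OF A _ xF]) (use im in auto)
    then have "- (\<Sum>c'\<in>deg_indices d j. cscale (lookup (?x c') 0) (vchain (col e A c'))) \<in> mbounds V e Z 0 j"
      by (simp add: x0 vchain_0)
    then have "(\<Sum>c'\<in>deg_indices d j. cscale (lookup (?x c') 0) (vchain (col e A c'))) \<in> mbounds V e Z 0 j"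
      using mchain.subspace_neg[OF subspace_mbounds[OF Z]] by fastforce
    also have "(\<Sum>c'\<in>deg_indices d j. cscale (lookup (?x c') 0) (vchain (col e A c')))
        = (\<Sum>c'\<in>deg_indices d j. cscale (lookup (u c') 0) (f j (snd (h c'))))"
    proof (rule sum.cong)
      fix c' assume c': "c' \<in> deg_indices d j"
      then have "c' < N" "fst (h c') = j" using len dc[of c'] by auto
      then show "cscale (lookup (?x c') 0) (vchain (col e A c')) = cscale (lookup (u c') 0) (f j (snd (h c')))"
        using lx[OF c'] col[of c'] gen(1)[OF hI[of c']] by simp
    qed simp
    also have "\<dots> = (\<Sum>r\<in>I j. cscale (lookup (u (inv_into {0..<N} h (j, r))) 0) (f j r))"
    proof (rule sum.reindex_bij_witness[where i = "\<lambda>r. inv_into {0..<N} h (j, r)" and j = "\<lambda>c'. snd (h c')"])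
      have inj: "inj_on h {0..<N}" and img: "h ` {0..<N} = P" using h by (auto simp: bij_betw_def N_def)
      have jJ: "j \<in> ?J" using hP[OF c] dc[OF c] unfolding P_def j_def by auto
      fix c' assume "c' \<in> deg_indices d j"
      then have c': "c' < N" "h c' = (j, snd (h c'))" using len dc[of c'] by (auto simp: prod_eq_iff)
      then show "inv_into {0..<N} h (j, snd (h c')) = c'"
        using inv_into_f_f[OF inj, of c'] by simp
      then show "cscale (lookup (u (inv_into {0..<N} h (j, snd (h c')))) 0) (f j (snd (h c'))) =
        cscale (lookup (u c') 0) (f j (snd (h c')))" by simp
      show "snd (h c') \<in> I j" using hI[OF c'(1)] c'(2) by (metis fst_conv)
    next
      have inj: "inj_on h {0..<N}" and img: "h ` {0..<N} = P" using h by (auto simp: bij_betw_def N_def)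
      have jJ: "j \<in> ?J" using hP[OF c] dc[OF c] unfolding P_def j_def by auto
      fix r assume "r \<in> I j"
      then have "(j, r) \<in> h ` {0..<N}" using jJ img by (simp add: P_def)
      then have *: "h (inv_into {0..<N} h (j, r)) = (j, r)" "inv_into {0..<N} h (j, r) \<in> {0..<N}"
        by (rule f_inv_into_f, rule inv_into_into)
      then show "snd (h (inv_into {0..<N} h (j, r))) = r" by simp
      show "inv_into {0..<N} h (j, r) \<in> deg_indices d j" using * len dc by auto
    qed
    finally have bound: "(\<Sum>r\<in>I j. cscale (lookup (u (inv_into {0..<N} h (j, r))) 0) (f j r)) \<in> mbounds V e Z 0 j" .
    have "lookup (u (inv_into {0..<N} h (j, r))) 0 = 0" if "r \<in> I j" for r
      using basis(4)[OF bound that] .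
    from this[of "snd (h c)"] show ?thesis
    proof -
      assume *: "snd (h c) \<in> I j \<Longrightarrow> lookup (u (inv_into {0..<N} h (j, snd (h c)))) 0 = 0"
      have "(j, snd (h c)) = h c" using dc[OF c] by (simp add: j_def prod_eq_iff)
      moreover have "inv_into {0..<N} h (h c) = c"
        using h c by (intro inv_into_f_f) (auto simp: bij_betw_def N_def)
      ultimately show ?thesis using * hI[OF c] dc[OF c] by (simp add: j_def)
    qed
  qed
  then show ?thesis using A im unfolding minimal_cover_def by blast
qed

lemma exact_shift:
  assumes cov: "minimal_cover V e Z d A" and Z: "graded_submodule V e Z"
  shows "mcycles V e Z (Suc p) j \<subseteq> mbounds V e Z (Suc p) j \<longleftrightarrow>
    mcycles V d (syzygies V e d A) p j \<subseteq> mbounds V d (syzygies V e d A) p j"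
proof -
  have A: "graded_matrix V e d A" using cov by (simp add: minimal_cover_def)
  note S = graded_submodule_syzygies[OF A]
  obtain n where n: "mchain.quot_dim (mcycles V e Z (Suc p) j) (mbounds V e Z (Suc p) j) n"
    using quot_dim_koszul_exists[OF Z] by blast
  show ?thesis
    using mchain.quot_dim_0_iff[OF subspace_mbounds[OF Z] subspace_mcycles[OF Z] n]
      mchain.quot_dim_0_iff[OF subspace_mbounds[OF S] subspace_mcycles[OF S] n[unfolded koszul_shift[OF cov Z]]]
    by simp
qed

text \<open>The invariant carried along a resolution: dimension shifting passes it on to the
  syzygies, and at p = 0 it says that the degrees of minimal generators are finite in
  number.\<close>

definition koszul_finite :: "int list \<Rightarrow> ('v, 'k::field) mvec set \<Rightarrow> bool" where
  "koszul_finite e Z \<longleftrightarrow> graded_submodule V e Z \<and> (\<forall>p. finite {j. \<not> mcycles V e Z p j \<subseteq> mbounds V e Z p j})"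

lemma koszul_finite_syzygies:
  assumes Z: "koszul_finite e Z" and cov: "minimal_cover V e Z d A"
  shows "koszul_finite d (syzygies V e d A)"
proof -
  have "graded_submodule V e Z" using Z by (simp add: koszul_finite_def)
  note shift = exact_shift[OF cov this]
  have "finite {j. \<not> mcycles V d (syzygies V e d A) p j \<subseteq> mbounds V d (syzygies V e d A) p j}" for p
    using Z unfolding koszul_finite_def shift[symmetric] by blast
  then show ?thesis using cov graded_submodule_syzygies unfolding koszul_finite_def minimal_cover_def by blast
qed

end

section \<open>Resolutions as sequences of minimal covers\<close>

definition ideal_vecs :: "('v, 'k::field) mpoly set \<Rightarrow> ('v, 'k) mvec set" where
  "ideal_vecs I = {u. u 0 \<in> I \<and> (\<forall>r\<ge>1. u r = 0)}"

text \<open>The resolution is cut into covers: \<open>res_degs d i\<close> and \<open>res_mat g A i\<close> describe the map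
  \<open>F\<^sub>i \<rightarrow> F\<^sub>i\<^sub>-\<^sub>1\<close> with \<open>F\<^sub>-\<^sub>1 = R\<close>.\<close>

definition res_degs :: "(nat \<Rightarrow> int list) \<Rightarrow> nat \<Rightarrow> int list" where
  "res_degs d i = (case i of 0 \<Rightarrow> [0] | Suc k \<Rightarrow> d k)"

definition res_mat :: "(nat \<Rightarrow> ('v, 'k) mpoly) \<Rightarrow> (nat \<Rightarrow> nat \<Rightarrow> nat \<Rightarrow> ('v, 'k::field) mpoly) \<Rightarrow> nat \<Rightarrow> nat \<Rightarrow> nat \<Rightarrow> ('v, 'k) mpoly" where
  "res_mat g A i = (case i of 0 \<Rightarrow> (\<lambda>r c. g c) | Suc k \<Rightarrow> A k)"

definition res_mod :: "'v set \<Rightarrow> ('v, 'k::field) mpoly set \<Rightarrow> (nat \<Rightarrow> int list) \<Rightarrow> (nat \<Rightarrow> ('v, 'k) mpoly)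
    \<Rightarrow> (nat \<Rightarrow> nat \<Rightarrow> nat \<Rightarrow> ('v, 'k) mpoly) \<Rightarrow> nat \<Rightarrow> ('v, 'k) mvec set" where
  "res_mod V I d g A i = (case i of 0 \<Rightarrow> ideal_vecs I
     | Suc k \<Rightarrow> syzygies V (res_degs d k) (d k) (res_mat g A k))"

lemma res_simps [simp]:
  "res_degs d 0 = [0]" "res_degs d (Suc i) = d i"
  "res_mat g A 0 = (\<lambda>r c. g c)" "res_mat g A (Suc i) = A i"
  "res_mod V I d g A 0 = ideal_vecs I"
  "res_mod V I d g A (Suc i) = syzygies V (res_degs d i) (d i) (res_mat g A i)"
  by (auto simp: res_degs_def res_mat_def res_mod_def)

lemma amap_augmentation:
  "mat_app (Suc 0) n (\<lambda>r c. g c) u = (\<lambda>r. if r = 0 then \<Sum>c<n. u c * g c else 0)"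
  by (auto simp: mat_app_def fun_eq_iff mult.commute)

text \<open>Each kernel is the image of the next matrix, so entries without constant terms give
  kernels without constant terms. Conversely, the columns of a matrix lie in the kernel of the
  preceding map, so their entries have none.\<close>

lemma minimal_graded_free_resolution_iff:
  "minimal_graded_free_resolution V I d g A \<longleftrightarrow>
    (\<forall>i. minimal_cover V (res_degs d i) (res_mod V I d g A i) (d i) (res_mat g A i))"
proof
  assume "minimal_graded_free_resolution V I d g A"
  then have g: "\<And>c. c < length (d 0) \<Longrightarrow> g c \<in> polys V \<and> homogeneous (d 0 ! c) (g c)"
    and A: "\<And>i r c. r < length (d i) \<Longrightarrow> c < length (d (Suc i)) \<Longrightarrow> A i r c \<in> polys V \<and>
      homogeneous (d (Suc i) ! c - d i ! r) (A i r c) \<and> lookup (A i r c) 0 = 0"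
    and I: "(\<lambda>u. \<Sum>c<length (d 0). u c * g c) ` free_mod V (length (d 0)) = I"
    and ex0: "amap (d 0) (d (Suc 0)) (A 0) ` free_mod V (length (d (Suc 0)))
      = {u \<in> free_mod V (length (d 0)). (\<Sum>c<length (d 0). u c * g c) = 0}"
    and ex: "\<And>i. amap (d (Suc i)) (d (Suc (Suc i))) (A (Suc i)) ` free_mod V (length (d (Suc (Suc i))))
      = {u \<in> free_mod V (length (d (Suc i))). amap (d i) (d (Suc i)) (A i) u = (\<lambda>_. 0)}"
    unfolding minimal_graded_free_resolution_def Let_def by auto
  have im: "amap (d i) (d (Suc i)) (A i) ` free_mod V (length (d (Suc i))) = res_mod V I d g A (Suc i)" for i
  proof (cases i)
    case 0
    then show ?thesis using ex0 by (auto simp: syzygies_def amap_augmentation fun_eq_iff)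
  next
    case (Suc k)
    then show ?thesis using ex[of k] by (simp add: syzygies_def zero_fun_def)
  qed
  have const: "lookup (u c) 0 = 0" if u: "u \<in> res_mod V I d g A (Suc i)" for u c i
  proof -
    obtain w where "u = amap (d i) (d (Suc i)) (A i) w" using u im[of i] by blast
    then show ?thesis using A by (auto simp: mat_app_def lookup_sum lookup_mult_zero)
  qed
  show "\<forall>i. minimal_cover V (res_degs d i) (res_mod V I d g A i) (d i) (res_mat g A i)"
  proof
    fix i
    show "minimal_cover V (res_degs d i) (res_mod V I d g A i) (d i) (res_mat g A i)"
    proof (cases i)
      case 0
      have "amap [0] (d 0) (\<lambda>r. g) ` free_mod V (length (d 0)) = ideal_vecs I"
      proof (intro equalityI subsetI)
        fix u assume "u \<in> amap [0] (d 0) (\<lambda>r. g) ` free_mod V (length (d 0))"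
        then show "u \<in> ideal_vecs I" using I by (auto simp: ideal_vecs_def amap_augmentation)
      next
        fix u assume u: "u \<in> ideal_vecs I"
        then obtain w where w: "w \<in> free_mod V (length (d 0))" "u 0 = (\<Sum>c<length (d 0). w c * g c)"
          using I by (auto simp: ideal_vecs_def)
        have "u = amap [0] (d 0) (\<lambda>r. g) w"
          using u w(2) by (auto simp: ideal_vecs_def amap_augmentation fun_eq_iff)
        then show "u \<in> amap [0] (d 0) (\<lambda>r. g) ` free_mod V (length (d 0))" using w(1) by blast
      qed
      then show ?thesis using g const[of _ 0] 0 by (auto simp: minimal_cover_def graded_matrix_def)
    next
      case (Suc k)
      have "graded_matrix V (d k) (d (Suc k)) (A k)" using A by (simp add: graded_matrix_def)
      then show ?thesis using im[of k] const[of _ "Suc k"] Suc by (simp add: minimal_cover_def)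
    qed
  qed
next
  assume cov: "\<forall>i. minimal_cover V (res_degs d i) (res_mod V I d g A i) (d i) (res_mat g A i)"
  have gm: "graded_matrix V (res_degs d i) (d i) (res_mat g A i)"
    and im: "amap (res_degs d i) (d i) (res_mat g A i) ` free_mod V (length (d i)) = res_mod V I d g A i"
    and const: "\<And>u c. u \<in> res_mod V I d g A (Suc i) \<Longrightarrow> lookup (u c) 0 = 0" for i
    using cov unfolding minimal_cover_def by auto
  have A0: "lookup (A i r c) 0 = 0" if rc: "r < length (d i)" "c < length (d (Suc i))" for i r c
  proof -
    have "amap (d i) (d (Suc i)) (A i) (unit_vec c 1) \<in> res_mod V I d g A (Suc i)"
      using im[of "Suc i"] unit_vec_free_mod[OF rc(2)] by auto
    then have "col (d i) (A i) c \<in> res_mod V I d g A (Suc i)"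
      using amap_unit_vec[OF rc(2), of "d i" "A i" 1] by (simp add: smul_def)
    from const[OF this, of r] show ?thesis using rc by (simp add: col_def)
  qed
  have I: "(\<lambda>u. \<Sum>c<length (d 0). u c * g c) ` free_mod V (length (d 0)) = I"
  proof -
    have "(\<lambda>u. u 0) ` ideal_vecs I = I"
    proof (intro equalityI subsetI)
      fix p assume "p \<in> I"
      then have "(\<lambda>r. if r = 0 then p else 0) \<in> ideal_vecs I" by (simp add: ideal_vecs_def)
      then show "p \<in> (\<lambda>u. u 0) ` ideal_vecs I" by (rule rev_image_eqI) simp
    qed (auto simp: ideal_vecs_def)
    then have "(\<lambda>u. u 0) ` amap [0] (d 0) (\<lambda>r. g) ` free_mod V (length (d 0)) = I" using im[of 0] by simp
    then show ?thesis by (simp add: image_image amap_augmentation)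
  qed
  have "A i r c \<in> polys V \<and> homogeneous (d (Suc i) ! c - d i ! r) (A i r c) \<and> lookup (A i r c) 0 = 0"
    if "r < length (d i)" "c < length (d (Suc i))" for i r c
    using gm[of "Suc i"] A0 that by (simp add: graded_matrix_def)
  moreover have "g c \<in> polys V \<and> homogeneous (d 0 ! c) (g c)" if "c < length (d 0)" for c
    using gm[of 0] that by (simp add: graded_matrix_def)
  moreover have "amap (d 0) (d (Suc 0)) (A 0) ` free_mod V (length (d (Suc 0)))
      = {u \<in> free_mod V (length (d 0)). (\<Sum>c<length (d 0). u c * g c) = 0}"
    using im[of "Suc 0"] by (auto simp: syzygies_def amap_augmentation fun_eq_iff)
  moreover have "amap (d (Suc i)) (d (Suc (Suc i))) (A (Suc i)) ` free_mod V (length (d (Suc (Suc i))))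
      = {u \<in> free_mod V (length (d (Suc i))). amap (d i) (d (Suc i)) (A i) u = (\<lambda>_. 0)}" for i
    using im[of "Suc (Suc i)"] by (simp add: syzygies_def zero_fun_def)
  ultimately show "minimal_graded_free_resolution V I d g A"
    using I unfolding minimal_graded_free_resolution_def Let_def by (simp only: One_nat_def) blast
qed

section \<open>Existence of resolutions and independence of the Betti numbers\<close>

context finite_vars
begin

lemma res_mod_graded:
  assumes "graded_submodule V [0] (ideal_vecs I)" "minimal_graded_free_resolution V I d g A"
  shows "graded_submodule V (res_degs d i) (res_mod V I d g A i)"
proof (cases i)
  case (Suc k)
  have "graded_matrix V (res_degs d k) (d k) (res_mat g A k)"
    using assms(2) unfolding minimal_graded_free_resolution_iff minimal_cover_def by blast
  then show ?thesis using graded_submodule_syzygies Suc by (simp only: res_simps)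
qed (use assms in simp)

text \<open>Shifting i times turns Koszul homology of the ideal in degree i into that of the i-th
  syzygy module in degree 0, whose dimension counts the basis elements of F_i of degree j.\<close>

lemma resolution_koszul:
  assumes I: "graded_submodule V [0] (ideal_vecs I)" and res: "minimal_graded_free_resolution V I d g A"
  shows "mchain.quot_dim (mcycles V [0] (ideal_vecs I) i j) (mbounds V [0] (ideal_vecs I) i j) (count_list (d i) j)"
proof -
  have cov: "minimal_cover V (res_degs d i) (res_mod V I d g A i) (d i) (res_mat g A i)" for i
    using res by (simp add: minimal_graded_free_resolution_iff)
  have "mchain.quot_dim (mcycles V [0] (ideal_vecs I) (i + p) j) (mbounds V [0] (ideal_vecs I) (i + p) j) n \<longleftrightarrow>
    mchain.quot_dim (mcycles V (res_degs d i) (res_mod V I d g A i) p j)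
      (mbounds V (res_degs d i) (res_mod V I d g A i) p j) n" for p n
  proof (induction i arbitrary: p)
    case (Suc i)
    show ?case using Suc[of "Suc p"] koszul_shift[OF cov res_mod_graded[OF I res], of i p j n]
      by (simp only: res_simps add_Suc add_Suc_right)
  qed (simp only: res_simps add_0)
  from this[of 0] show ?thesis using koszul_H0[OF cov res_mod_graded[OF I res], of i j]
    by (simp only: add_0_right)
qed

text \<open>Each cover determines the module to be covered next, so tuples of degrees, module and
  cover are produced by dependent choice.\<close>

lemma resolution_exists:
  fixes I :: "('v, 'k::field) mpoly set"
  assumes fin: "koszul_finite [0] (ideal_vecs I)"
  shows "\<exists>d g A. minimal_graded_free_resolution V I d g A"
proof -
  define P where "P n s \<longleftrightarrow> (case s of (e, Z, d, A) \<Rightarrow> koszul_finite e Z \<and> minimal_cover V e Z d A \<and>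
    (n = 0 \<longrightarrow> e = [0] \<and> Z = ideal_vecs I))"
    for n :: nat and s :: "int list \<times> ('v, 'k) mvec set \<times> int list \<times> (nat \<Rightarrow> nat \<Rightarrow> ('v, 'k) mpoly)"
  define Q where "Q s s' \<longleftrightarrow> (case s of (e, Z, d, A) \<Rightarrow> case s' of (e', Z', d', A') \<Rightarrow> e' = d \<and> Z' = syzygies V e d A)"
    for s s' :: "int list \<times> ('v, 'k) mvec set \<times> int list \<times> (nat \<Rightarrow> nat \<Rightarrow> ('v, 'k) mpoly)"
  have cov_ex: "\<exists>d A. minimal_cover V e Z d A" if "koszul_finite e Z" for e and Z :: "('v, 'k) mvec set"
    using that minimal_cover_exists[of e Z] unfolding koszul_finite_def by blast
  have "\<exists>s. \<forall>n. P n (s n) \<and> Q (s n) (s (Suc n))"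
  proof (rule dependent_nat_choice)
    show "\<exists>x. P 0 x" using cov_ex[OF fin] fin unfolding P_def by auto
  next
    fix x n assume "P n x"
    then obtain e Z d A where x: "x = (e, Z, d, A)" "koszul_finite e Z" "minimal_cover V e Z d A"
      unfolding P_def by (cases x) auto
    have "koszul_finite d (syzygies V e d A)" using koszul_finite_syzygies x by blast
    moreover from cov_ex[OF this] obtain d' A' where "minimal_cover V d (syzygies V e d A) d' A'" by blast
    ultimately have "P (Suc n) (d, syzygies V e d A, d', A') \<and> Q x (d, syzygies V e d A, d', A')"
      unfolding P_def Q_def x(1) by simp
    then show "\<exists>y. P (Suc n) y \<and> Q x y" by blast
  qed
  then obtain s where s: "\<And>n. P n (s n)" "\<And>n. Q (s n) (s (Suc n))" by blast
  define d where "d n = fst (snd (snd (s n)))" for n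
  define B where "B n = snd (snd (snd (s n)))" for n
  define g where "g = B 0 0"
  define A where "A n = B (Suc n)" for n
  have degs: "res_degs d n = fst (s n)" for n
  proof (cases n)
    case 0
    then show ?thesis using s(1)[of 0] by (auto simp: P_def split: prod.splits)
  next
    case (Suc k)
    then show ?thesis using s(2)[of k] by (auto simp: Q_def d_def split: prod.splits)
  qed
  \<comment> \<open>For n = 0 \<open>res_mat\<close> repeats g in every row, whereas
    \<open>B 0\<close> is only known to be right in its first row; the two agree because the degree
    list [0] has length 1.\<close>
  have mat: "graded_matrix V e d (res_mat g A n) = graded_matrix V e d (B n)"
    "amap e d (res_mat g A n) = amap e d (B n)" if "n = 0 \<longrightarrow> e = [0]" for n e d
  proof -
    have "res_mat g A n r c = B n r c" if "r < length e" for r c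
      using that \<open>n = 0 \<longrightarrow> e = [0]\<close> by (cases n) (auto simp: g_def A_def)
    then show "graded_matrix V e d (res_mat g A n) = graded_matrix V e d (B n)"
      "amap e d (res_mat g A n) = amap e d (B n)"
      by (auto simp: graded_matrix_def mat_app_def fun_eq_iff)
  qed
  have e0: "n = 0 \<longrightarrow> fst (s n) = [0]" for n using degs[of n] by auto
  have cov_eq: "minimal_cover V (fst (s n)) Z (d n) (res_mat g A n) = minimal_cover V (fst (s n)) Z (d n) (B n)"
    "syzygies V (fst (s n)) (d n) (res_mat g A n) = syzygies V (fst (s n)) (d n) (B n)" for n Z
    using mat[OF e0] by (auto simp: minimal_cover_def syzygies_def)
  have mods: "res_mod V I d g A n = fst (snd (s n))" for n
  proof (cases n)
    case 0
    then show ?thesis using s(1)[of 0] by (auto simp: P_def split: prod.splits)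
  next
    case (Suc k)
    then show ?thesis using s(2)[of k] cov_eq(2)[of k] degs[of k]
      by (auto simp: Q_def d_def B_def split: prod.splits)
  qed
  have "minimal_cover V (res_degs d n) (res_mod V I d g A n) (d n) (res_mat g A n)" for n
    using s(1)[of n] unfolding mods degs cov_eq by (auto simp: P_def d_def B_def split: prod.splits)
  then show ?thesis unfolding minimal_graded_free_resolution_iff by blast
qed

text \<open>All resolutions count the dimension of the same homology space, and one exists, so the
  definite description denotes.\<close>

lemma graded_betti_koszul:
  assumes fin: "koszul_finite [0] (ideal_vecs I)"
  shows "mchain.quot_dim (mcycles V [0] (ideal_vecs I) i j) (mbounds V [0] (ideal_vecs I) i j) (graded_betti V I i j)"
proof -
  have I: "graded_submodule V [0] (ideal_vecs I)" using fin by (simp add: koszul_finite_def)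
  obtain d g A where res: "minimal_graded_free_resolution V I d g A" using resolution_exists[OF fin] by blast
  have "graded_betti V I i j = count_list (d i) j"
    unfolding graded_betti_def
  proof (rule the_equality)
    fix b assume "\<exists>d g A. minimal_graded_free_resolution V I d g A \<and> b = count_list (d i) j"
    then show "b = count_list (d i) j"
      using mchain.quot_dim_unique[OF subspace_mbounds[OF I]] resolution_koszul[OF I] res by metis
  qed (use res in blast)
  then show ?thesis using resolution_koszul[OF I res] by simp
qed

lemma graded_betti_nonzero:
  assumes fin: "koszul_finite [0] (ideal_vecs I)"
  shows "graded_betti V I i j \<noteq> 0 \<longleftrightarrow>
    \<not> mcycles V [0] (ideal_vecs I) i j \<subseteq> mbounds V [0] (ideal_vecs I) i j"
proof -
  have I: "graded_submodule V [0] (ideal_vecs I)" using fin by (simp add: koszul_finite_def)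
  show ?thesis
    by (simp only: mchain.quot_dim_0_iff[OF subspace_mbounds[OF I] subspace_mcycles[OF I]
          graded_betti_koszul[OF fin, of i j]])
qed

end

section \<open>Regularity of monomial ideals\<close>

definition mono_ideal :: "('v \<Rightarrow>\<^sub>0 nat) set \<Rightarrow> ('v, 'k::field) mpoly set" where
  "mono_ideal U = {p. keys p \<subseteq> U}"

definition upset :: "'v set \<Rightarrow> ('v \<Rightarrow>\<^sub>0 nat) set \<Rightarrow> ('v \<Rightarrow>\<^sub>0 nat) set" where
  "upset V G = {m. keys m \<subseteq> V \<and> (\<exists>g\<in>G. \<forall>v. lookup g v \<le> lookup m v)}"

text \<open>The upper Koszul complex of the ideal at \<alpha>. The set \<open>U\<close> is
  arbitrary: for the exponents in a difference of two monomial ideals this is the difference of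
  their complexes, used for relative homology.\<close>

definition faces :: "'v set \<Rightarrow> ('v \<Rightarrow>\<^sub>0 nat) set \<Rightarrow> ('v \<Rightarrow>\<^sub>0 nat) \<Rightarrow> 'v set set" where
  "faces V U \<alpha> = {\<sigma>. \<sigma> \<subseteq> V \<and> \<sigma> \<subseteq> keys \<alpha> \<and> \<alpha> - face_mon \<sigma> \<in> U}"

definition up_closed :: "'v set \<Rightarrow> ('v \<Rightarrow>\<^sub>0 nat) set \<Rightarrow> bool" where
  "up_closed V U \<longleftrightarrow> (\<forall>m\<in>U. keys m \<subseteq> V) \<and> (\<forall>m\<in>U. \<forall>n. keys n \<subseteq> V \<longrightarrow> (\<forall>v. lookup m v \<le> lookup n v) \<longrightarrow> n \<in> U)"

lemma up_closed_upset: "up_closed V (upset V G)"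
  unfolding up_closed_def
proof (intro conjI ballI allI impI)
  fix m n assume m: "m \<in> upset V G" and n: "keys n \<subseteq> V" "\<forall>v. lookup m v \<le> lookup n v"
  then obtain g where "g \<in> G" "\<forall>v. lookup g v \<le> lookup m v" by (auto simp: upset_def)
  then have "\<forall>v. lookup g v \<le> lookup n v" using n(2) le_trans by blast
  then show "n \<in> upset V G" using n(1) \<open>g \<in> G\<close> by (auto simp: upset_def)
qed (simp add: upset_def)

lemma ext_upD:
  assumes "up_closed V U"
  shows "m \<in> U \<Longrightarrow> keys m \<subseteq> V" "m \<in> U \<Longrightarrow> keys n \<subseteq> V \<Longrightarrow> (\<And>v. lookup m v \<le> lookup n v) \<Longrightarrow> n \<in> U"
  using assms unfolding up_closed_def by blast+

lemma graded_submodule_mono_ideal: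
  fixes U :: "('v \<Rightarrow>\<^sub>0 nat) set"
  assumes U: "up_closed V U"
  shows "graded_submodule V [0] (ideal_vecs (mono_ideal U :: ('v, 'k::field) mpoly set))"
  unfolding graded_submodule_def
proof (intro conjI ballI allI subsetI)
  let ?Z = "ideal_vecs (mono_ideal U :: ('v, 'k) mpoly set)"
  show "u \<in> free_mod V (length [0])" if "u \<in> ?Z" for u
    using that ext_upD(1)[OF U] by (auto simp: ideal_vecs_def mono_ideal_def free_mod_def polys_iff)
  show "0 \<in> ?Z" by (simp add: ideal_vecs_def mono_ideal_def)
  show "u + w \<in> ?Z" if "u \<in> ?Z" "w \<in> ?Z" for u w
    using that keys_add[of "u 0" "w 0"] by (auto simp: ideal_vecs_def mono_ideal_def)
  show "smul p u \<in> ?Z" if p: "p \<in> polys V" and u: "u \<in> ?Z" for p u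
  proof -
    have "keys (p * u 0) \<subseteq> U"
    proof
      fix m assume "m \<in> keys (p * u 0)"
      then obtain a b where m: "a \<in> keys p" "b \<in> keys (u 0)" "m = a + b" using keys_mult[of p "u 0"] by blast
      then have b: "b \<in> U" "keys a \<subseteq> V" using u p by (auto simp: ideal_vecs_def mono_ideal_def polys_iff)
      then have "keys m \<subseteq> V" using keys_add[of a b] ext_upD(1)[OF U b(1)] m(3) by auto
      then show "m \<in> U" by (rule ext_upD(2)[OF U b(1)]) (simp add: m lookup_add)
    qed
    then show ?thesis using u by (simp add: ideal_vecs_def mono_ideal_def)
  qed
  show "hcomp [0] j u \<in> ?Z" if "u \<in> ?Z" for u j
    using that by (auto simp: ideal_vecs_def mono_ideal_def hcomp_def keys_hpart)
qed

section \<open>Regularity of a monomial ideal from its Koszul complexes\<close>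

context finite_vars
begin

lemma face_closed_faces:
  assumes U: "up_closed V U" shows "face_closed (faces V U \<alpha>)"
  unfolding face_closed_def
proof (intro ballI allI impI)
  fix \<sigma> \<rho> assume \<sigma>: "\<sigma> \<in> faces V U \<alpha>" and sub: "\<rho> \<subseteq> \<sigma>"
  then have \<sigma>': "\<sigma> \<subseteq> V" "\<sigma> \<subseteq> keys \<alpha>" "\<alpha> - face_mon \<sigma> \<in> U" by (auto simp: faces_def)
  have fin: "finite \<sigma>" "finite \<rho>" using \<sigma>' sub finV by (auto intro: finite_subset)
  have ka: "keys \<alpha> \<subseteq> V"
  proof
    fix v assume "v \<in> keys \<alpha>"
    then show "v \<in> V" using ext_upD(1)[OF U \<sigma>'(3)] \<sigma>'(1) fin
      by (cases "v \<in> \<sigma>") (auto simp: in_keys_iff lookup_minus lookup_face_mon subset_iff)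
  qed
  have "keys (\<alpha> - face_mon \<rho>) \<subseteq> V" using keys_minus_nat[of \<alpha> "face_mon \<rho>"] ka by blast
  then have "\<alpha> - face_mon \<rho> \<in> U"
    by (rule ext_upD(2)[OF U \<sigma>'(3)]) (use sub fin in \<open>auto simp: lookup_minus lookup_face_mon\<close>)
  then show "\<rho> \<in> faces V U \<alpha>" using sub \<sigma>' by (auto simp: faces_def)
qed

text \<open>Cycles and primitives are split into strands and put together again. The ideal is felt
  only through the support condition: the strand at \<alpha> of a chain with entries in the ideal
  lives on \<open>faces V U \<alpha>\<close>.\<close>

lemma exact_mono_ideal:
  assumes U: "up_closed V U"
  shows "mcycles V [0] (ideal_vecs (mono_ideal U :: ('v, 'k::field) mpoly set)) p j
      \<subseteq> mbounds V [0] (ideal_vecs (mono_ideal U)) p j \<longleftrightarrow>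
    (\<forall>\<alpha>. int (mdeg \<alpha>) = j \<longrightarrow> exact_at TYPE('k) V (faces V U \<alpha>) p)"
    (is "mcycles V [0] ?Z p j \<subseteq> _ \<longleftrightarrow> _")
proof -
  let ?F = "free_mod V (length [0::int])"
  have Z: "graded_submodule V [0] ?Z" by (rule graded_submodule_mono_ideal[OF U])
  have ZF: "?Z \<subseteq> ?F" using graded_submoduleD(1)[OF Z] by blast
  have Z_iff: "u \<in> ?Z \<longleftrightarrow> u \<in> ?F \<and> keys (u 0) \<subseteq> U" for u
    using ZF by (auto simp: ideal_vecs_def mono_ideal_def free_mod_def)
  have strand_Z: "strand \<alpha> (\<lambda>\<sigma>. c \<sigma> 0) \<in> kchains (faces V U \<alpha>) q" if c: "c \<in> mchains V [0] ?Z q j"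
    for c :: "('v, 'k) mchain" and q and \<alpha> :: "'v \<Rightarrow>\<^sub>0 nat"
    unfolding kchains_def
  proof (intro CollectI allI impI)
    fix \<sigma> assume ne: "strand \<alpha> (\<lambda>\<sigma>. c \<sigma> 0) \<sigma> \<noteq> 0"
    then have sub: "\<sigma> \<subseteq> keys \<alpha>" and key: "\<alpha> - face_mon \<sigma> \<in> keys (c \<sigma> 0)"
      by (auto simp: strand_def in_keys_iff split: if_splits)
    then have "c \<sigma> \<noteq> 0" by auto
    then show "\<sigma> \<in> faces V U \<alpha> \<and> card \<sigma> = q"
      using mchainsD[OF c, of \<sigma>] Z_iff[of "c \<sigma>"] key sub by (auto simp: faces_def)
  qed
  have in_Z: "y \<in> mchains V [0] ?Z q j"
    if y: "y \<in> mchains V [0] ?F q j"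
      and s: "\<And>\<alpha>. keys \<alpha> \<subseteq> V \<Longrightarrow> int (mdeg \<alpha>) = j \<Longrightarrow> strand \<alpha> (\<lambda>\<sigma>. y \<sigma> 0) \<in> kchains (faces V U \<alpha>) q"
    for y q
  proof -
    have "keys (y \<sigma> 0) \<subseteq> U" for \<sigma>
    proof
      fix m assume m: "m \<in> keys (y \<sigma> 0)"
      then have ne: "y \<sigma> \<noteq> 0" by auto
      note y\<sigma> = mchainsD(1,2)[OF y, of \<sigma>] mchainsD(3,4)[OF y ne]
      have fin: "finite \<sigma>" using y\<sigma>(3) finV finite_subset by blast
      have "keys (m + face_mon \<sigma>) \<subseteq> V"
        using keys_add[of m "face_mon \<sigma>"] y\<sigma>(1,3) m fin by (auto simp: free_mod_def polys_iff keys_face_mon)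
      moreover have "int (mdeg (m + face_mon \<sigma>)) = j"
        using y\<sigma>(2,4) m fin by (auto simp: hvec_def homogeneous_def mdeg_add mdeg_face_mon)
      ultimately have "strand (m + face_mon \<sigma>) (\<lambda>\<sigma>. y \<sigma> 0) \<in> kchains (faces V U (m + face_mon \<sigma>)) q" by (rule s)
      moreover have "strand (m + face_mon \<sigma>) (\<lambda>\<sigma>. y \<sigma> 0) \<sigma> \<noteq> 0"
        using m lookup_strand[OF fin, of "\<lambda>\<sigma>. y \<sigma> 0" m] by (simp add: in_keys_iff)
      ultimately show "m \<in> U" by (auto simp: kchains_def faces_def)
    qed
    then show ?thesis using y mchainsD(1)[OF y] unfolding mchains_subset_iff[OF ZF] Z_iff by blast
  qed
  show ?thesis
  proof (intro iffI allI impI)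
    assume ex: "mcycles V [0] ?Z p j \<subseteq> mbounds V [0] ?Z p j"
    fix \<alpha> :: "'v \<Rightarrow>\<^sub>0 nat" assume deg: "int (mdeg \<alpha>) = j"
    show "exact_at TYPE('k) V (faces V U \<alpha>) p"
    proof (rule exact_atI)
      fix a :: "'v set \<Rightarrow> 'k"
      assume a: "a \<in> kchains (faces V U \<alpha>) p" "\<And>\<rho>. \<rho> \<in> faces V U \<alpha> \<Longrightarrow> bd V a \<rho> = 0"
      have cyc: "bd V a \<rho> = 0" for \<rho>
      proof (rule ccontr)
        assume ne: "bd V a \<rho> \<noteq> 0"
        then obtain v where "a (insert v \<rho>) \<noteq> 0" using kbd_nonzero by blast
        then have "insert v \<rho> \<in> faces V U \<alpha>" using a(1) by (auto simp: kchains_def)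
        then have "\<rho> \<in> faces V U \<alpha>" using face_closed_faces[OF U] unfolding face_closed_def by blast
        then show False using a(2) ne by blast
      qed
      \<comment> \<open>The cycle a in multidegree \<alpha> becomes a Koszul cycle whose strands in
        all other multidegrees are zero.\<close>
      define b where "b \<beta> r = (if \<beta> = \<alpha> then a else (\<lambda>_. 0))" for \<beta> and r :: nat
      have "\<exists>c\<in>mchains V [0] ?F p j. \<forall>r<length [0::int]. \<forall>\<beta>. keys \<beta> \<subseteq> V \<longrightarrow> int (mdeg \<beta>) = j - [0] ! r
          \<longrightarrow> strand \<beta> (\<lambda>\<sigma>. c \<sigma> r) = b \<beta> r"
        by (rule assemble_strands) (use a(1) in \<open>auto simp: b_def kchains_def faces_def split: if_splits\<close>)
      then obtain c where c: "c \<in> mchains V [0] ?F p j"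
        "\<And>\<beta>. keys \<beta> \<subseteq> V \<Longrightarrow> int (mdeg \<beta>) = j \<Longrightarrow> strand \<beta> (\<lambda>\<sigma>. c \<sigma> 0) = b \<beta> 0" by auto
      have cZ: "c \<in> mchains V [0] ?Z p j"
        by (rule in_Z[OF c(1)]) (use c(2) a(1) in \<open>auto simp: b_def kchains_def\<close>)
      show "\<exists>b\<in>kchains (faces V U \<alpha>) (Suc p). \<forall>\<rho>\<in>faces V U \<alpha>. bd V b \<rho> = a \<rho>"
      proof (cases "keys \<alpha> \<subseteq> V")
        case False
        have "faces V U \<alpha> = {}"
        proof (rule ccontr)
          assume "faces V U \<alpha> \<noteq> {}"
          then obtain \<sigma> where "\<sigma> \<in> faces V U \<alpha>" by blast
          then have "{} \<in> faces V U \<alpha>" using face_closed_faces[OF U] unfolding face_closed_def by blast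
          then have "\<alpha> \<in> U" by (simp add: faces_def)
          then show False using False ext_upD(1)[OF U] by blast
        qed
        then show ?thesis by (intro bexI[of _ "\<lambda>_. 0"]) (auto simp: kchains_def)
      next
        case True
        have "koszul_d V c = 0"
        proof (cases p)
          case 0
          then show ?thesis using mchains_0_vchain[of c] c(1) koszul_d_vchain[of V "c {}"] by metis
        next
          case (Suc q)
          show ?thesis
          proof (rule mchains_eqI)
            show "koszul_d V c \<in> mchains V [0] ?F q j"
              using c(1) Suc by (intro koszul_d_mchains graded_submodule_free_mod) simp
            show "0 \<in> mchains V [0] ?F q j"
              using mchain.subspace_0[OF subspace_mchains[OF graded_submodule_free_mod]] by blast
            fix r \<beta> \<rho> assume *: "r < length [0::int]" "keys \<beta> \<subseteq> V" "int (mdeg \<beta>) = j - [0] ! r"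
              "\<rho> \<subseteq> V" "\<rho> \<subseteq> keys \<beta>"
            then have "strand \<beta> (\<lambda>\<sigma>. koszul_d V c \<sigma> r) \<rho> = bd V (b \<beta> 0) \<rho>"
              using strand_koszul_d[of \<rho> \<beta> c r] c(2)[of \<beta>] by simp
            also have "\<dots> = 0" using cyc by (simp add: b_def kbd_eq_0)
            finally show "strand \<beta> (\<lambda>\<sigma>. koszul_d V c \<sigma> r) \<rho> = strand \<beta> (\<lambda>\<sigma>. (0 :: ('v, 'k) mchain) \<sigma> r) \<rho>"
              by (simp add: strand_def)
          qed
        qed
        then have "c \<in> mcycles V [0] ?Z p j" using cZ by (simp add: mcycles_def)
        then obtain y where y: "y \<in> mchains V [0] ?Z (Suc p) j" "c = koszul_d V y" using ex by (auto simp: mbounds_def)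
        have "bd V (strand \<alpha> (\<lambda>\<sigma>. y \<sigma> 0)) \<rho> = a \<rho>" if "\<rho> \<in> faces V U \<alpha>" for \<rho>
          using that strand_koszul_d[of \<rho> \<alpha> y 0] c(2)[OF True deg] y(2) by (auto simp: faces_def b_def)
        then show ?thesis using strand_Z[OF y(1)] by blast
      qed
    qed
  next
    assume ex: "\<forall>\<alpha>. int (mdeg \<alpha>) = j \<longrightarrow> exact_at TYPE('k) V (faces V U \<alpha>) p"
    show "mcycles V [0] ?Z p j \<subseteq> mbounds V [0] ?Z p j"
    proof
      fix c assume "c \<in> mcycles V [0] ?Z p j"
      then have c: "c \<in> mchains V [0] ?Z p j" "koszul_d V c = 0" by (auto simp: mcycles_def)
      have "\<exists>b\<in>kchains (faces V U \<alpha>) (Suc p). int (mdeg \<alpha>) = j \<longrightarrow>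
          (\<forall>\<rho>\<in>faces V U \<alpha>. bd V b \<rho> = strand \<alpha> (\<lambda>\<sigma>. c \<sigma> 0) \<rho>)" for \<alpha>
      proof (cases "int (mdeg \<alpha>) = j")
        case True
        have "bd V (strand \<alpha> (\<lambda>\<sigma>. c \<sigma> 0)) \<rho> = 0" if "\<rho> \<in> faces V U \<alpha>" for \<rho>
          using that strand_koszul_d[of \<rho> \<alpha> c 0] c(2) by (auto simp: faces_def strand_def)
        then show ?thesis
          using exact_atE[of V "faces V U \<alpha>" p "strand \<alpha> (\<lambda>\<sigma>. c \<sigma> 0)"] ex True strand_Z[OF c(1)] by blast
      qed (intro bexI[of _ "\<lambda>_. 0"], auto simp: kchains_def)
      then obtain b where b: "\<And>\<alpha>. b \<alpha> \<in> kchains (faces V U \<alpha>) (Suc p)"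
        "\<And>\<alpha> \<rho>. int (mdeg \<alpha>) = j \<Longrightarrow> \<rho> \<in> faces V U \<alpha> \<Longrightarrow> bd V (b \<alpha>) \<rho> = strand \<alpha> (\<lambda>\<sigma>. c \<sigma> 0) \<rho>" by metis
      have "\<exists>y\<in>mchains V [0] ?F (Suc p) j. \<forall>r<length [0::int]. \<forall>\<beta>. keys \<beta> \<subseteq> V \<longrightarrow> int (mdeg \<beta>) = j - [0] ! r
          \<longrightarrow> strand \<beta> (\<lambda>\<sigma>. y \<sigma> r) = b \<beta>"
        by (rule assemble_strands) (use b(1) in \<open>auto simp: kchains_def faces_def\<close>)
      then obtain y where y: "y \<in> mchains V [0] ?F (Suc p) j"
        "\<And>\<beta>. keys \<beta> \<subseteq> V \<Longrightarrow> int (mdeg \<beta>) = j \<Longrightarrow> strand \<beta> (\<lambda>\<sigma>. y \<sigma> 0) = b \<beta>" by auto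
      have yZ: "y \<in> mchains V [0] ?Z (Suc p) j"
        by (rule in_Z[OF y(1)]) (use y(2) b(1) in auto)
      have "koszul_d V y = c"
      proof (rule mchains_eqI)
        show "koszul_d V y \<in> mchains V [0] ?F p j" by (rule koszul_d_mchains[OF graded_submodule_free_mod y(1)])
        show "c \<in> mchains V [0] ?F p j" using c(1) ZF by (rule mchains_mono)
        fix r \<beta> \<rho> assume *: "r < length [0::int]" "keys \<beta> \<subseteq> V" "int (mdeg \<beta>) = j - [0] ! r"
          "\<rho> \<subseteq> V" "\<rho> \<subseteq> keys \<beta>"
        then have r: "r = 0" "int (mdeg \<beta>) = j" by auto
        have s: "strand \<beta> (\<lambda>\<sigma>. koszul_d V y \<sigma> 0) \<rho> = bd V (b \<beta>) \<rho>"
          using strand_koszul_d[of \<rho> \<beta> y 0] y(2)[OF *(2) r(2)] * by simp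
        show "strand \<beta> (\<lambda>\<sigma>. koszul_d V y \<sigma> r) \<rho> = strand \<beta> (\<lambda>\<sigma>. c \<sigma> r) \<rho>"
        proof (cases "\<rho> \<in> faces V U \<beta>")
          case True
          then show ?thesis using s b(2)[OF r(2)] r(1) by simp
        next
          case False
          have "bd V (b \<beta>) \<rho> = 0"
          proof (rule kbd_eq_0)
            fix v
            have "insert v \<rho> \<notin> faces V U \<beta>"
              using False face_closed_faces[OF U, of \<beta>] unfolding face_closed_def by blast
            then show "b \<beta> (insert v \<rho>) = 0" using b(1)[of \<beta>] by (auto simp: kchains_def)
          qed
          moreover have "strand \<beta> (\<lambda>\<sigma>. c \<sigma> 0) \<rho> = 0"
            using strand_Z[OF c(1), of \<beta>] False by (auto simp: kchains_def)
          ultimately show ?thesis using s r(1) by simp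
        qed
      qed
      then show "c \<in> mbounds V [0] ?Z p j" using yZ unfolding mbounds_def by blast
    qed
  qed
qed

text \<open>If the exponent of v in \<alpha> exceeds that in every generator, lowering it by one
  does not leave the ideal, so the complex is a cone with apex v. Only boundedly many \<alpha>
  remain.\<close>

lemma not_exact_bounded:
  assumes G: "finite G" "\<And>g. g \<in> G \<Longrightarrow> keys g \<subseteq> V"
  shows "finite {(\<alpha>, i). \<not> exact_at TYPE('k::field) V (faces V (upset V G) \<alpha>) i}"
proof -
  define N where "N = Max (insert 0 (\<Union>g\<in>G. lookup g ` V))"
  have N: "lookup g v \<le> N" if "g \<in> G" for g v
  proof (cases "v \<in> V")
    case True
    then show ?thesis unfolding N_def using that G(1) finV by (intro Max_ge) auto
  next
    case False
    then have "v \<notin> keys g" using G(2)[OF that] by blast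
    then show ?thesis by (simp add: in_keys_iff)
  qed
  let ?B = "\<Union>n\<le>card V * N. {m. keys m \<subseteq> V \<and> mdeg m = n}"
  have "{(\<alpha>, i). \<not> exact_at TYPE('k) V (faces V (upset V G) \<alpha>) i} \<subseteq> ?B \<times> {..card V}"
  proof clarify
    fix \<alpha> :: "'v \<Rightarrow>\<^sub>0 nat" and i assume ne: "\<not> exact_at TYPE('k) V (faces V (upset V G) \<alpha>) i"
    have ex: "exact_at TYPE('k) V (faces V (upset V G) \<alpha>) i" if "\<And>\<sigma>. \<sigma> \<in> faces V (upset V G) \<alpha> \<Longrightarrow> card \<sigma> \<noteq> i"
      using that by (rule exact_at_no_faces)
    then obtain \<sigma> where \<sigma>: "\<sigma> \<in> faces V (upset V G) \<alpha>" "card \<sigma> = i" using ne by blast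
    then have "i \<le> card V" using finV by (auto simp: faces_def intro: card_mono)
    have "{} \<in> faces V (upset V G) \<alpha>"
      using face_closed_faces[OF up_closed_upset, of G \<alpha>] \<sigma>(1) unfolding face_closed_def by blast
    then have keys: "keys \<alpha> \<subseteq> V" by (simp add: faces_def upset_def)
    have "lookup \<alpha> v \<le> N" if v: "v \<in> V" for v
    proof (rule ccontr)
      assume big: "\<not> lookup \<alpha> v \<le> N"
      have "exact_at TYPE('k) V (faces V (upset V G) \<alpha>) i"
      proof (rule exact_at_cone[OF finV v])
        show "faces V (upset V G) \<alpha> \<subseteq> Pow V" by (auto simp: faces_def)
        show "\<rho> - {v} \<in> faces V (upset V G) \<alpha>" if "\<rho> \<in> faces V (upset V G) \<alpha>" for \<rho>
          using face_closed_faces[OF up_closed_upset, of G \<alpha>] that unfolding face_closed_def by blast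
        show "insert v \<rho> \<in> faces V (upset V G) \<alpha>" if \<rho>: "\<rho> \<in> faces V (upset V G) \<alpha>" for \<rho>
        proof -
          have \<rho>': "\<rho> \<subseteq> V" "\<rho> \<subseteq> keys \<alpha>" and "\<exists>g\<in>G. \<forall>u. lookup g u \<le> lookup (\<alpha> - face_mon \<rho>) u"
            using \<rho> by (auto simp: faces_def upset_def)
          then obtain g where g: "g \<in> G" "\<And>u. lookup g u \<le> lookup (\<alpha> - face_mon \<rho>) u" by blast
          have fin: "finite \<rho>" using \<rho>' finV finite_subset by blast
          have "lookup g u \<le> lookup (\<alpha> - face_mon (insert v \<rho>)) u" for u
          proof (cases "u = v")
            case True
            then show ?thesis using N[OF g(1), of v] big fin by (simp add: lookup_minus lookup_face_mon)
          next
            case False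
            then show ?thesis using g(2)[of u] fin by (simp add: lookup_minus lookup_face_mon)
          qed
          moreover have "keys (\<alpha> - face_mon (insert v \<rho>)) \<subseteq> V" using keys_minus_nat keys by (rule subset_trans)
          moreover have "v \<in> keys \<alpha>" using big by (simp add: in_keys_iff)
          ultimately show ?thesis using \<rho>' v g(1) unfolding faces_def upset_def by blast
        qed
      qed
      then show False using ne by blast
    qed
    then have "mdeg \<alpha> \<le> card V * N"
      using mdeg_eq_sum[OF finV keys] sum_bounded_above[of V "lookup \<alpha>" N] by simp
    then show "\<alpha> \<in> ?B \<and> i \<in> {..card V}" using keys \<open>i \<le> card V\<close> by simp
  qed
  moreover have "finite (?B \<times> {..card V})" using finite_monomials_of_degree[OF finV] by auto
  ultimately show ?thesis by (rule finite_subset)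
qed

definition shifted_degs :: "'k::field itself \<Rightarrow> ('v \<Rightarrow>\<^sub>0 nat) set \<Rightarrow> int set" where
  "shifted_degs K U = {int (mdeg \<alpha>) - int i | \<alpha> i. \<not> exact_at TYPE('k) V (faces V U \<alpha>) i}"

text \<open>For a generator of least degree the complex consists of the empty face alone, since a
  larger face would give an element of smaller degree. The empty face is then a cycle that does not
  bound.\<close>

lemma generator_not_exact:
  assumes G: "finite G" "G \<noteq> {}" "\<And>g. g \<in> G \<Longrightarrow> keys g \<subseteq> V"
  shows "\<exists>g\<in>G. \<not> exact_at TYPE('k::field) V (faces V (upset V G) g) 0"
proof -
  define g where "g = arg_min_on mdeg G"
  have g: "g \<in> G" "\<And>g'. g' \<in> G \<Longrightarrow> mdeg g \<le> mdeg g'"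
    unfolding g_def using arg_min_if_finite[OF G(1,2), of mdeg] by (auto simp: not_less)
  have face: "{} \<in> faces V (upset V G) g" using g(1) G(3) by (auto simp: faces_def upset_def)
  have noface: "insert v {} \<notin> faces V (upset V G) g" for v
  proof
    assume "insert v {} \<in> faces V (upset V G) g"
    then obtain g' where *: "v \<in> V" "v \<in> keys g" "g' \<in> G" "\<And>u. lookup g' u \<le> lookup (g - face_mon {v}) u"
      by (auto simp: faces_def upset_def)
    have "mdeg g' = sum (lookup g') V" "mdeg g = sum (lookup g) V"
      using mdeg_eq_sum[OF finV] G(3) * g(1) by auto
    moreover have "sum (lookup g') V < sum (lookup g) V"
    proof (rule sum_strict_mono_ex1[OF finV])
      show "\<forall>u\<in>V. lookup g' u \<le> lookup g u" using *(4) by (auto simp: lookup_minus intro: le_trans[OF _ diff_le_self])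
      have "lookup g' v < lookup g v" using *(4)[of v] *(2) by (simp add: lookup_minus lookup_face_mon in_keys_iff)
      then show "\<exists>u\<in>V. lookup g' u < lookup g u" using *(1) by blast
    qed
    ultimately show False using g(2)[OF *(3)] by simp
  qed
  define a :: "'v set \<Rightarrow> 'k" where "a \<sigma> = of_bool (\<sigma> = {})" for \<sigma>
  have "a \<in> kchains (faces V (upset V G) g) 0" using face by (auto simp: kchains_def a_def)
  moreover have "bd V a \<rho> = 0" for \<rho> by (rule kbd_eq_0) (simp add: a_def)
  moreover have "bd V b {} \<noteq> a {}" if "b \<in> kchains (faces V (upset V G) g) (Suc 0)" for b
  proof -
    have "b (insert v {}) = 0" for v using that noface by (auto simp: kchains_def)
    then have "bd V b {} = 0" by (intro kbd_eq_0)
    then show ?thesis by (simp add: a_def)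
  qed
  ultimately have "\<not> exact_at TYPE('k) V (faces V (upset V G) g) 0"
    using exact_atE[of V "faces V (upset V G) g" 0 a] face by metis
  then show ?thesis using g(1) by blast
qed

text \<open>A Betti number at (i, j) is nonzero iff some \<alpha> of degree j has homology at i.
  Finiteness and nonemptiness are part of the conclusion because \<open>Max\<close> is meaningful
  only with them.\<close>

theorem reg_mono_ideal:
  assumes "finite G" "G \<noteq> {}" "\<forall>g\<in>G. keys g \<subseteq> V"
  shows "finite (shifted_degs TYPE('k::field) (upset V G))" "shifted_degs TYPE('k) (upset V G) \<noteq> {}"
    "reg V (mono_ideal (upset V G) :: ('v, 'k) mpoly set) = Max (shifted_degs TYPE('k) (upset V G))"
proof -
  note G = assms(1,2) assms(3)[rule_format]
  let ?U = "upset V G"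
  let ?I = "mono_ideal ?U :: ('v, 'k) mpoly set"
  let ?E = "{(\<alpha>, i). \<not> exact_at TYPE('k) V (faces V ?U \<alpha>) i}"
  have finE: "finite ?E" by (rule not_exact_bounded[OF G(1,3)])
  have "shifted_degs TYPE('k) ?U = (\<lambda>(\<alpha>, i). int (mdeg \<alpha>) - int i) ` ?E"
    by (auto simp: shifted_degs_def)
  then show "finite (shifted_degs TYPE('k) ?U)" using finE by simp
  obtain g where g: "g \<in> G" "\<not> exact_at TYPE('k) V (faces V ?U g) 0"
    using generator_not_exact[OF G] by blast
  then show "shifted_degs TYPE('k) ?U \<noteq> {}" by (auto simp: shifted_degs_def)
  have ex: "mcycles V [0] (ideal_vecs ?I) p j \<subseteq> mbounds V [0] (ideal_vecs ?I) p j \<longleftrightarrow>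
    (\<forall>\<alpha>. int (mdeg \<alpha>) = j \<longrightarrow> exact_at TYPE('k) V (faces V ?U \<alpha>) p)" for p j
    by (rule exact_mono_ideal[OF up_closed_upset])
  have "finite {j. \<not> mcycles V [0] (ideal_vecs ?I) p j \<subseteq> mbounds V [0] (ideal_vecs ?I) p j}" for p
  proof (rule finite_subset)
    show "{j. \<not> mcycles V [0] (ideal_vecs ?I) p j \<subseteq> mbounds V [0] (ideal_vecs ?I) p j}
        \<subseteq> (\<lambda>(\<alpha>, i). int (mdeg \<alpha>)) ` ?E" unfolding ex by force
  qed (use finE in simp)
  then have fin: "koszul_finite [0] (ideal_vecs ?I)"
    using graded_submodule_mono_ideal[OF up_closed_upset] by (simp add: koszul_finite_def)
  have "{j - int i | i j. graded_betti V ?I i j \<noteq> 0} = shifted_degs TYPE('k) ?U"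
    unfolding graded_betti_nonzero[OF fin] ex shifted_degs_def by blast
  moreover have "?I \<noteq> {0}"
  proof -
    have "single g 1 \<in> ?I" using g(1) G(3) by (auto simp: mono_ideal_def upset_def)
    moreover have "single g (1::'k) \<noteq> 0" by (metis lookup_single_eq lookup_zero zero_neq_one)
    ultimately show ?thesis by blast
  qed
  ultimately show "reg V ?I = Max (shifted_degs TYPE('k) ?U)" by (simp add: reg_def)
qed

end

section \<open>Algebra of monomial ideals\<close>

lemma sum_monomials: "(\<Sum>m\<in>keys p. single m (lookup p m)) = p"
proof (rule poly_mapping_eqI)
  fix n
  have "(\<Sum>m\<in>keys p. lookup (single m (lookup p m)) n) = (\<Sum>m\<in>keys p. if m = n then lookup p n else 0)"
    by (rule sum.cong) (auto simp: lookup_single when_def)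
  then show "lookup (\<Sum>m\<in>keys p. single m (lookup p m)) n = lookup p n"
    by (simp add: lookup_sum in_keys_iff)
qed

lemma polys_idealI:
  fixes I :: "('v, 'k::field) mpoly set"
  assumes sub: "I \<subseteq> polys V" and zero: "0 \<in> I" and add: "\<And>p q. p \<in> I \<Longrightarrow> q \<in> I \<Longrightarrow> p + q \<in> I"
    and mult: "\<And>p q. p \<in> polys V \<Longrightarrow> q \<in> I \<Longrightarrow> p * q \<in> I"
  shows "ideal I (poly_ring V)"
proof -
  interpret cring "poly_ring V :: ('v, 'k) mpoly ring" by (rule cring_poly_ring)
  show ?thesis
  proof (rule idealI)
    show "ring (poly_ring V :: ('v, 'k) mpoly ring)" by (rule ring_axioms)
    show "subgroup I (add_monoid (poly_ring V))"
    proof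
      show "I \<subseteq> carrier (add_monoid (poly_ring V))" using sub by simp
      show "x \<otimes>\<^bsub>add_monoid (poly_ring V)\<^esub> y \<in> I" if "x \<in> I" "y \<in> I" for x y using add that by simp
      show "\<one>\<^bsub>add_monoid (poly_ring V)\<^esub> \<in> I" using zero by simp
      fix x assume x: "x \<in> I"
      have "\<ominus>\<^bsub>poly_ring V\<^esub> x = (\<ominus>\<^bsub>poly_ring V\<^esub> \<one>\<^bsub>poly_ring V\<^esub>) \<otimes>\<^bsub>poly_ring V\<^esub> x"
        using sub x l_minus[of "\<one>\<^bsub>poly_ring V\<^esub>" x] l_one[of x] by auto
      also have "\<dots> \<in> I" using mult[OF a_inv_closed[OF one_closed] x] by simp
      finally show "inv\<^bsub>add_monoid (poly_ring V)\<^esub> x \<in> I" by (simp add: a_inv_def)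
    qed
    show "x \<otimes>\<^bsub>poly_ring V\<^esub> a \<in> I" "a \<otimes>\<^bsub>poly_ring V\<^esub> x \<in> I"
      if "a \<in> I" "x \<in> polys V" for a x
      using mult[OF that(2,1)] by (simp_all add: mult.commute)
  qed
qed

lemma polys_idealD:
  fixes I :: "('v, 'k::field) mpoly set"
  assumes "ideal I (poly_ring V)"
  shows "p \<in> I \<Longrightarrow> p \<in> polys V" "0 \<in> I" "p \<in> I \<Longrightarrow> q \<in> I \<Longrightarrow> p + q \<in> I"
    "p \<in> polys V \<Longrightarrow> q \<in> I \<Longrightarrow> p * q \<in> I"
proof -
  interpret ideal I "poly_ring V" by fact
  show "p \<in> I \<Longrightarrow> p \<in> polys V" by (rule Icarr)
  show "0 \<in> I" using additive_subgroup.zero_closed[OF is_additive_subgroup] by simp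
  show "p \<in> I \<Longrightarrow> q \<in> I \<Longrightarrow> p + q \<in> I" using additive_subgroup.a_closed[OF is_additive_subgroup, of p q] by simp
  show "p \<in> polys V \<Longrightarrow> q \<in> I \<Longrightarrow> p * q \<in> I" using I_l_closed[of q p] by simp
qed

lemma polys_ideal_sum:
  fixes I :: "('v, 'k::field) mpoly set"
  assumes "ideal I (poly_ring V)"
  shows "(\<And>x. x \<in> S \<Longrightarrow> f x \<in> I) \<Longrightarrow> sum f S \<in> I"
  by (induction S rule: infinite_finite_induct) (auto intro: polys_idealD[OF assms])

lemma keys_mult_subset:
  assumes "\<And>a b. a \<in> keys p \<Longrightarrow> b \<in> keys q \<Longrightarrow> a + b \<in> U"
  shows "keys (p * q) \<subseteq> U"
  using assms keys_mult[of p q] by blast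

lemma upset_add:
  assumes "m \<in> upset V G" "keys n \<subseteq> V" shows "n + m \<in> upset V G"
proof (rule ext_upD(2)[OF up_closed_upset assms(1)])
  show "keys (n + m) \<subseteq> V" using keys_add[of n m] assms by (auto simp: upset_def)
qed (simp add: lookup_add)

lemma upset_add_upset:
  assumes "m \<in> upset V G" "n \<in> upset V H" shows "m + n \<in> upset V {g + h |g h. g \<in> G \<and> h \<in> H}"
proof -
  obtain g h where "g \<in> G" "\<And>v. lookup g v \<le> lookup m v" "h \<in> H" "\<And>v. lookup h v \<le> lookup n v"
    using assms by (auto simp: upset_def)
  moreover from this have "lookup (g + h) v \<le> lookup (m + n) v" for v by (simp add: lookup_add add_mono)
  moreover have "keys (m + n) \<subseteq> V" using keys_add[of m n] assms by (auto simp: upset_def)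
  ultimately show ?thesis unfolding upset_def by blast
qed

lemma upset_decompose:
  assumes "m \<in> upset V G"
  obtains g where "g \<in> G" "m = (m - g) + g" "keys (m - g) \<subseteq> V"
proof -
  obtain g where g: "g \<in> G" "\<And>v. lookup g v \<le> lookup m v" using assms by (auto simp: upset_def)
  have "m = (m - g) + g" using g(2) by (intro poly_mapping_eqI) (simp add: lookup_add lookup_minus)
  moreover have "keys (m - g) \<subseteq> V" using keys_minus_nat[of m g] assms by (auto simp: upset_def)
  ultimately show thesis using that g(1) by blast
qed

lemma generator_in_upset: "g \<in> G \<Longrightarrow> keys g \<subseteq> V \<Longrightarrow> g \<in> upset V G"
  by (auto simp: upset_def)

lemma single_in_mono_ideal: "m \<in> U \<Longrightarrow> single m k \<in> mono_ideal U"
  by (simp add: mono_ideal_def)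

lemma mono_ideal_ideal:
  fixes U :: "('v \<Rightarrow>\<^sub>0 nat) set"
  assumes U: "up_closed V U" shows "ideal (mono_ideal U :: ('v, 'k::field) mpoly set) (poly_ring V)"
proof (rule polys_idealI)
  show "(mono_ideal U :: ('v, 'k) mpoly set) \<subseteq> polys V"
  proof (intro subsetI)
    fix p :: "('v, 'k) mpoly" assume "p \<in> mono_ideal U"
    then have "keys m \<subseteq> V" if "m \<in> keys p" for m
      using that ext_upD(1)[OF U, of m] unfolding mono_ideal_def by blast
    then show "p \<in> polys V" unfolding polys_iff by blast
  qed
  show "0 \<in> mono_ideal U" by (simp add: mono_ideal_def)
  show "p + q \<in> mono_ideal U" if "p \<in> mono_ideal U" "q \<in> mono_ideal U" for p q :: "('v, 'k) mpoly"
    using that keys_add[of p q] by (auto simp: mono_ideal_def)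
  show "p * q \<in> mono_ideal U" if p: "p \<in> polys V" and q: "q \<in> mono_ideal U" for p q :: "('v, 'k) mpoly"
    unfolding mono_ideal_def mem_Collect_eq
  proof (rule keys_mult_subset)
    fix a b assume a: "a \<in> keys p" and b: "b \<in> keys q"
    have bU: "b \<in> U" and "keys a \<subseteq> V" using p q a b by (auto simp: mono_ideal_def polys_iff)
    moreover have "keys (a + b) \<subseteq> V" using keys_add[of a b] ext_upD(1)[OF U bU] \<open>keys a \<subseteq> V\<close> by blast
    ultimately show "a + b \<in> U" using ext_upD(2)[OF U bU] by (simp add: lookup_add)
  qed
qed

lemma genideal_monomials:
  assumes G: "\<And>g. g \<in> G \<Longrightarrow> keys g \<subseteq> V"
  shows "Idl\<^bsub>poly_ring V\<^esub> ((\<lambda>g. single g (1::'k::field)) ` G) = mono_ideal (upset V G)"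
    (is "Idl\<^bsub>?R\<^esub> ?S = ?I")
proof -
  interpret cring ?R by (rule cring_poly_ring)
  have S: "?S \<subseteq> carrier ?R" by (intro image_subsetI single_in_polys G)
  note I = genideal_ideal[OF S]
  show ?thesis
  proof (intro equalityI subsetI)
    have "?S \<subseteq> ?I" by (intro image_subsetI single_in_mono_ideal generator_in_upset G)
    then show "p \<in> ?I" if "p \<in> Idl\<^bsub>?R\<^esub> ?S" for p
      using genideal_minimal[OF mono_ideal_ideal[OF up_closed_upset]] that by blast
  next
    fix p assume p: "p \<in> ?I"
    have "single m (lookup p m) \<in> Idl\<^bsub>?R\<^esub> ?S" if m: "m \<in> keys p" for m
    proof -
      have "m \<in> upset V G" using p m by (auto simp: mono_ideal_def)
      then obtain g where g: "g \<in> G" "m = (m - g) + g" "keys (m - g) \<subseteq> V" by (rule upset_decompose)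
      have "single m (lookup p m) = single (m - g) (lookup p m) * single g 1"
        using g(2) by (simp add: mult_single)
      also have "\<dots> \<in> Idl\<^bsub>?R\<^esub> ?S"
        using g genideal_self[OF S] by (intro polys_idealD(4)[OF I]) auto
      finally show ?thesis .
    qed
    then have "(\<Sum>m\<in>keys p. single m (lookup p m)) \<in> Idl\<^bsub>?R\<^esub> ?S" by (intro polys_ideal_sum[OF I])
    then show "p \<in> Idl\<^bsub>?R\<^esub> ?S" by (simp add: sum_monomials)
  qed
qed

lemma ideal_prod_monomials:
  assumes G: "\<And>g. g \<in> G \<Longrightarrow> keys g \<subseteq> V" and H: "\<And>h. h \<in> H \<Longrightarrow> keys h \<subseteq> V"
  shows "ideal_prod (poly_ring V) (mono_ideal (upset V G)) (mono_ideal (upset V H))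
    = (mono_ideal (upset V {g + h |g h. g \<in> G \<and> h \<in> H}) :: ('v, 'k::field) mpoly set)"
    (is "ideal_prod ?R ?I ?J = ?K")
proof -
  interpret cring "poly_ring V :: ('v, 'k) mpoly ring" by (rule cring_poly_ring)
  note IJ = mono_ideal_ideal[OF up_closed_upset[of V G], where 'k = 'k] mono_ideal_ideal[OF up_closed_upset[of V H], where 'k = 'k]
  note P = ideal_prod_is_ideal[OF IJ]
  show ?thesis
  proof (intro equalityI subsetI)
    fix p assume "p \<in> ideal_prod ?R ?I ?J"
    then show "p \<in> ?K"
    proof induction
      case (prod i j)
      then show ?case using upset_add_upset unfolding mono_ideal_def
        by (auto intro!: keys_mult_subset) blast
    next
      case (sum s t)
      then show ?case using polys_idealD(3)[OF mono_ideal_ideal[OF up_closed_upset]] by simp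
    qed
  next
    fix p assume p: "p \<in> ?K"
    have "single m (lookup p m) \<in> ideal_prod ?R ?I ?J" if m: "m \<in> keys p" for m
    proof -
      have "m \<in> upset V {g + h |g h. g \<in> G \<and> h \<in> H}" using p m by (auto simp: mono_ideal_def)
      then obtain f where "f \<in> {g + h |g h. g \<in> G \<and> h \<in> H}" "m = (m - f) + f" "keys (m - f) \<subseteq> V"
        by (rule upset_decompose)
      then obtain g h where g: "g \<in> G" "h \<in> H" "m = (m - (g + h)) + (g + h)" "keys (m - (g + h)) \<subseteq> V" by blast
      have "single m (lookup p m) = single (m - (g + h)) (lookup p m) * (single g 1 * single h 1)"
        using g(3) by (simp add: mult_single)
      also have "\<dots> \<in> ideal_prod ?R ?I ?J"
      proof (rule polys_idealD(4)[OF P])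
        have "single g 1 \<in> ?I" "single h 1 \<in> ?J" by (intro single_in_mono_ideal generator_in_upset g G H)+
        then show "single g 1 * single h 1 \<in> ideal_prod ?R ?I ?J"
          using ideal_prod.prod[of "single g 1" ?I "single h 1" ?J ?R] by simp
      qed (use g in simp)
      finally show ?thesis .
    qed
    then have "(\<Sum>m\<in>keys p. single m (lookup p m)) \<in> ideal_prod ?R ?I ?J" by (intro polys_ideal_sum[OF P])
    then show "p \<in> ideal_prod ?R ?I ?J" by (simp add: sum_monomials)
  qed
qed

lemma ideal_power_2_monomials:
  assumes G: "\<And>g. g \<in> G \<Longrightarrow> keys g \<subseteq> V"
  shows "ideal_power (poly_ring V) (mono_ideal (upset V G)) 2
    = (mono_ideal (upset V {g + h |g h. g \<in> G \<and> h \<in> G}) :: ('v, 'k::field) mpoly set)"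
proof -
  \<comment> \<open>The second power unfolds to the unit ideal times I times I, and the unit ideal
    is generated by the monomial with exponent 0.\<close>
  have "polys V = (mono_ideal (upset V {0}) :: ('v, 'k) mpoly set)"
    by (simp add: set_eq_iff polys_iff mono_ideal_def upset_def subset_iff[of "keys _" "Collect _"] Ball_def)
  moreover have "{g + h |g h. g \<in> {0} \<and> h \<in> G} = G" by auto
  ultimately have "ideal_prod (poly_ring V) (polys V) (mono_ideal (upset V G))
      = (mono_ideal (upset V G) :: ('v, 'k) mpoly set)"
    using ideal_prod_monomials[of "{0}" V G, where 'k = 'k] G by simp
  then show ?thesis
    unfolding ideal_power_def using ideal_prod_monomials[of G V G, where 'k = 'k] G
    by (simp add: numeral_2_eq_2 ideals_set_def)
qed

text \<open>This replaces a monomial order on the variables, which the type of variables does not provide.\<close>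

lemma unique_sum:
  fixes M N :: "('v \<Rightarrow>\<^sub>0 nat) set"
  assumes "finite W" "finite M" "finite N" "M \<noteq> {}" "N \<noteq> {}"
    and "\<And>a a' v. a \<in> M \<Longrightarrow> a' \<in> M \<Longrightarrow> v \<notin> W \<Longrightarrow> lookup a v = lookup a' v"
    and "\<And>b b' v. b \<in> N \<Longrightarrow> b' \<in> N \<Longrightarrow> v \<notin> W \<Longrightarrow> lookup b v = lookup b' v"
  shows "\<exists>m\<in>M. \<exists>n\<in>N. \<forall>a\<in>M. \<forall>b\<in>N. a + b = m + n \<longrightarrow> a = m \<and> b = n"
  using assms
proof (induction W arbitrary: M N rule: finite_induct)
  case empty
  then obtain m n where "m \<in> M" "n \<in> N" by blast
  moreover have "a = m" if "a \<in> M" for a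
    using empty(5)[OF that \<open>m \<in> M\<close>] by (intro poly_mapping_eqI) auto
  moreover have "b = n" if "b \<in> N" for b
    using empty(6)[OF that \<open>n \<in> N\<close>] by (intro poly_mapping_eqI) auto
  ultimately show ?case by blast
next
  case (insert w W)
  \<comment> \<open>Both sets are cut down to their elements of highest exponent in w. A sum that
    agrees with m + n in w forces both summands to be highest, so uniqueness may be sought among
    these, where w no longer distinguishes anything.\<close>
  define mx where "mx = (\<lambda>X::('v \<Rightarrow>\<^sub>0 nat) set. Max ((\<lambda>a. lookup a w) ` X))"
  define top where "top = (\<lambda>X::('v \<Rightarrow>\<^sub>0 nat) set. {a \<in> X. lookup a w = mx X})"
  have mx: "lookup a w \<le> mx X" if "finite X" "a \<in> X" for a X using that by (simp add: mx_def)
  have top_ne: "top X \<noteq> {}" if "finite X" "X \<noteq> {}" for X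
  proof -
    have "mx X \<in> (\<lambda>a. lookup a w) ` X" unfolding mx_def using that by (intro Max_in) auto
    then show ?thesis by (auto simp: top_def)
  qed
  have agree: "lookup a v = lookup a' v" if "a \<in> top X" "a' \<in> top X" "v \<notin> W"
    "\<And>a a' v. a \<in> X \<Longrightarrow> a' \<in> X \<Longrightarrow> v \<notin> insert w W \<Longrightarrow> lookup a v = lookup a' v" for X a a' v
    using that by (cases "v = w") (auto simp: top_def)
  have "\<exists>m\<in>top M. \<exists>n\<in>top N. \<forall>a\<in>top M. \<forall>b\<in>top N. a + b = m + n \<longrightarrow> a = m \<and> b = n"
  proof (rule insert.IH)
    show "finite (top M)" "finite (top N)" using insert.prems by (auto simp: top_def)
    show "top M \<noteq> {}" "top N \<noteq> {}" using top_ne insert.prems by auto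
    show "lookup a v = lookup a' v" if "a \<in> top M" "a' \<in> top M" "v \<notin> W" for a a' v
      using that by (rule agree) (rule insert.prems(5))
    show "lookup a v = lookup a' v" if "a \<in> top N" "a' \<in> top N" "v \<notin> W" for a a' v
      using that by (rule agree) (rule insert.prems(6))
  qed
  then obtain m n where mn: "m \<in> top M" "n \<in> top N"
    "\<And>a b. a \<in> top M \<Longrightarrow> b \<in> top N \<Longrightarrow> a + b = m + n \<Longrightarrow> a = m \<and> b = n" by blast
  have "a = m \<and> b = n" if "a \<in> M" "b \<in> N" "a + b = m + n" for a b
  proof -
    have "lookup a w + lookup b w = mx M + mx N"
      using arg_cong[OF that(3), of "\<lambda>x. lookup x w"] mn(1,2) by (simp add: lookup_add top_def)
    then have "lookup a w = mx M" "lookup b w = mx N"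
      using mx[OF insert.prems(1) that(1)] mx[OF insert.prems(2) that(2)] by auto
    then show ?thesis using mn(3) that by (auto simp: top_def)
  qed
  then show ?case using mn(1,2) by (auto simp: top_def)
qed

text \<open>Splitting the term m off p leaves a product in which m + n cannot occur, so the
  coefficient at m + n is a product of two nonzero field elements.\<close>

lemma unique_sum_in_keys:
  fixes p q :: "('v, 'k::field) mpoly"
  assumes m: "m \<in> keys p" and n: "n \<in> keys q"
    and unique: "\<And>a b. a \<in> keys p \<Longrightarrow> b \<in> keys q \<Longrightarrow> a + b = m + n \<Longrightarrow> a = m"
  shows "m + n \<in> keys (p * q)"
proof -
  define p' where "p' = p - single m (lookup p m)"
  have "lookup p' a = (if a = m then 0 else lookup p a)" for a
    by (auto simp: p'_def lookup_minus lookup_single when_def)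
  then have keys: "a \<in> keys p' \<Longrightarrow> a \<in> keys p \<and> a \<noteq> m" for a
    by (auto simp: in_keys_iff split: if_splits)
  have "lookup (p' * q) (m + n) = 0"
  proof (rule ccontr)
    assume "lookup (p' * q) (m + n) \<noteq> 0"
    then obtain a b where "a \<in> keys p'" "b \<in> keys q" "m + n = a + b"
      using keys_mult[of p' q] by (auto simp: in_keys_iff)
    then show False using unique[of a b] keys[of a] by simp
  qed
  moreover have "lookup (single m (lookup p m) * q) (m + n) = lookup p m * lookup q n"
    by (auto simp: lookup_monom_mult)
  moreover have "p * q = single m (lookup p m) * q + p' * q" by (simp add: p'_def algebra_simps)
  ultimately have "lookup (p * q) (m + n) = lookup p m * lookup q n" by (simp add: lookup_add)
  then show ?thesis using m n by (simp add: in_keys_iff)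
qed

section \<open>The square and the symbolic square of the edge ideal\<close>

lemma in_mono_ideal_times_monomial:
  fixes p :: "('v, 'k::field) mpoly"
  shows "p * single F 1 \<in> mono_ideal U \<longleftrightarrow> (\<forall>n\<in>keys p. n + F \<in> U)"
proof
  assume p: "p * single F 1 \<in> mono_ideal U"
  show "\<forall>n\<in>keys p. n + F \<in> U"
  proof
    fix n assume "n \<in> keys p"
    moreover have "lookup (single F 1 * p) (F + n) = lookup p n" by (auto simp: lookup_monom_mult)
    ultimately have "n + F \<in> keys (p * single F 1)" by (simp add: in_keys_iff mult.commute add.commute)
    then show "n + F \<in> U" using p unfolding mono_ideal_def by blast
  qed
next
  assume "\<forall>n\<in>keys p. n + F \<in> U"
  then show "p * single F 1 \<in> mono_ideal U"
    unfolding mono_ideal_def mem_Collect_eq by (intro keys_mult_subset) (simp split: if_splits)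
qed

lemma poly_ring_minus:
  fixes a b :: "('v, 'k::field) mpoly"
  assumes "b \<in> polys V" shows "a \<ominus>\<^bsub>poly_ring V\<^esub> b = a - b"
proof -
  interpret cring "poly_ring V :: ('v, 'k) mpoly ring" by (rule cring_poly_ring)
  have "\<ominus>\<^bsub>poly_ring V\<^esub> b = - b"
    using minus_equality[of "- b" b] assms by simp
  then show ?thesis by (simp add: a_minus_def)
qed

locale sink_weighted_graph =
  fixes D :: "'v wograph"
  assumes wog: "weighted_oriented_graph D" and sinks: "\<forall>v \<in> Vplus D. is_sink D v"
begin

abbreviation V :: "'v set" where "V \<equiv> verts D"
abbreviation w :: "'v \<Rightarrow> nat" where "w \<equiv> weight D"

definition adj :: "'v \<Rightarrow> 'v \<Rightarrow> bool" where
  "adj u v \<longleftrightarrow> (u, v) \<in> arcs D \<or> (v, u) \<in> arcs D"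

definition wmon :: "'v set \<Rightarrow> ('v \<Rightarrow>\<^sub>0 nat)" where
  "wmon S = (\<Sum>x\<in>S. single x (w x))"

lemma finite_V: "finite V"
  using wog by (simp add: weighted_oriented_graph_def)

sublocale finite_vars V
  by standard (rule finite_V)

lemma adj_sym: "adj u v \<Longrightarrow> adj v u"
  by (auto simp: adj_def)

lemma adj_irrefl: "\<not> adj u u"
  using wog by (auto simp: adj_def weighted_oriented_graph_def)

lemma adj_V: "adj u v \<Longrightarrow> u \<in> V" "adj u v \<Longrightarrow> v \<in> V"
  using wog by (auto simp: adj_def weighted_oriented_graph_def)

lemma w_pos: "v \<in> V \<Longrightarrow> 0 < w v"
  using wog by (auto simp: weighted_oriented_graph_def Suc_le_eq)

text \<open>The sink hypothesis enters here: the tail of an arc is no sink and thus has weight 1,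
  which makes the monomial of an arc symmetric in its two ends.\<close>

lemma arc_weight: "(u, v) \<in> arcs D \<Longrightarrow> w u = 1"
proof -
  assume uv: "(u, v) \<in> arcs D"
  then have "u \<in> V" using adj_V(1) unfolding adj_def by blast
  moreover have "u \<notin> Vplus D" using sinks uv by (auto simp: is_sink_def)
  ultimately show "w u = 1" using w_pos[of u] by (simp add: Vplus_def)
qed

lemma lookup_wmon: "finite S \<Longrightarrow> lookup (wmon S) v = (if v \<in> S then w v else 0)"
  by (simp add: wmon_def lookup_sum lookup_single when_def)

lemma keys_wmon: "finite S \<Longrightarrow> keys (wmon S) \<subseteq> S"
  by (auto simp: in_keys_iff lookup_wmon split: if_splits)

lemma edge_monomial_wmon:
  assumes "(u, v) \<in> arcs D" shows "edge_monomial D (u, v) = single (wmon {u, v}) 1"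
proof -
  have "u \<noteq> v" using assms adj_irrefl unfolding adj_def by blast
  then have "wmon {u, v} = single u 1 + single v (w v)" using arc_weight[OF assms] by (simp add: wmon_def)
  then show ?thesis by (simp add: edge_monomial_def)
qed

section \<open>Exponents of the edge ideal and of its square\<close>

definition edge_mons :: "'v set \<Rightarrow> ('v \<Rightarrow>\<^sub>0 nat) set" where
  "edge_mons X = {wmon {u, v} |u v. adj u v \<and> u \<in> X \<and> v \<in> X}"

lemma edge_mons_keys: "g \<in> edge_mons X \<Longrightarrow> keys g \<subseteq> X"
proof -
  assume "g \<in> edge_mons X"
  then obtain u v where "g = wmon {u, v}" "u \<in> X" "v \<in> X" by (auto simp: edge_mons_def)
  then show ?thesis using keys_wmon[of "{u, v}"] by blast
qed

text \<open>Proved for all subgraphs inside the locale of D: \<open>delete_verts D N\<close> can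
  have sources of weight at least 2, so it need not satisfy the assumptions of the locale
  itself.\<close>

lemma edge_ideal_delete_verts:
  "edge_ideal (delete_verts D N) = (mono_ideal (upset (V - N) (edge_mons (V - N))) :: ('v, 'k::field) mpoly set)"
proof -
  let ?A = "arcs D \<inter> ((V - N) \<times> (V - N))"
  have "edge_monomial (delete_verts D N) ` ?A = (\<lambda>g. single g (1::'k)) ` edge_mons (V - N)"
  proof (intro equalityI subsetI)
    fix p :: "('v, 'k) mpoly" assume "p \<in> edge_monomial (delete_verts D N) ` ?A"
    then obtain u v where uv: "(u, v) \<in> ?A" "p = edge_monomial (delete_verts D N) (u, v)" by auto
    then have "p = (single (wmon {u, v}) 1 :: ('v, 'k) mpoly)"
      using edge_monomial_wmon[of u v, where 'a = 'k] by (simp add: edge_monomial_def delete_verts_def)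
    then show "p \<in> (\<lambda>g. single g (1::'k)) ` edge_mons (V - N)"
      using uv(1) by (auto simp: edge_mons_def adj_def)
  next
    fix p :: "('v, 'k) mpoly" assume "p \<in> (\<lambda>g. single g (1::'k)) ` edge_mons (V - N)"
    then obtain u v where uv: "adj u v" "u \<in> V - N" "v \<in> V - N" "p = single (wmon {u, v}) 1"
      by (auto simp: edge_mons_def)
    have "\<exists>a b. (a, b) \<in> ?A \<and> {u, v} = {a, b}" using uv(1,2,3) by (auto simp: adj_def)
    then obtain a b where ab: "(a, b) \<in> ?A" "{u, v} = {a, b}" by blast
    then have "p = edge_monomial (delete_verts D N) (a, b)"
      using edge_monomial_wmon[of a b, where 'a = 'k] uv(4) by (simp add: edge_monomial_def delete_verts_def)
    then show "p \<in> edge_monomial (delete_verts D N) ` ?A" using ab(1) by blast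
  qed
  then show ?thesis
    using genideal_monomials[of "edge_mons (V - N)" "V - N", OF edge_mons_keys, where 'k = 'k]
    by (simp add: edge_ideal_def delete_verts_def)
qed

lemma edge_ideal_eq: "edge_ideal D = (mono_ideal (upset V (edge_mons V)) :: ('v, 'k::field) mpoly set)"
proof -
  have "arcs D \<inter> (V \<times> V) = arcs D" using wog by (auto simp: weighted_oriented_graph_def)
  then have "delete_verts D {} = \<lparr>verts = V, arcs = arcs D, weight = w\<rparr>" by (simp add: delete_verts_def)
  then have "edge_ideal (delete_verts D {}) = (edge_ideal D :: ('v, 'k) mpoly set)"
    by (simp add: edge_ideal_def edge_monomial_def)
  then show ?thesis using edge_ideal_delete_verts[of "{}", where 'k = 'k] by simp
qed

definition square_mons :: "('v \<Rightarrow>\<^sub>0 nat) set" where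
  "square_mons = {g + h |g h. g \<in> edge_mons V \<and> h \<in> edge_mons V}"

lemma edge_ideal_square:
  "ideal_power (poly_ring V) (edge_ideal D) 2 = (mono_ideal (upset V square_mons) :: ('v, 'k::field) mpoly set)"
  unfolding edge_ideal_eq square_mons_def by (rule ideal_power_2_monomials) (rule edge_mons_keys)

lemma edge_upset_iff:
  assumes "keys m \<subseteq> X" "X \<subseteq> V"
  shows "m \<in> upset X (edge_mons X) \<longleftrightarrow>
    (\<exists>u\<in>X. \<exists>v\<in>X. adj u v \<and> w u \<le> lookup m u \<and> w v \<le> lookup m v)"
proof
  assume "m \<in> upset X (edge_mons X)"
  then obtain u v where uv: "adj u v" "u \<in> X" "v \<in> X" "\<And>z. lookup (wmon {u, v}) z \<le> lookup m z"
    by (auto simp: upset_def edge_mons_def)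
  then show "\<exists>u\<in>X. \<exists>v\<in>X. adj u v \<and> w u \<le> lookup m u \<and> w v \<le> lookup m v"
    using uv(4)[of u] uv(4)[of v] by (auto simp: lookup_wmon)
next
  assume "\<exists>u\<in>X. \<exists>v\<in>X. adj u v \<and> w u \<le> lookup m u \<and> w v \<le> lookup m v"
  then obtain u v where uv: "adj u v" "u \<in> X" "v \<in> X" "w u \<le> lookup m u" "w v \<le> lookup m v" by blast
  have "lookup (wmon {u, v}) z \<le> lookup m z" for z using uv(4,5) by (simp add: lookup_wmon)
  then show "m \<in> upset X (edge_mons X)" using uv(1-3) assms by (auto simp: upset_def edge_mons_def)
qed

lemma square_upsetI:
  assumes "keys m \<subseteq> V" "adj u v" "adj x y"
    and "\<And>z. (if z \<in> {u, v} then w z else 0) + (if z \<in> {x, y} then w z else 0) \<le> lookup m z"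
  shows "m \<in> upset V square_mons"
proof -
  have "wmon {u, v} + wmon {x, y} \<in> square_mons"
    using assms(2,3) adj_V unfolding square_mons_def edge_mons_def by blast
  moreover have "lookup (wmon {u, v} + wmon {x, y}) z \<le> lookup m z" for z
    using assms(4)[of z] by (simp add: lookup_add lookup_wmon)
  ultimately show ?thesis using assms(1) unfolding upset_def by blast
qed

lemma square_upsetD:
  assumes "m \<in> upset V square_mons"
  shows "\<exists>u v x y. adj u v \<and> adj x y \<and>
    (\<forall>z. (if z \<in> {u, v} then w z else 0) + (if z \<in> {x, y} then w z else 0) \<le> lookup m z)"
proof -
  obtain u v x y where *: "adj u v" "adj x y"
    "\<And>z. lookup (wmon {u, v} + wmon {x, y}) z \<le> lookup m z"
    using assms unfolding upset_def square_mons_def edge_mons_def by blast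
  then show ?thesis
    by (intro exI[of _ u] exI[of _ v] exI[of _ x] exI[of _ y]) (simp add: lookup_add lookup_wmon)
qed

section \<open>Triangles and the generators of the symbolic square\<close>

lemma triangles_iff:
  "S \<in> triangles D \<longleftrightarrow> (\<exists>a b c. S = {a, b, c} \<and> adj a b \<and> adj b c \<and> adj a c)"
proof -
  have edges: "{u, v} \<in> und_edges D \<longleftrightarrow> adj u v" for u v
    by (auto simp: und_edges_def adj_def doubleton_eq_iff)
  show ?thesis
  proof
    assume S: "S \<in> triangles D"
    then obtain a b c where abc: "S = {a, b, c}" "a \<noteq> b" "b \<noteq> c" "a \<noteq> c"
      by (auto simp: triangles_def card_3_iff)
    then have "adj a b" "adj b c" "adj a c" using S by (simp_all add: triangles_def edges)
    then show "\<exists>a b c. S = {a, b, c} \<and> adj a b \<and> adj b c \<and> adj a c" using abc(1) by blast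
  next
    assume "\<exists>a b c. S = {a, b, c} \<and> adj a b \<and> adj b c \<and> adj a c"
    then obtain a b c where abc: "S = {a, b, c}" "adj a b" "adj b c" "adj a c" by blast
    then have "a \<noteq> b" "b \<noteq> c" "a \<noteq> c" using adj_irrefl by auto
    then show "S \<in> triangles D"
      using abc adj_V adj_sym by (auto simp: triangles_def edges)
  qed
qed

lemma triangle_finite: "S \<in> triangles D \<Longrightarrow> finite S" "S \<in> triangles D \<Longrightarrow> S \<subseteq> V"
  using adj_V by (auto simp: triangles_iff)

lemma finite_triangles: "finite (triangles D)"
  by (rule finite_subset[of _ "Pow V"]) (use triangle_finite finite_V in auto)

lemma closed_nbhd_iff: "y \<in> closed_nbhd D S \<longleftrightarrow> y \<in> S \<or> (\<exists>x\<in>S. adj x y)"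
  by (auto simp: closed_nbhd_def adj_def)

text \<open>\<open>a\<^sup>2bc = (ab)(ac)\<close>, and \<open>abcx = (ax)(bc)\<close> if \<open>x\<close> is a neighbour of \<open>a\<close>.\<close>

lemma triangle_times_neighbour:
  assumes S: "S \<in> triangles D" and x: "x \<in> closed_nbhd D S" and m: "keys m \<subseteq> V"
    and le: "\<And>z. lookup (wmon S) z + lookup (wmon {x}) z \<le> lookup m z"
  shows "m \<in> upset V square_mons"
proof -
  have le': "(if z \<in> S then w z else 0) + (if z = x then w z else 0) \<le> lookup m z" for z
    using le[of z] triangle_finite[OF S] by (simp add: lookup_wmon)
  \<comment> \<open>By symmetry of the triangle, the vertex equal or adjacent to x may be called
    a.\<close>
  have "\<exists>a b c. S = {a, b, c} \<and> adj a b \<and> adj b c \<and> adj a c \<and> (x = a \<or> x \<notin> S \<and> adj a x)"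
  proof -
    obtain y where y: "y \<in> S" "x = y \<or> x \<notin> S \<and> adj y x" using x by (auto simp: closed_nbhd_iff)
    obtain a b c where abc: "S = {a, b, c}" "adj a b" "adj b c" "adj a c" using S by (auto simp: triangles_iff)
    have "\<exists>b' c'. S = {y, b', c'} \<and> adj y b' \<and> adj b' c' \<and> adj y c'"
    proof -
      consider "y = a" | "y = b" | "y = c" using y(1) abc(1) by auto
      then show ?thesis
      proof cases
        case 1
        then show ?thesis using abc by (intro exI[of _ b] exI[of _ c]) simp
      next
        case 2
        then show ?thesis using abc adj_sym by (intro exI[of _ a] exI[of _ c]) auto
      next
        case 3
        then show ?thesis using abc adj_sym by (intro exI[of _ a] exI[of _ b]) auto
      qed
    qed
    then show ?thesis using y(2) by blast
  qed
  then obtain a b c where abc: "S = {a, b, c}" "adj a b" "adj b c" "adj a c" "x = a \<or> x \<notin> S \<and> adj a x" by blast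
  then have ne: "a \<noteq> b" "b \<noteq> c" "a \<noteq> c" using adj_irrefl by auto
  show ?thesis
  proof (cases "x = a")
    case True
    show ?thesis
    proof (rule square_upsetI[OF m abc(2) abc(4)])
      fix z show "(if z \<in> {a, b} then w z else 0) + (if z \<in> {a, c} then w z else 0) \<le> lookup m z"
        using le'[of z] True abc(1) ne by auto
    qed
  next
    case False
    then have x: "x \<notin> S" "adj a x" using abc(5) by auto
    show ?thesis
    proof (rule square_upsetI[OF m x(2) abc(3)])
      fix z show "(if z \<in> {a, x} then w z else 0) + (if z \<in> {b, c} then w z else 0) \<le> lookup m z"
        using le'[of z] x(1) abc(1) ne by auto
    qed
  qed
qed

definition sym_mons :: "('v \<Rightarrow>\<^sub>0 nat) set" where
  "sym_mons = square_mons \<union> wmon ` triangles D"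

lemma sym_mons_keys: "g \<in> sym_mons \<Longrightarrow> keys g \<subseteq> V"
proof -
  have "keys (g + h) \<subseteq> V" if "g \<in> edge_mons V" "h \<in> edge_mons V" for g h
    using keys_add[of g h] edge_mons_keys that by blast
  moreover have "keys (wmon S) \<subseteq> V" if "S \<in> triangles D" for S
    using keys_wmon triangle_finite[OF that] by blast
  ultimately show "g \<in> sym_mons \<Longrightarrow> keys g \<subseteq> V" unfolding sym_mons_def square_mons_def by blast
qed

lemma sym_upset_iff:
  "m \<in> upset V sym_mons \<longleftrightarrow> m \<in> upset V square_mons \<or>
    (keys m \<subseteq> V \<and> (\<exists>S\<in>triangles D. \<forall>z. lookup (wmon S) z \<le> lookup m z))"
  unfolding sym_mons_def upset_def by blast

lemma finite_mons: "finite (edge_mons X)" "finite square_mons" "finite sym_mons"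
proof -
  show E: "finite (edge_mons X)" for X
  proof (rule finite_subset)
    show "edge_mons X \<subseteq> (\<lambda>(u, v). wmon {u, v}) ` (V \<times> V)" using adj_V by (auto simp: edge_mons_def)
  qed (use finite_V in simp)
  have "square_mons = (\<lambda>(g, h). g + h) ` (edge_mons V \<times> edge_mons V)" by (auto simp: square_mons_def)
  then show "finite square_mons" using E by simp
  then show "finite sym_mons" using finite_triangles by (simp add: sym_mons_def)
qed

text \<open>If \<open>P\<close> is the annihilator of \<open>f\<close> modulo \<open>I\<close> and \<open>m \<notin> I\<close> is a monomial of \<open>f\<close>, then
  \<open>x\<^sub>v m \<in> I\<close> for every \<open>x\<^sub>v \<in> P\<close>, so the exponent of \<open>x\<^sub>v\<close> in \<open>m\<close> is \<open>w v - 1\<close>.  The edge that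
  divides \<open>x\<^sub>a m\<close> therefore joins \<open>a\<close> to a variable outside \<open>P\<close>.\<close>

lemma Ass_neighbour:
  fixes P :: "('v, 'k::field) mpoly set"
  assumes P: "P \<in> Ass_quot (poly_ring V) (edge_ideal D)" and a: "a \<in> V" "var a \<in> P"
  shows "\<exists>u. adj a u \<and> var u \<notin> P"
proof (rule ccontr)
  assume neg: "\<nexists>u. adj a u \<and> var u \<notin> P"
  let ?I = "edge_ideal D :: ('v, 'k) mpoly set"
  obtain f where f: "f \<in> polys V" "P = {r \<in> polys V. r * f \<in> ?I}" and prime: "primeideal P (poly_ring V)"
    using P by (auto simp: Ass_quot_def)
  interpret P: primeideal P "poly_ring V" by (rule prime)
  have "1 \<notin> P" using P.I_notcarr P.one_imp_carrier by auto
  moreover have "1 \<in> P" if "f \<in> ?I" unfolding f(2) using that by simp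
  ultimately have "f \<notin> ?I" by blast
  then obtain m where m: "m \<in> keys f" "m \<notin> upset V (edge_mons V)"
    unfolding edge_ideal_eq mono_ideal_def by blast
  have mV: "keys m \<subseteq> V" using f(1) m(1) unfolding polys_iff by blast
  have step: "\<exists>y. adj v y \<and> lookup m v + 1 = w v \<and> w y \<le> lookup m y" if v: "v \<in> V" "var v \<in> P" for v
  proof -
    have "f * single (single v 1) 1 \<in> ?I" using v(2) unfolding f(2) by (simp add: var_def mult.commute)
    then have "m + single v 1 \<in> upset V (edge_mons V)"
      unfolding edge_ideal_eq in_mono_ideal_times_monomial using m(1) by blast
    moreover have "keys (m + single v 1) \<subseteq> V" using keys_add[of m "single v 1"] mV v(1) by auto
    ultimately obtain x y where xy: "adj x y" "w x \<le> lookup (m + single v 1) x" "w y \<le> lookup (m + single v 1) y"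
      using edge_upset_iff[of "m + single v 1" V] by blast
    have no: "\<not> (w x \<le> lookup m x \<and> w y \<le> lookup m y)" if "adj x y" for x y
      using m(2) edge_upset_iff[OF mV] adj_V that by blast
    have xy_ne: "x \<noteq> y" using xy(1) adj_irrefl by auto
    have l: "lookup (m + single v 1) z = lookup m z + (if z = v then 1 else 0)" for z
      by (simp add: lookup_add lookup_single when_def)
    show ?thesis
    proof (cases "x = v")
      case True
      then show ?thesis using xy xy_ne no[OF xy(1)] unfolding l by (intro exI[of _ y]) auto
    next
      case False
      then show ?thesis using xy xy_ne no[OF xy(1)] adj_sym[OF xy(1)] unfolding l
        by (intro exI[of _ x]) (auto split: if_splits)
    qed
  qed
  from step[OF a] obtain y where y: "adj a y" "w y \<le> lookup m y" by blast
  then have "var y \<in> P" using neg by blast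
  from step[OF adj_V(2)[OF y(1)] this] show False using y(2) by auto
qed

lemma prime_monomial_notin:
  fixes P :: "('v, 'k::field) mpoly set"
  assumes prime: "primeideal P (poly_ring V)" and Q: "Q \<subseteq> V" "\<And>v. v \<in> Q \<Longrightarrow> var v \<notin> P"
  shows "single (wmon Q) 1 \<notin> P"
proof -
  interpret P: primeideal P "poly_ring V" by (rule prime)
  have one: "1 \<notin> P" using P.I_notcarr P.one_imp_carrier by auto
  have power: "single (single v n) 1 \<notin> P" if v: "v \<in> Q" for v n
  proof (induction n)
    case (Suc n)
    have "var v * single (single v n) 1 = (single (single v (Suc n)) 1 :: ('v, 'k) mpoly)"
      by (simp add: var_def mult_single flip: single_add)
    moreover have "var v \<in> polys V" "single (single v n) 1 \<in> polys V" using v Q(1) by auto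
    ultimately show ?case using P.I_prime[of "var v" "single (single v n) 1"] Q(2)[OF v] Suc by auto
  qed (use one in simp)
  have "finite Q" using Q(1) finite_V finite_subset by blast
  then show ?thesis using Q(1) power
  proof (induction Q rule: finite_induct)
    case empty
    then show ?case using one by (simp add: wmon_def)
  next
    case (insert v Q)
    have "single (wmon (insert v Q)) 1 = single (single v (w v)) 1 * (single (wmon Q) 1 :: ('v, 'k) mpoly)"
      using insert.hyps by (simp add: wmon_def mult_single)
    moreover have "single (single v (w v)) 1 \<in> polys V" "single (wmon Q) 1 \<in> polys V"
      using insert.prems(1) keys_wmon[OF insert.hyps(1)] by (auto intro!: single_in_polys)
    ultimately show ?case using P.I_prime[of "single (single v (w v)) 1" "single (wmon Q) 1"] insert by auto
  qed
qed

text \<open>Let P be any associated prime. The product of the powers of all variables outside P is a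
  unit in R_P, and by \<open>Ass_neighbour\<close> some vertex of N[S] is among these variables for
  every triangle S. So this one monomial multiplies every term of p into I^2.\<close>

lemma sym_mons_in_symbolic_power:
  fixes p :: "('v, 'k::field) mpoly"
  assumes p: "p \<in> mono_ideal (upset V sym_mons)"
  shows "p \<in> symbolic_power (poly_ring V) (edge_ideal D) 2"
  unfolding symbolic_power_def
proof (rule INT_I)
  let ?R = "poly_ring V :: ('v, 'k) mpoly ring" and ?I = "edge_ideal D :: ('v, 'k) mpoly set"
  fix P assume P: "P \<in> Ass_quot ?R ?I"
  then have prime: "primeideal P ?R" by (simp add: Ass_quot_def)
  interpret P: primeideal P ?R by (rule prime)
  have one: "1 \<notin> P" using P.I_notcarr P.one_imp_carrier by auto
  define Q where "Q = {v \<in> V. var v \<notin> P}"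
  have finQ: "finite Q" using finite_V by (simp add: Q_def)
  have sP: "single (wmon Q) 1 \<notin> P" by (rule prime_monomial_notin[OF prime]) (auto simp: Q_def)
  have sR: "single (wmon Q) 1 \<in> (polys V :: ('v, 'k) mpoly set)"
    using keys_wmon[OF finQ] by (intro single_in_polys) (auto simp: Q_def)
  have pR: "p \<in> polys V" by (rule polys_idealD(1)[OF mono_ideal_ideal[OF up_closed_upset] p])
  have "n + wmon Q \<in> upset V square_mons" if n: "n \<in> keys p" for n
  proof -
    have "n \<in> upset V sym_mons" using p n unfolding mono_ideal_def by blast
    then consider "n \<in> upset V square_mons"
      | S where "keys n \<subseteq> V" "S \<in> triangles D" "\<And>z. lookup (wmon S) z \<le> lookup n z"
      unfolding sym_upset_iff by blast
    then show ?thesis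
    proof cases
      case 1
      then have "wmon Q + n \<in> upset V square_mons"
        using keys_wmon[OF finQ] by (intro upset_add) (auto simp: Q_def)
      then show ?thesis by (simp add: add.commute)
    next
      case 2
      have "\<exists>x\<in>closed_nbhd D S. x \<in> Q"
      proof -
        obtain a where a: "a \<in> S" using 2(2) by (auto simp: triangles_iff)
        then have aV: "a \<in> V" using triangle_finite(2)[OF 2(2)] by blast
        show ?thesis
        proof (cases "var a \<in> P")
          case True
          then obtain u where "adj a u" "var u \<notin> P" using Ass_neighbour[OF P aV] by blast
          then have "u \<in> closed_nbhd D S" "u \<in> Q" using a adj_V(2)[of a u] by (auto simp: closed_nbhd_iff Q_def)
          then show ?thesis by blast
        qed (use a aV in \<open>auto simp: closed_nbhd_iff Q_def\<close>)
      qed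
      then obtain x where x: "x \<in> closed_nbhd D S" "x \<in> Q" by blast
      have "keys (n + wmon Q) \<subseteq> V"
        using keys_add[of n "wmon Q"] keys_wmon[OF finQ] 2(1) by (auto simp: Q_def)
      then show ?thesis
      proof (rule triangle_times_neighbour[OF 2(2) x(1)])
        fix z show "lookup (wmon S) z + lookup (wmon {x}) z \<le> lookup (n + wmon Q) z"
          using 2(3)[of z] x(2) finQ by (auto simp: lookup_add lookup_wmon)
      qed
    qed
  qed
  then have a: "single (wmon Q) 1 * p \<in> ideal_power ?R ?I 2"
    unfolding edge_ideal_square using in_mono_ideal_times_monomial[of p "wmon Q"] by (simp add: mult.commute)
  have "single (wmon Q) 1 * p \<in> polys V" using sR pR by simp
  then have "1 * ((single (wmon Q) 1 * p) \<ominus>\<^bsub>?R\<^esub> (single (wmon Q) 1 * p)) = 0"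
    by (simp add: poly_ring_minus)
  then show "p \<in> loc_contraction ?R P (ideal_power ?R ?I 2)"
    unfolding loc_contraction_def mem_Collect_eq poly_ring_simps
    using a sP sR pR one polys_closed(2) by blast
qed

section \<open>Vertex covers and the upper bound for the symbolic square\<close>

definition vertex_cover :: "'v set \<Rightarrow> bool" where
  "vertex_cover C \<longleftrightarrow> C \<subseteq> V \<and> (\<forall>u v. adj u v \<longrightarrow> u \<in> C \<or> v \<in> C)"

text \<open>The order of a monomial along the prime of C in terms of the powers x_c^(w c): integer
  division counts the whole powers that it contains.\<close>

definition cover_degree :: "'v set \<Rightarrow> ('v \<Rightarrow>\<^sub>0 nat) \<Rightarrow> nat" where
  "cover_degree C m = (\<Sum>c\<in>C. lookup m c div w c)"

lemma minimal_vertex_cover: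
  assumes "vertex_cover C"
  shows "\<exists>C'\<subseteq>C. vertex_cover C' \<and> (\<forall>c\<in>C'. \<exists>u. adj c u \<and> u \<notin> C')"
proof -
  have fin: "finite C" using assms finite_V finite_subset by (auto simp: vertex_cover_def)
  obtain C' where C': "C' \<subseteq> C" "vertex_cover C'" "\<And>B. B \<subseteq> C \<Longrightarrow> vertex_cover B \<Longrightarrow> card C' \<le> card B"
    using ex_has_least_nat[of "\<lambda>B. B \<subseteq> C \<and> vertex_cover B" C card] assms by blast
  have "\<exists>u. adj c u \<and> u \<notin> C'" if c: "c \<in> C'" for c
  proof -
    have "card (C' - {c}) < card C'" using c C'(1) fin by (intro card_Diff1_less) (auto intro: finite_subset)
    then have "\<not> vertex_cover (C' - {c})" using C'(3)[of "C' - {c}"] C'(1) by auto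
    then obtain u v where "adj u v" "u \<notin> C' - {c}" "v \<notin> C' - {c}"
      using C'(2) unfolding vertex_cover_def by blast
    moreover have "u \<noteq> v" using \<open>adj u v\<close> adj_irrefl by auto
    moreover have "u \<in> C' \<or> v \<in> C'" using C'(2) \<open>adj u v\<close> unfolding vertex_cover_def by blast
    ultimately show ?thesis using adj_sym by blast
  qed
  then show ?thesis using C' by blast
qed

definition cover_prime :: "'v set \<Rightarrow> ('v, 'k::field) mpoly set" where
  "cover_prime C = mono_ideal {m. keys m \<subseteq> V \<and> keys m \<inter> C \<noteq> {}}"

lemma keys_le: "(\<And>v. lookup m v \<le> lookup n v) \<Longrightarrow> keys m \<subseteq> keys (n :: 'v \<Rightarrow>\<^sub>0 nat)"
  by (metis in_keys_iff le_zero_eq subsetI)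

lemma in_cover_prime: "p \<in> cover_prime C \<longleftrightarrow> p \<in> polys V \<and> (\<forall>m\<in>keys p. keys m \<inter> C \<noteq> {})"
  unfolding cover_prime_def mono_ideal_def polys_iff by blast

text \<open>If p and q both have terms free of C, two of these form a sum that arises in only one
  way, so a term free of C survives in the product.\<close>

lemma cover_prime_prime:
  assumes C: "C \<subseteq> V" shows "primeideal (cover_prime C :: ('v, 'k::field) mpoly set) (poly_ring V)"
proof (rule primeidealI)
  show "cring (poly_ring V :: ('v, 'k) mpoly ring)" by (rule cring_poly_ring)
  have "up_closed V {m. keys m \<subseteq> V \<and> keys m \<inter> C \<noteq> {}}"
    unfolding up_closed_def using keys_le by blast
  then show "ideal (cover_prime C :: ('v, 'k) mpoly set) (poly_ring V)"
    unfolding cover_prime_def by (rule mono_ideal_ideal)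
  have "(1 :: ('v, 'k) mpoly) \<notin> cover_prime C"
    unfolding in_cover_prime by (simp flip: single_one)
  then show "polys V \<noteq> (cover_prime C :: ('v, 'k) mpoly set)" using polys_closed(2) by blast
  fix p q :: "('v, 'k) mpoly"
  assume p: "p \<in> polys V" and q: "q \<in> polys V" and "p \<otimes>\<^bsub>poly_ring V\<^esub> q \<in> cover_prime C"
  then have pq: "p * q \<in> cover_prime C" by simp
  show "p \<in> cover_prime C \<or> q \<in> cover_prime C"
  proof (rule ccontr)
    assume neg: "\<not> (p \<in> cover_prime C \<or> q \<in> cover_prime C)"
    define M where "M = {m \<in> keys p. keys m \<inter> C = {}}"
    define N where "N = {m \<in> keys q. keys m \<inter> C = {}}"
    have "\<exists>m\<in>M. \<exists>n\<in>N. \<forall>a\<in>M. \<forall>b\<in>N. a + b = m + n \<longrightarrow> a = m \<and> b = n"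
    proof (rule unique_sum[OF finite_V])
      show "finite M" "finite N" by (auto simp: M_def N_def)
      show "M \<noteq> {}" "N \<noteq> {}" using neg p q unfolding in_cover_prime M_def N_def by blast+
      have 0: "lookup a v = 0" if "r \<in> polys V" "a \<in> keys r" "v \<notin> V" for a v and r :: "('v, 'k) mpoly"
      proof -
        have "v \<notin> keys a" using that unfolding polys_iff by blast
        then show ?thesis by (simp add: in_keys_iff)
      qed
      show "lookup a v = lookup a' v" if "a \<in> M" "a' \<in> M" "v \<notin> V" for a a' v
        using 0[OF p] that by (simp add: M_def)
      show "lookup a v = lookup a' v" if "a \<in> N" "a' \<in> N" "v \<notin> V" for a a' v
        using 0[OF q] that by (simp add: N_def)
    qed
    then obtain m n where mn: "m \<in> M" "n \<in> N"
      "\<And>a b. a \<in> M \<Longrightarrow> b \<in> N \<Longrightarrow> a + b = m + n \<Longrightarrow> a = m \<and> b = n" by blast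
    have no_C: "keys (m + n) \<inter> C = {}" using mn(1,2) keys_add[of m n] by (auto simp: M_def N_def)
    have "m + n \<in> keys (p * q)"
    proof (rule unique_sum_in_keys)
      fix a b assume ab: "a \<in> keys p" "b \<in> keys q" "a + b = m + n"
      have "keys a \<subseteq> keys (m + n)" "keys b \<subseteq> keys (m + n)"
        unfolding ab(3)[symmetric] by (intro keys_le; simp add: lookup_add)+
      then have "a \<in> M" "b \<in> N" using ab no_C by (auto simp: M_def N_def)
      then show "a = m" using mn(3) ab(3) by blast
    qed (use mn in \<open>auto simp: M_def N_def\<close>)
    then show False using pq no_C unfolding in_cover_prime by blast
  qed
qed

text \<open>The monomial F has exponent w - 1 on C and w off C. It contains no edge because C is a
  cover. A further variable c in C completes x_c^(w c), and \<open>min\<close> supplies an edge to a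
  vertex off C, whose full power is already there.\<close>

lemma cover_prime_Ass:
  assumes C: "vertex_cover C" and min: "\<And>c. c \<in> C \<Longrightarrow> \<exists>u. adj c u \<and> u \<notin> C"
  shows "cover_prime C \<in> Ass_quot (poly_ring V) (edge_ideal D :: ('v, 'k::field) mpoly set)"
proof -
  have CV: "C \<subseteq> V" using C by (simp add: vertex_cover_def)
  then have finC: "finite C" using finite_V finite_subset by blast
  define F where "F = (\<Sum>v\<in>V. single v (if v \<in> C then w v - 1 else w v))"
  have F: "lookup F v = (if v \<in> C then w v - 1 else if v \<in> V then w v else 0)" for v
  proof -
    have "lookup F v = (\<Sum>x\<in>V. if x = v then (if v \<in> C then w v - 1 else w v) else 0)"
      unfolding F_def lookup_sum by (rule sum.cong) (auto simp: lookup_single when_def)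
    then show ?thesis using finite_V CV by auto
  qed
  have keysF: "keys F \<subseteq> V" using CV by (auto simp: in_keys_iff F split: if_splits)
  have iff: "n + F \<in> upset V (edge_mons V) \<longleftrightarrow> keys n \<inter> C \<noteq> {}" if n: "keys n \<subseteq> V" for n
  proof -
    have "keys (n + F) \<subseteq> V" using keys_add[of n F] n keysF by blast
    note edge = edge_upset_iff[OF this order_refl]
    show ?thesis
    proof
      assume "n + F \<in> upset V (edge_mons V)"
      then obtain u v where uv: "adj u v" "w u \<le> lookup (n + F) u" "w v \<le> lookup (n + F) v"
        unfolding edge by blast
      have "c \<in> keys n" if "c \<in> C" "w c \<le> lookup (n + F) c" for c
        using that w_pos[of c] CV by (auto simp: lookup_add F in_keys_iff)
      then show "keys n \<inter> C \<noteq> {}" using uv C unfolding vertex_cover_def by blast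
    next
      assume "keys n \<inter> C \<noteq> {}"
      then obtain c where c: "c \<in> keys n" "c \<in> C" by blast
      obtain u where u: "adj c u" "u \<notin> C" using min[OF c(2)] by blast
      have "w c \<le> lookup (n + F) c" "w u \<le> lookup (n + F) u"
        using c u adj_V[OF u(1)] by (auto simp: lookup_add F in_keys_iff)
      then show "n + F \<in> upset V (edge_mons V)" unfolding edge using u adj_V[OF u(1)] by blast
    qed
  qed
  have "cover_prime C = {r \<in> polys V. r * single F 1 \<in> (edge_ideal D :: ('v, 'k) mpoly set)}"
  proof -
    have "r * single F 1 \<in> edge_ideal D \<longleftrightarrow> (\<forall>m\<in>keys r. keys m \<inter> C \<noteq> {})" if "r \<in> polys V" for r :: "('v, 'k) mpoly"
      using that iff unfolding edge_ideal_eq in_mono_ideal_times_monomial polys_iff by blast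
    then show ?thesis unfolding set_eq_iff in_cover_prime by blast
  qed
  moreover have "single F 1 \<in> (polys V :: ('v, 'k) mpoly set)" using keysF by (rule single_in_polys)
  ultimately show ?thesis using cover_prime_prime[OF CV, where 'k = 'k]
    unfolding Ass_quot_def by auto
qed

lemma square_cover_degree:
  assumes C: "vertex_cover C" and m: "m \<in> upset V square_mons"
  shows "2 \<le> cover_degree C m"
proof -
  obtain u v x y where uv: "adj u v" "adj x y"
    "\<And>z. (if z \<in> {u, v} then w z else 0) + (if z \<in> {x, y} then w z else 0) \<le> lookup m z"
    using square_upsetD[OF m] by blast
  have CV: "C \<subseteq> V" using C by (simp add: vertex_cover_def)
  then have finC: "finite C" using finite_V finite_subset by blast
  have "of_bool (c \<in> {u, v}) + of_bool (c \<in> {x, y}) \<le> lookup m c div w c" if c: "c \<in> C" for c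
  proof -
    have "0 < w c" using c CV w_pos by blast
    moreover have "(of_bool (c \<in> {u, v}) + of_bool (c \<in> {x, y})) * w c \<le> lookup m c"
      using uv(3)[of c] by (auto split: if_splits)
    ultimately show ?thesis by (simp add: less_eq_div_iff_mult_less_eq)
  qed
  then have "(\<Sum>c\<in>C. of_bool (c \<in> {u, v}) + of_bool (c \<in> {x, y})) \<le> cover_degree C m"
    unfolding cover_degree_def by (rule sum_mono)
  moreover have "1 \<le> (\<Sum>c\<in>C. of_bool (c \<in> {a, b}) :: nat)" if ab: "adj a b" for a b
  proof -
    obtain c where "c \<in> C" "c \<in> {a, b}" using C ab unfolding vertex_cover_def by blast
    then show ?thesis using member_le_sum[of c C "\<lambda>c. of_bool (c \<in> {a, b}) :: nat"] finC by simp
  qed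
  from this[OF uv(1)] this[OF uv(2)]
  have "2 \<le> (\<Sum>c\<in>C. of_bool (c \<in> {u, v}) + of_bool (c \<in> {x, y}) :: nat)" unfolding sum.distrib by linarith
  ultimately show ?thesis by linarith
qed

text \<open>A multiplier outside the prime of C has terms free of C. Such a term and a suitable term
  of p have a sum that arises only once, so a term of small order along C cannot be cancelled in s *
  p, where every term has order at least 2.\<close>

lemma cover_degree_contraction:
  fixes p s :: "('v, 'k::field) mpoly"
  assumes C: "vertex_cover C" and p: "p \<in> polys V" and s: "s \<in> polys V" "s \<notin> cover_prime C"
    and sp: "s * p \<in> mono_ideal (upset V square_mons)" and m: "m \<in> keys p"
  shows "2 \<le> cover_degree C m"
proof (rule ccontr)
  assume neg: "\<not> 2 \<le> cover_degree C m"
  have CV: "C \<subseteq> V" using C by (simp add: vertex_cover_def)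
  then have finC: "finite C" using finite_V finite_subset by blast
  \<comment> \<open>\<open>cover_degree\<close> rounds down and may not separate two terms. Among
    the terms of small order, k is therefore taken with least plain degree on C, which forces a term
    b below k on C to agree with k there.\<close>
  define c_deg where "c_deg n = sum (lookup n) C" for n :: "'v \<Rightarrow>\<^sub>0 nat"
  obtain k where k: "k \<in> keys p" "cover_degree C k < 2"
    "\<And>n. n \<in> keys p \<Longrightarrow> cover_degree C n < 2 \<Longrightarrow> c_deg k \<le> c_deg n"
    using ex_has_least_nat[of "\<lambda>n. n \<in> keys p \<and> cover_degree C n < 2" m c_deg] neg m by auto
  define M where "M = {a \<in> keys s. keys a \<inter> C = {}}"
  define N where "N = {n \<in> keys p. \<forall>c\<in>C. lookup n c = lookup k c}"
  have out: "lookup a v = 0" if "r \<in> polys V" "a \<in> keys r" "v \<notin> V" for a v and r :: "('v, 'k) mpoly"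
  proof -
    have "v \<notin> keys a" using that unfolding polys_iff by blast
    then show ?thesis by (simp add: in_keys_iff)
  qed
  have M0: "lookup a c = 0" if "a \<in> M" "c \<in> C" for a c
  proof -
    have "c \<notin> keys a" using that unfolding M_def by blast
    then show ?thesis by (simp add: in_keys_iff)
  qed
  have "\<exists>m\<in>M. \<exists>n\<in>N. \<forall>a\<in>M. \<forall>b\<in>N. a + b = m + n \<longrightarrow> a = m \<and> b = n"
  proof (rule unique_sum)
    show "finite (V - C)" using finite_V by simp
    show "finite M" "finite N" by (auto simp: M_def N_def)
    show "M \<noteq> {}" using s unfolding in_cover_prime M_def by blast
    show "N \<noteq> {}" using k(1) by (auto simp: N_def)
    show "lookup a v = lookup a' v" if "a \<in> M" "a' \<in> M" "v \<notin> V - C" for a a' v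
      using that M0 out[OF s(1)] by (cases "v \<in> C") (auto simp: M_def)
    show "lookup a v = lookup a' v" if "a \<in> N" "a' \<in> N" "v \<notin> V - C" for a a' v
      using that out[OF p] by (cases "v \<in> C") (auto simp: N_def)
  qed
  then obtain m n where mn: "m \<in> M" "n \<in> N"
    "\<And>a b. a \<in> M \<Longrightarrow> b \<in> N \<Longrightarrow> a + b = m + n \<Longrightarrow> a = m \<and> b = n" by blast
  have mn_k: "lookup (m + n) c = lookup k c" if "c \<in> C" for c
    using mn(1,2) M0 that by (simp add: lookup_add N_def)
  have "m + n \<in> keys (s * p)"
  proof (rule unique_sum_in_keys)
    fix a b assume ab: "a \<in> keys s" "b \<in> keys p" "a + b = m + n"
    have sum: "lookup a c + lookup b c = lookup k c" if "c \<in> C" for c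
      using mn_k[OF that] ab(3) by (simp flip: lookup_add)
    then have le: "lookup b c \<le> lookup k c" if "c \<in> C" for c using that by (metis le_add2)
    have "cover_degree C b \<le> cover_degree C k"
      unfolding cover_degree_def using le by (intro sum_mono div_le_mono)
    then have "c_deg k \<le> c_deg b" using k ab(2) by simp
    have b_eq: "lookup b c = lookup k c" if "c \<in> C" for c
    proof (rule ccontr)
      assume "lookup b c \<noteq> lookup k c"
      then have "sum (lookup b) C < sum (lookup k) C"
        using le that by (intro sum_strict_mono_ex1[OF finC]) (auto simp: le_less)
      then show False using \<open>c_deg k \<le> c_deg b\<close> by (simp add: c_deg_def)
    qed
    then have "b \<in> N" using ab(2) by (simp add: N_def)
    moreover have "keys a \<inter> C = {}" using sum b_eq by (force simp: in_keys_iff)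
    then have "a \<in> M" using ab(1) by (simp add: M_def)
    ultimately show "a = m" using mn(3) ab(3) by blast
  qed (use mn in \<open>auto simp: M_def N_def\<close>)
  then have "m + n \<in> upset V square_mons" using sp unfolding mono_ideal_def by blast
  then have "2 \<le> cover_degree C (m + n)" by (rule square_cover_degree[OF C])
  also have "cover_degree C (m + n) = cover_degree C k"
    unfolding cover_degree_def using mn_k by (intro sum.cong) auto
  finally show False using k(2) by simp
qed

text \<open>Two kinds of covers suffice as tests. V - W, where W holds the vertices whose full power
  divides m, yields an edge ab in W. Adding one vertex x of W yields either the double power of x or
  an edge in W that avoids x. Used at a and b, this leads to (ab)^2, to two edges with a doubled
  common vertex, to two disjoint edges, or to a triangle.\<close>

lemma sym_upsetI:
  assumes m: "keys m \<subseteq> V" and deg: "\<And>C. vertex_cover C \<Longrightarrow> 2 \<le> cover_degree C m"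
  shows "m \<in> upset V sym_mons"
proof (rule ccontr)
  assume neg: "m \<notin> upset V sym_mons"
  then have no_square: "m \<notin> upset V square_mons"
    and no_triangle: "\<And>S. S \<in> triangles D \<Longrightarrow> \<exists>z. \<not> lookup (wmon S) z \<le> lookup m z"
    unfolding sym_upset_iff using m by blast+
  define W where "W = {v \<in> V. w v \<le> lookup m v}"
  have Wle: "w v \<le> lookup m v" if "v \<in> W" for v using that by (simp add: W_def)
  have small: "lookup m c div w c = 0" if "c \<in> V - W" for c using that by (auto simp: W_def not_le)
  have "\<not> vertex_cover (V - W)"
  proof
    assume "vertex_cover (V - W)"
    then have "2 \<le> cover_degree (V - W) m" by (rule deg)
    then show False using small by (simp add: cover_degree_def)
  qed
  then obtain a b where ab: "adj a b" "a \<in> W" "b \<in> W"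
    using adj_V unfolding vertex_cover_def by blast
  have a_b: "a \<noteq> b" using ab(1) adj_irrefl by auto
  have disjoint: False if "adj u v" "u \<in> W" "v \<in> W" "adj x y" "x \<in> W" "y \<in> W" "{u, v} \<inter> {x, y} = {}" for u v x y
  proof -
    have "m \<in> upset V square_mons"
    proof (rule square_upsetI[OF m that(1,4)])
      fix z show "(if z \<in> {u, v} then w z else 0) + (if z \<in> {x, y} then w z else 0) \<le> lookup m z"
        using that(2,3,5,6,7) Wle by auto
    qed
    then show False using no_square by blast
  qed
  have avoid: "2 * w x \<le> lookup m x \<or> (\<exists>u v. adj u v \<and> u \<in> W \<and> v \<in> W \<and> u \<noteq> x \<and> v \<noteq> x)"
    if x: "x \<in> W" for x
  proof (cases "vertex_cover (insert x (V - W))")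
    case True
    have "cover_degree (insert x (V - W)) m = lookup m x div w x"
      using small x finite_V by (simp add: cover_degree_def)
    then have "2 \<le> lookup m x div w x" using deg[OF True] by simp
    moreover have "0 < w x" using x w_pos by (simp add: W_def)
    ultimately show ?thesis by (simp add: less_eq_div_iff_mult_less_eq)
  next
    case False
    then show ?thesis using x adj_V unfolding vertex_cover_def W_def by blast
  qed
  \<comment> \<open>The edge that avoids x cannot be disjoint from the edge xy, since this would put
    m into the square; hence it passes through y.\<close>
  have nbr: "2 * w x \<le> lookup m x \<or> (\<exists>c\<in>W. adj y c \<and> c \<noteq> x)" if xy: "adj x y" "x \<in> W" "y \<in> W" for x y
  proof (rule ccontr)
    assume no: "\<not> ?thesis"
    then obtain u v where uv: "adj u v" "u \<in> W" "v \<in> W" "u \<noteq> x" "v \<noteq> x" using avoid[OF xy(2)] by blast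
    have "u \<noteq> y" "v \<noteq> y" using no uv adj_sym[OF uv(1)] by blast+
    then show False using disjoint[OF xy uv(1-3)] uv by auto
  qed
  have twice: False if "adj x y" "adj x c" "c \<noteq> y" "2 * w x \<le> lookup m x" "x \<in> W" "y \<in> W" "c \<in> W" for x y c
  proof -
    have "x \<noteq> y" "x \<noteq> c" using that adj_irrefl by auto
    have "m \<in> upset V square_mons"
    proof (rule square_upsetI[OF m that(1,2)])
      fix z show "(if z \<in> {x, y} then w z else 0) + (if z \<in> {x, c} then w z else 0) \<le> lookup m z"
        using that(3-7) \<open>x \<noteq> y\<close> \<open>x \<noteq> c\<close> Wle by auto
    qed
    then show False using no_square by blast
  qed
  from nbr[OF ab] nbr[OF adj_sym[OF ab(1)] ab(3,2)]
  consider "2 * w a \<le> lookup m a" "2 * w b \<le> lookup m b"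
    | d where "2 * w a \<le> lookup m a" "d \<in> W" "adj a d" "d \<noteq> b"
    | c where "2 * w b \<le> lookup m b" "c \<in> W" "adj b c" "c \<noteq> a"
    | c d where "c \<in> W" "adj b c" "c \<noteq> a" "d \<in> W" "adj a d" "d \<noteq> b" by blast
  then show False
  proof cases
    case 1
    have "m \<in> upset V square_mons"
    proof (rule square_upsetI[OF m ab(1) ab(1)])
      fix z show "(if z \<in> {a, b} then w z else 0) + (if z \<in> {a, b} then w z else 0) \<le> lookup m z"
        using 1 by auto
    qed
    then show False using no_square by blast
  next
    case 2
    then show False using twice[OF ab(1) 2(3)] ab by blast
  next
    case 3
    then show False using twice[OF adj_sym[OF ab(1)] 3(3)] ab by blast
  next
    case 4
    show False
    proof (cases "c = d")
      case True
      then have "{a, b, c} \<in> triangles D" unfolding triangles_iff using ab(1) 4 by blast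
      then obtain z where "\<not> lookup (wmon {a, b, c}) z \<le> lookup m z" using no_triangle by blast
      then show False using ab(2,3) 4(1) Wle by (auto simp: lookup_wmon split: if_splits)
    next
      case False
      then show False
        using disjoint[OF 4(2) ab(3) 4(1) 4(5) ab(2) 4(4)] 4 a_b by auto
    qed
  qed
qed

text \<open>The primes of minimal covers are associated, so a term of p passes the test for these
  covers. Any other cover contains a minimal one, and enlarging a cover cannot lower its
  \<open>cover_degree\<close>.\<close>

lemma symbolic_square:
  "symbolic_power (poly_ring V) (edge_ideal D) 2 = (mono_ideal (upset V sym_mons) :: ('v, 'k::field) mpoly set)"
proof (intro equalityI subsetI)
  fix p :: "('v, 'k) mpoly" assume "p \<in> mono_ideal (upset V sym_mons)"
  then show "p \<in> symbolic_power (poly_ring V) (edge_ideal D) 2" by (rule sym_mons_in_symbolic_power)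
next
  let ?R = "poly_ring V :: ('v, 'k) mpoly ring" and ?I = "edge_ideal D :: ('v, 'k) mpoly set"
  fix p assume p: "p \<in> symbolic_power ?R ?I 2"
  have "vertex_cover V" using adj_V by (auto simp: vertex_cover_def)
  have loc: "p \<in> polys V \<and> (\<exists>s\<in>polys V. s \<notin> cover_prime C \<and> s * p \<in> mono_ideal (upset V square_mons))"
    if C: "vertex_cover C" "\<And>c. c \<in> C \<Longrightarrow> \<exists>u. adj c u \<and> u \<notin> C" for C
  proof -
    have "p \<in> loc_contraction ?R (cover_prime C) (ideal_power ?R ?I 2)"
      using p cover_prime_Ass[OF C, where 'k = 'k] unfolding symbolic_power_def by blast
    then obtain a s t where pR: "p \<in> polys V" and a: "a \<in> mono_ideal (upset V square_mons)"
      and st: "s \<in> polys V" "s \<notin> cover_prime C" "t \<in> polys V" "t \<notin> cover_prime C"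
      and eq: "t * (s * p \<ominus>\<^bsub>?R\<^esub> a) = 0"
      unfolding loc_contraction_def edge_ideal_square by auto
    have aR: "a \<in> polys V" by (rule polys_idealD(1)[OF mono_ideal_ideal[OF up_closed_upset] a])
    have spR: "s * p \<in> polys V" using st pR by simp
    have "t * s * p = t * a" using eq aR by (simp add: poly_ring_minus algebra_simps)
    then have "t * s * p \<in> mono_ideal (upset V square_mons)"
      using polys_idealD(4)[OF mono_ideal_ideal[OF up_closed_upset] st(3) a] by simp
    moreover have "t * s \<notin> cover_prime C"
    proof -
      have "C \<subseteq> V" using C(1) by (simp add: vertex_cover_def)
      from primeideal.I_prime[OF cover_prime_prime[OF this, where 'k = 'k], of t s] show ?thesis
        using st by auto
    qed
    ultimately show ?thesis using pR st by (auto intro!: bexI[of _ "t * s"])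
  qed
  obtain C0 where C0: "vertex_cover C0" "\<And>c. c \<in> C0 \<Longrightarrow> \<exists>u. adj c u \<and> u \<notin> C0"
    using minimal_vertex_cover[OF \<open>vertex_cover V\<close>] by blast
  have pR: "p \<in> polys V" using loc[OF C0] by blast
  show "p \<in> mono_ideal (upset V sym_mons)" unfolding mono_ideal_def mem_Collect_eq
  proof
    fix m assume m: "m \<in> keys p"
    show "m \<in> upset V sym_mons"
    proof (rule sym_upsetI)
      show "keys m \<subseteq> V" using pR m unfolding polys_iff by blast
      fix C assume C: "vertex_cover C"
      obtain C' where C': "C' \<subseteq> C" "vertex_cover C'" "\<And>c. c \<in> C' \<Longrightarrow> \<exists>u. adj c u \<and> u \<notin> C'"
        using minimal_vertex_cover[OF C] by blast
      obtain s where "s \<in> polys V" "s \<notin> cover_prime C'" "s * p \<in> mono_ideal (upset V square_mons)"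
        using loc[OF C'(2,3)] by blast
      then have "2 \<le> cover_degree C' m" using cover_degree_contraction[OF C'(2) pR] m by blast
      also have "\<dots> \<le> cover_degree C m"
        unfolding cover_degree_def using C C'(1) finite_V
        by (intro sum_mono2) (auto simp: vertex_cover_def intro: finite_subset)
      finally show "2 \<le> cover_degree C m" .
    qed
  qed
qed

end

section \<open>Comparison of the regularities\<close>

context finite_vars
begin

text \<open>The Koszul strand of R modulo the ideal: the full simplex relative to the complex of the
  ideal.\<close>

definition quot_faces :: "('v \<Rightarrow>\<^sub>0 nat) set \<Rightarrow> ('v \<Rightarrow>\<^sub>0 nat) \<Rightarrow> 'v set set" where
  "quot_faces U \<gamma> = Pow (V \<inter> keys \<gamma>) - faces V U \<gamma>"

lemma face_pair_quot:
  assumes "up_closed V U" shows "face_pair V (faces V U \<gamma>) (Pow (V \<inter> keys \<gamma>))"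
proof
  show "finite V" by (rule finV)
  show "face_closed (faces V U \<gamma>)" by (rule face_closed_faces[OF assms])
  show "faces V U \<gamma> \<subseteq> Pow (V \<inter> keys \<gamma>)" unfolding faces_def by blast
  show "face_closed (Pow (V \<inter> keys \<gamma>))" unfolding face_closed_def by blast
qed blast

lemma exact_Pow:
  assumes "keys \<gamma> \<subseteq> V" "\<gamma> \<noteq> 0 \<or> k \<noteq> 0"
  shows "exact_at TYPE('k::field) V (Pow (V \<inter> keys \<gamma>)) k"
proof (cases "\<gamma> = 0")
  case True
  then show ?thesis using assms by (intro exact_at_no_faces) auto
next
  case False
  then obtain u where "u \<in> keys \<gamma>" by (metis keys_eq_empty ex_in_conv)
  then show ?thesis using assms finV by (intro exact_at_cone[of _ u]) auto
qed

lemma reg_generators_positive: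
  assumes G: "finite G" "\<And>g. g \<in> G \<Longrightarrow> keys g \<subseteq> V" "0 \<notin> G"
  shows "1 \<le> reg V (mono_ideal (upset V G) :: ('v, 'k::field) mpoly set)"
proof (cases "G = {}")
  case True
  then have "mono_ideal (upset V G) = {0 :: ('v, 'k) mpoly}" by (auto simp: mono_ideal_def upset_def)
  then show ?thesis by (simp add: reg_def)
next
  case False
  have keysG: "\<forall>g\<in>G. keys g \<subseteq> V" using G(2) by blast
  note reg = reg_mono_ideal[OF G(1) False keysG, where 'k = 'k]
  obtain g where g: "g \<in> G" "\<not> exact_at TYPE('k) V (faces V (upset V G) g) 0"
    using generator_not_exact[OF G(1) False G(2)] by blast
  then have "int (mdeg g) \<in> shifted_degs TYPE('k) (upset V G)" by (force simp: shifted_degs_def)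
  then have "int (mdeg g) \<le> reg V (mono_ideal (upset V G) :: ('v, 'k) mpoly set)"
    unfolding reg(3) using reg(1) by (intro Max_ge)
  moreover have "mdeg g \<noteq> 0" using g(1) G(3) by (auto simp: mdeg_eq_0_iff)
  ultimately show ?thesis by linarith
qed

text \<open>The upper half of reg (R/J) = reg J - 1. The simplex is acyclic, so homology of R/J at k
  comes from J at k - 1. The exception is \<gamma> = 0 with k = 0, where the claim becomes reg J
  \<ge> 1.\<close>

lemma quot_faces_upper:
  assumes G: "finite G" "\<And>g. g \<in> G \<Longrightarrow> keys g \<subseteq> V" "0 \<notin> G" and \<gamma>: "keys \<gamma> \<subseteq> V"
    and ne: "\<not> exact_at TYPE('k::field) V (quot_faces (upset V G) \<gamma>) k"
  shows "int (mdeg \<gamma>) - int k \<le> reg V (mono_ideal (upset V G) :: ('v, 'k) mpoly set) - 1"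
proof (cases "\<gamma> = 0 \<and> k = 0")
  case True
  then show ?thesis using reg_generators_positive[OF G, where 'k = 'k] by simp
next
  case False
  interpret face_pair "TYPE('k)" V "faces V (upset V G) \<gamma>" "Pow (V \<inter> keys \<gamma>)"
    by (rule face_pair_quot[OF up_closed_upset])
  have "k \<noteq> 0 \<and> \<not> exact_at TYPE('k) V (faces V (upset V G) \<gamma>) (k - 1)"
    using exact_at_quot[of k] exact_Pow[OF \<gamma>, of k, where 'k = 'k] False ne unfolding quot_faces_def by blast
  then obtain k' where k: "k = Suc k'" "\<not> exact_at TYPE('k) V (faces V (upset V G) \<gamma>) k'"
    by (cases k) auto
  have keysG: "\<forall>g\<in>G. keys g \<subseteq> V" using G(2) by blast
  have "G \<noteq> {}"
  proof
    assume "G = {}"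
    then have "faces V (upset V G) \<gamma> = {}" by (simp add: faces_def upset_def)
    then show False using k(2) exact_at_no_faces[of "{}" k' V, where 'k = 'k] by simp
  qed
  note reg = reg_mono_ideal[OF G(1) this keysG, where 'k = 'k]
  have "int (mdeg \<gamma>) - int k' \<in> shifted_degs TYPE('k) (upset V G)" using k(2) by (auto simp: shifted_degs_def)
  then have "int (mdeg \<gamma>) - int k' \<le> reg V (mono_ideal (upset V G) :: ('v, 'k) mpoly set)"
    unfolding reg(3) using reg(1) by (intro Max_ge)
  then show ?thesis using k(1) by simp
qed

text \<open>The lower half of reg (R/J) = reg J - 1: homology of J at k reappears in R/J at k + 1.
  For J = 0 the homology is that of R itself at \<gamma> = 0, k = 0, in accordance with reg 0 =
  1.\<close>

lemma quot_faces_attained: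
  assumes G: "finite G" "\<And>g. g \<in> G \<Longrightarrow> keys g \<subseteq> V" "0 \<notin> G"
  shows "\<exists>\<gamma> k. keys \<gamma> \<subseteq> V \<and> \<not> exact_at TYPE('k::field) V (quot_faces (upset V G) \<gamma>) k \<and>
    int (mdeg \<gamma>) - int k = reg V (mono_ideal (upset V G) :: ('v, 'k) mpoly set) - 1"
proof (cases "G = {}")
  case True
  then have reg: "reg V (mono_ideal (upset V G) :: ('v, 'k) mpoly set) = 1"
    by (auto simp: mono_ideal_def upset_def reg_def)
  have X: "quot_faces (upset V G) 0 = {{}}" using True by (auto simp: quot_faces_def faces_def upset_def)
  define a :: "'v set \<Rightarrow> 'k" where "a \<sigma> = of_bool (\<sigma> = {})" for \<sigma>
  have "\<not> exact_at TYPE('k) V (quot_faces (upset V G) 0) 0"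
  proof
    assume "exact_at TYPE('k) V (quot_faces (upset V G) 0) 0"
    moreover have "a \<in> kchains (quot_faces (upset V G) 0) 0" by (simp add: X kchains_def a_def)
    moreover have "\<forall>\<rho>\<in>quot_faces (upset V G) 0. bd V a \<rho> = 0" by (auto intro!: kbd_eq_0 simp: a_def)
    ultimately obtain b where b: "b \<in> kchains (quot_faces (upset V G) 0) (Suc 0)" "bd V b {} = a {}"
      using exact_atE unfolding X by blast
    have "bd V b {} = 0" by (rule kbd_eq_0) (use b(1) in \<open>auto simp: kchains_def X\<close>)
    then show False using b(2) by (simp add: a_def)
  qed
  then show ?thesis using reg by (intro exI[of _ 0]) auto
next
  case False
  have keysG: "\<forall>g\<in>G. keys g \<subseteq> V" using G(2) by blast
  note reg = reg_mono_ideal[OF G(1) False keysG, where 'k = 'k]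
  have "reg V (mono_ideal (upset V G) :: ('v, 'k) mpoly set) \<in> shifted_degs TYPE('k) (upset V G)"
    unfolding reg(3) using reg(1,2) by (rule Max_in)
  then obtain \<gamma> k where \<gamma>: "\<not> exact_at TYPE('k) V (faces V (upset V G) \<gamma>) k"
    "int (mdeg \<gamma>) - int k = reg V (mono_ideal (upset V G) :: ('v, 'k) mpoly set)"
    unfolding shifted_degs_def by auto
  interpret face_pair "TYPE('k)" V "faces V (upset V G) \<gamma>" "Pow (V \<inter> keys \<gamma>)"
    by (rule face_pair_quot[OF up_closed_upset])
  have "faces V (upset V G) \<gamma> \<noteq> {}" using \<gamma>(1) exact_at_no_faces[of "{}" k V, where 'k = 'k] by auto
  then have "{} \<in> faces V (upset V G) \<gamma>" using subfaceA by blast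
  then have \<gamma>U: "\<gamma> \<in> upset V G" by (simp add: faces_def)
  then have keys: "keys \<gamma> \<subseteq> V" by (simp add: upset_def)
  have "\<gamma> \<noteq> 0"
  proof
    assume "\<gamma> = 0"
    then obtain g where "g \<in> G" "\<And>v. lookup g v = 0" using \<gamma>U by (auto simp: upset_def)
    then have "g = 0" by (intro poly_mapping_eqI) simp
    then show False using \<open>g \<in> G\<close> G(3) by blast
  qed
  then have "exact_at TYPE('k) V (Pow (V \<inter> keys \<gamma>)) k" using exact_Pow[OF keys] by blast
  then have "\<not> exact_at TYPE('k) V (quot_faces (upset V G) \<gamma>) (Suc k)"
    using exact_at_sub \<gamma>(1) unfolding quot_faces_def by blast
  then show ?thesis using keys \<gamma>(2) by (intro exI[of _ \<gamma>] exI[of _ "Suc k"]) auto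
qed

end

text \<open>Vertices outside W lie in no face, so their terms in the boundary vanish. Needed because
  a strand off N[S] is joined with a set \<tau> that may be smaller than N[S].\<close>

lemma exact_at_enlarge:
  assumes "X \<subseteq> Pow W" "W \<subseteq> V" "finite V"
  shows "exact_at TYPE('k::field) V X i \<longleftrightarrow> exact_at TYPE('k) W X i"
proof -
  have "bd V a \<rho> = bd W a \<rho>" if "a \<in> kchains X j" for a :: "'a set \<Rightarrow> 'k" and j \<rho>
    unfolding kbd_def
  proof (rule sum.mono_neutral_right)
    show "\<forall>v\<in>V - \<rho> - (W - \<rho>). ksgn v \<rho> * 1 * a (insert v \<rho>) = 0"
      using that assms(1) by (auto simp: kchains_def)
  qed (use assms in auto)
  then show ?thesis unfolding exact_at_def by (metis (no_types, lifting))
qed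

text \<open>Moving a past all of \<rho>: by orientation, each pair of a and v in \<rho> contributes
  exactly one sign.\<close>

lemma ksgn_join_sgn:
  "finite \<rho> \<Longrightarrow> a \<notin> \<rho> \<Longrightarrow> ksgn a \<rho> * join_sgn {a} \<rho> = ((- 1) ^ card \<rho> :: 'k::comm_ring_1)"
proof (induction \<rho> rule: finite_induct)
  case (insert v \<rho>)
  then have "(ksgn a (insert v \<rho>) * ksgn v {a} :: 'k) = - ksgn a \<rho>"
    using orientation[of a v] ksgn_insert[of "{}" a v, where 'a = 'k] by (simp add: ksgn_insert)
  moreover have "(ksgn a (insert v \<rho>) * join_sgn {a} (insert v \<rho>) :: 'k)
      = (ksgn a (insert v \<rho>) * ksgn v {a}) * join_sgn {a} \<rho>"
    using insert.hyps by (simp add: join_sgn_insert algebra_simps)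
  ultimately show ?case using insert by simp
qed (simp add: join_sgn_def)

lemma join_sgn_Un:
  "finite \<sigma> \<Longrightarrow> finite \<tau> \<Longrightarrow> \<sigma> \<inter> \<tau> = {} \<Longrightarrow> join_sgn (\<sigma> \<union> \<tau>) \<rho> = join_sgn \<sigma> \<rho> * (join_sgn \<tau> \<rho> :: 'k::comm_ring_1)"
  by (simp add: join_sgn_def ksgn_Un prod.distrib)

section \<open>Decomposition of I^(2) / I^2 over the triangles\<close>

context sink_weighted_graph
begin

abbreviation nbhd :: "'v set \<Rightarrow> 'v set" where "nbhd S \<equiv> closed_nbhd D S"

lemma nbhd_V: "S \<in> triangles D \<Longrightarrow> nbhd S \<subseteq> V" "S \<subseteq> nbhd S"
  using triangle_finite(2)[of S] adj_V by (auto simp: closed_nbhd_iff)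

text \<open>The monomials in the summand of \<open>I\<^sup>(\<^sup>2\<^sup>) / I\<^sup>2\<close> generated by the triangle \<open>S\<close>; it is a shift of
  \<open>R / ((x\<^sub>v\<^bsup>w v\<^esup> : v \<in> N[S]) + I(D - N[S]))\<close>.\<close>

definition summand :: "'v set \<Rightarrow> ('v \<Rightarrow>\<^sub>0 nat) set" where
  "summand S = {m. keys m \<subseteq> V \<and>
     (\<forall>v\<in>nbhd S. lookup (wmon S) v \<le> lookup m v \<and> lookup m v < lookup (wmon S) v + w v) \<and>
     \<not> (\<exists>u\<in>V - nbhd S. \<exists>v\<in>V - nbhd S. adj u v \<and> w u \<le> lookup m u \<and> w v \<le> lookup m v)}"

lemma lookup_wmon_triangle: "S \<in> triangles D \<Longrightarrow> lookup (wmon S) v = (if v \<in> S then w v else 0)"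
  using triangle_finite(1) lookup_wmon by blast

lemma disjoint_edges_square:
  assumes "keys m \<subseteq> V" "adj u v" "adj x y" "{u, v} \<inter> {x, y} = {}" "\<And>z. z \<in> {u, v, x, y} \<Longrightarrow> w z \<le> lookup m z"
  shows "m \<in> upset V square_mons"
proof (rule square_upsetI[OF assms(1-3)])
  fix z show "(if z \<in> {u, v} then w z else 0) + (if z \<in> {x, y} then w z else 0) \<le> lookup m z"
    using assms(4,5) by auto
qed

text \<open>Exceeding the bound at a vertex of N[S], or an edge off N[S] next to an edge of S, puts
  the monomial into I^2. Conversely, a vertex outside S whose full power divides m is off N[S], and
  so would be its partner in an edge dividing m. Thus two edges whose product divides m lie in S,
  share a vertex, and double it beyond its bound.\<close>

lemma sym_minus_square: "upset V sym_mons - upset V square_mons = (\<Union>S\<in>triangles D. summand S)"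
proof (intro equalityI subsetI)
  fix m assume m: "m \<in> upset V sym_mons - upset V square_mons"
  then obtain S where S: "keys m \<subseteq> V" "S \<in> triangles D" "\<And>z. lookup (wmon S) z \<le> lookup m z"
    unfolding Diff_iff sym_upset_iff by blast
  obtain a b c where abc: "S = {a, b, c}" "adj a b" using S(2) unfolding triangles_iff by blast
  have "lookup m v < lookup (wmon S) v + w v" if v: "v \<in> nbhd S" for v
  proof (rule ccontr)
    assume big: "\<not> lookup m v < lookup (wmon S) v + w v"
    have "m \<in> upset V square_mons"
    proof (rule triangle_times_neighbour[OF S(2) v S(1)])
      fix z show "lookup (wmon S) z + lookup (wmon {v}) z \<le> lookup m z"
        using big S(3)[of z] by (cases "z = v") (auto simp: lookup_wmon)
    qed
    then show False using m by blast
  qed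
  moreover have False
    if uv: "u \<in> V - nbhd S" "v \<in> V - nbhd S" "adj u v" "w u \<le> lookup m u" "w v \<le> lookup m v" for u v
  proof -
    have "{a, b} \<inter> {u, v} = {}" using uv abc by (auto simp: closed_nbhd_iff)
    moreover have "w z \<le> lookup m z" if z: "z \<in> {a, b, u, v}" for z
    proof (cases "z \<in> S")
      case True
      then show ?thesis using S(3)[of z] by (simp add: lookup_wmon_triangle[OF S(2)])
    next
      case False
      then have "z \<in> {u, v}" using z abc(1) by auto
      then show ?thesis using uv by auto
    qed
    ultimately have "m \<in> upset V square_mons" by (intro disjoint_edges_square[OF S(1) abc(2) uv(3)]) auto
    then show False using m by blast
  qed
  ultimately have "m \<in> summand S" using S unfolding summand_def by blast
  then show "m \<in> (\<Union>S\<in>triangles D. summand S)" using S(2) by blast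
next
  fix m assume "m \<in> (\<Union>S\<in>triangles D. summand S)"
  then obtain S where S: "S \<in> triangles D" "m \<in> summand S" by blast
  have mV: "keys m \<subseteq> V" and lo: "\<And>v. v \<in> nbhd S \<Longrightarrow> lookup (wmon S) v \<le> lookup m v"
    and hi: "\<And>v. v \<in> nbhd S \<Longrightarrow> lookup m v < lookup (wmon S) v + w v"
    and edge: "\<And>u v. u \<in> V - nbhd S \<Longrightarrow> v \<in> V - nbhd S \<Longrightarrow> adj u v \<Longrightarrow> w u \<le> lookup m u \<Longrightarrow> w v \<le> lookup m v \<Longrightarrow> False"
    using S(2) unfolding summand_def by blast+
  have "lookup (wmon S) z \<le> lookup m z" for z
    using lo[of z] nbhd_V(2)[of S] by (cases "z \<in> S") (auto simp: lookup_wmon_triangle[OF S(1)])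
  then have "m \<in> upset V sym_mons" unfolding sym_upset_iff using mV S(1) by blast
  moreover have "m \<notin> upset V square_mons"
  proof
    assume "m \<in> upset V square_mons"
    then obtain u v x y where uv: "adj u v" "adj x y"
      and le: "\<And>z. (if z \<in> {u, v} then w z else 0) + (if z \<in> {x, y} then w z else 0) \<le> lookup m z"
      using square_upsetD by blast
    have big: "w u \<le> lookup m u" "w v \<le> lookup m v" "w x \<le> lookup m x" "w y \<le> lookup m y"
      using le[of u] le[of v] le[of x] le[of y] by (auto split: if_splits)
    have in_S: "p \<in> S" if pq: "adj p q" "w p \<le> lookup m p" "w q \<le> lookup m q" for p q
    proof (rule ccontr)
      assume pS: "p \<notin> S"
      have not_nbhd: "z \<notin> nbhd S" if "z \<notin> S" "w z \<le> lookup m z" for z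
        using hi[of z] that by (auto simp: lookup_wmon_triangle[OF S(1)])
      have p: "p \<notin> nbhd S" using not_nbhd pS pq by blast
      then have "q \<notin> S" using adj_sym[OF pq(1)] by (auto simp: closed_nbhd_iff)
      then show False using edge[of p q] p not_nbhd pq adj_V by blast
    qed
    have sub: "u \<in> S" "v \<in> S" "x \<in> S" "y \<in> S"
      using in_S[OF uv(1)] in_S[OF adj_sym[OF uv(1)]] in_S[OF uv(2)] in_S[OF adj_sym[OF uv(2)]] big by auto
    have "{u, v} \<inter> {x, y} \<noteq> {}"
    proof
      assume disj: "{u, v} \<inter> {x, y} = {}"
      have "u \<noteq> v" "x \<noteq> y" using uv adj_irrefl by auto
      then have "card {u, v, x, y} = 4" using disj by (auto simp: card_insert_if)
      moreover have "card {u, v, x, y} \<le> card S" using sub triangle_finite(1)[OF S(1)] by (intro card_mono) auto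
      moreover have "card S = 3" using S(1) by (simp add: triangles_def)
      ultimately show False by simp
    qed
    then obtain z where z: "z \<in> {u, v}" "z \<in> {x, y}" by blast
    then have "z \<in> S" using sub by auto
    moreover have "2 * w z \<le> lookup m z" using le[of z] z by simp
    ultimately show False using hi[of z] nbhd_V(2)[of S] by (auto simp: lookup_wmon_triangle[OF S(1)])
  qed
  ultimately show "m \<in> upset V sym_mons - upset V square_mons" by blast
qed

text \<open>A vertex of T outside S is either a neighbour of S, or T is disjoint from S, because its
  vertices are mutually adjacent. In both cases a product of two edges divides m.\<close>

lemma triangle_unique:
  assumes m: "keys m \<subseteq> V" "m \<notin> upset V square_mons"
    and S: "S \<in> triangles D" "\<And>z. lookup (wmon S) z \<le> lookup m z"
    and T: "T \<in> triangles D" "\<And>z. lookup (wmon T) z \<le> lookup m z"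
  shows "S = T"
proof -
  have "T \<subseteq> S"
  proof
    fix x assume x: "x \<in> T"
    show "x \<in> S"
    proof (rule ccontr)
      assume xS: "x \<notin> S"
      show False
      proof (cases "x \<in> nbhd S")
        case True
        have "m \<in> upset V square_mons"
        proof (rule triangle_times_neighbour[OF S(1) True m(1)])
          fix z show "lookup (wmon S) z + lookup (wmon {x}) z \<le> lookup m z"
            using S(2)[of z] T(2)[of z] x xS
            by (auto simp: lookup_wmon_triangle[OF S(1)] lookup_wmon_triangle[OF T(1)] lookup_wmon)
        qed
        then show False using m(2) by blast
      next
        case False
        have "S \<inter> T = {}"
        proof (rule ccontr)
          assume "S \<inter> T \<noteq> {}"
          then obtain y where y: "y \<in> S" "y \<in> T" by blast
          then have "y \<noteq> x" using xS by blast
          then have "adj y x" using T(1) x y(2) adj_sym unfolding triangles_iff by blast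
          then show False using False y(1) by (auto simp: closed_nbhd_iff)
        qed
        moreover obtain a b c where abc: "S = {a, b, c}" "adj a b" using S(1) unfolding triangles_iff by blast
        moreover obtain a' b' c' where abc': "T = {a', b', c'}" "adj a' b'" using T(1) unfolding triangles_iff by blast
        ultimately have "{a, b} \<inter> {a', b'} = {}" by auto
        moreover have "w z \<le> lookup m z" if z: "z \<in> {a, b, a', b'}" for z
        proof (cases "z \<in> S")
          case True
          then show ?thesis using S(2)[of z] by (simp add: lookup_wmon_triangle[OF S(1)])
        next
          case False
          then have "z \<in> T" using z abc(1) abc'(1) by auto
          then show ?thesis using T(2)[of z] by (simp add: lookup_wmon_triangle[OF T(1)])
        qed
        ultimately have "m \<in> upset V square_mons" by (intro disjoint_edges_square[OF m(1) abc(2) abc'(2)]) auto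
        then show False using m(2) by blast
      qed
    qed
  qed
  moreover have "card S = card T" using S(1) T(1) by (simp add: triangles_def)
  ultimately show "S = T" using triangle_finite(1)[OF S(1)] card_subset_eq by metis
qed

lemma summandD:
  assumes "S \<in> triangles D" "m \<in> summand S"
  shows "keys m \<subseteq> V" "m \<notin> upset V square_mons" "lookup (wmon S) z \<le> lookup m z"
proof -
  show "keys m \<subseteq> V" using assms(2) by (simp add: summand_def)
  show "m \<notin> upset V square_mons" using sym_minus_square assms by blast
  show "lookup (wmon S) z \<le> lookup m z"
  proof (cases "z \<in> S")
    case True
    then have "z \<in> nbhd S" using nbhd_V(2) by blast
    then show ?thesis using assms(2) by (simp add: summand_def)
  qed (simp add: lookup_wmon_triangle[OF assms(1)])
qed

text \<open>Comparable faces give comparable monomials, and the larger one lies above the triangles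
  of both. By uniqueness they belong to the same summand, so the summands are separate blocks of the
  complex.\<close>

lemma quot_summands:
  assumes ex: "\<And>S. S \<in> triangles D \<Longrightarrow> exact_at TYPE('k::field) V (faces V (summand S) \<alpha>) i"
  shows "exact_at TYPE('k) V (faces V (upset V sym_mons) \<alpha> - faces V (upset V square_mons) \<alpha>) i"
proof (rule exact_at_disjoint_union[of _ "\<lambda>S. faces V (summand S) \<alpha>" "triangles D"])
  let ?X = "faces V (upset V sym_mons) \<alpha> - faces V (upset V square_mons) \<alpha>"
  have "?X = faces V (upset V sym_mons - upset V square_mons) \<alpha>" unfolding faces_def by blast
  also have "\<dots> = (\<Union>S\<in>triangles D. faces V (summand S) \<alpha>)"
    unfolding sym_minus_square by (simp add: set_eq_iff faces_def)
  finally show X: "?X = (\<Union>S\<in>triangles D. faces V (summand S) \<alpha>)" .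
  have le: "lookup (\<alpha> - face_mon \<sigma>) z \<le> lookup (\<alpha> - face_mon \<rho>) z" if "\<rho> \<subseteq> \<sigma>" "\<sigma> \<subseteq> V" for \<rho> \<sigma> z
  proof -
    have "finite \<sigma>" "finite \<rho>" using that finite_V by (auto intro: finite_subset)
    then show ?thesis using that(1) by (auto simp: lookup_minus lookup_face_mon)
  qed
  show "\<sigma> \<in> faces V (summand S) \<alpha>"
    if S: "S \<in> triangles D" and \<rho>: "\<rho> \<in> faces V (summand S) \<alpha>" and \<sigma>: "\<sigma> \<in> ?X" and comp: "\<rho> \<subseteq> \<sigma> \<or> \<sigma> \<subseteq> \<rho>"
    for S \<rho> \<sigma>
  proof -
    obtain T where T: "T \<in> triangles D" "\<sigma> \<in> faces V (summand T) \<alpha>" using \<sigma> unfolding X by blast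
    have s: "\<alpha> - face_mon \<rho> \<in> summand S" "\<alpha> - face_mon \<sigma> \<in> summand T" "\<rho> \<subseteq> V" "\<sigma> \<subseteq> V"
      using \<rho> T(2) by (auto simp: faces_def)
    note S' = summandD[OF S s(1)] and T' = summandD[OF T(1) s(2)]
    have "S = T" using comp
    proof
      assume "\<rho> \<subseteq> \<sigma>"
      then have "lookup (wmon T) z \<le> lookup (\<alpha> - face_mon \<rho>) z" for z
        using T'(3)[of z] le[of \<rho> \<sigma> z] s(4) by linarith
      then show "S = T" by (intro triangle_unique[OF S'(1,2) S S'(3) T(1)])
    next
      assume "\<sigma> \<subseteq> \<rho>"
      then have "lookup (wmon S) z \<le> lookup (\<alpha> - face_mon \<sigma>) z" for z
        using S'(3)[of z] le[of \<sigma> \<rho> z] s(3) by linarith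
      then show "S = T" by (intro triangle_unique[OF T'(1,2) S _ T(1) T'(3)])
    qed
    then show ?thesis using T(2) by simp
  qed
  show "S = T" if "S \<in> triangles D" "T \<in> triangles D" "\<rho> \<in> faces V (summand S) \<alpha>" "\<rho> \<in> faces V (summand T) \<alpha>"
    for S T \<rho>
    using that summandD triangle_unique[of "\<alpha> - face_mon \<rho>" S T] unfolding faces_def by blast
qed (rule ex)

section \<open>Homology of one summand\<close>

definition outer :: "'v set \<Rightarrow> ('v \<Rightarrow>\<^sub>0 nat) \<Rightarrow> ('v \<Rightarrow>\<^sub>0 nat)" where
  "outer S \<alpha> = (\<Sum>v\<in>V - nbhd S. single v (lookup \<alpha> v))"

lemma lookup_outer: "lookup (outer S \<alpha>) v = (if v \<in> V - nbhd S then lookup \<alpha> v else 0)"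
proof -
  have "lookup (outer S \<alpha>) v = (\<Sum>x\<in>V - nbhd S. if x = v then lookup \<alpha> v else 0)"
    unfolding outer_def lookup_sum by (rule sum.cong) (auto simp: lookup_single when_def)
  then show ?thesis using finite_V by simp
qed

lemma keys_outer: "keys (outer S \<alpha>) = keys \<alpha> \<inter> (V - nbhd S)"
  by (auto simp: in_keys_iff lookup_outer split: if_splits)

text \<open>The Koszul strand of the quotient by the edge ideal of D - N[S], over the ring in the
  variables off N[S].\<close>

definition outer_faces :: "'v set \<Rightarrow> ('v \<Rightarrow>\<^sub>0 nat) \<Rightarrow> 'v set set" where
  "outer_faces S \<gamma> = finite_vars.quot_faces (V - nbhd S) (upset (V - nbhd S) (edge_mons (V - nbhd S))) \<gamma>"

lemma finite_vars_outer: "finite_vars (V - nbhd S)"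
  by standard (use finite_V in simp)

lemma in_outer_faces:
  assumes "keys \<gamma> \<subseteq> V - nbhd S"
  shows "\<rho> \<in> outer_faces S \<gamma> \<longleftrightarrow> \<rho> \<subseteq> keys \<gamma> \<and>
    \<not> (\<exists>u\<in>V - nbhd S. \<exists>v\<in>V - nbhd S. adj u v \<and> w u \<le> lookup (\<gamma> - face_mon \<rho>) u \<and> w v \<le> lookup (\<gamma> - face_mon \<rho>) v)"
proof -
  have "keys (\<gamma> - face_mon \<rho>) \<subseteq> V - nbhd S" using keys_minus_nat assms by (rule subset_trans)
  from edge_upset_iff[OF this] show ?thesis
    unfolding outer_faces_def finite_vars.quot_faces_def[OF finite_vars_outer] faces_def using assms by auto
qed

text \<open>At v \<in> N[S] the summand allows the exponents from \<open>lookup (wmon S) v\<close>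
  up to, but excluding, that number plus w v. If \<alpha> sits at the excluded end, v must be in the
  face; if it sits at the lower end, v must not. So the part of a face in N[S] is forced to be
  \<tau>.\<close>

lemma faces_summand_join:
  assumes S: "S \<in> triangles D" and \<alpha>: "keys \<alpha> \<subseteq> V"
    and vals: "\<And>v. v \<in> nbhd S \<Longrightarrow> lookup \<alpha> v = lookup (wmon S) v \<or> lookup \<alpha> v = lookup (wmon S) v + w v"
    and \<tau>: "\<tau> = {v \<in> nbhd S. lookup \<alpha> v = lookup (wmon S) v + w v}"
  shows "faces V (summand S) \<alpha> = (\<union>) \<tau> ` outer_faces S (outer S \<alpha>)"
proof -
  have NV: "nbhd S \<subseteq> V" by (rule nbhd_V(1)[OF S])
  have wp: "0 < w v" if "v \<in> nbhd S" for v using that NV w_pos by blast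
  have \<tau>N: "\<tau> \<subseteq> nbhd S" using \<tau> by blast
  have ok: "keys (outer S \<alpha>) \<subseteq> V - nbhd S" by (simp add: keys_outer)
  have split: "\<sigma> \<in> faces V (summand S) \<alpha> \<longleftrightarrow> \<sigma> \<inter> nbhd S = \<tau> \<and> \<sigma> - nbhd S \<in> outer_faces S (outer S \<alpha>)"
    if sub: "\<sigma> \<subseteq> V" for \<sigma>
  proof -
    have fin: "finite \<sigma>" using sub finite_V by (auto intro: finite_subset)
    have l: "lookup (\<alpha> - face_mon \<sigma>) v = lookup \<alpha> v - of_bool (v \<in> \<sigma>)" for v
      using fin by (simp add: lookup_minus lookup_face_mon)
    have l': "lookup (outer S \<alpha> - face_mon (\<sigma> - nbhd S)) v = lookup (\<alpha> - face_mon \<sigma>) v" if "v \<in> V - nbhd S" for v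
      using that fin by (simp add: lookup_minus lookup_face_mon lookup_outer)
    have N: "(\<sigma> \<inter> nbhd S \<subseteq> keys \<alpha> \<and> (\<forall>v\<in>nbhd S. lookup (wmon S) v \<le> lookup (\<alpha> - face_mon \<sigma>) v \<and>
        lookup (\<alpha> - face_mon \<sigma>) v < lookup (wmon S) v + w v)) \<longleftrightarrow> \<sigma> \<inter> nbhd S = \<tau>" (is "?L \<longleftrightarrow> ?R")
    proof
      assume L: ?L
      have "v \<in> \<sigma> \<longleftrightarrow> v \<in> \<tau>" if v: "v \<in> nbhd S" for v
      proof -
        have "v \<in> \<sigma> \<Longrightarrow> 0 < lookup \<alpha> v" using L v by (auto simp: in_keys_iff)
        moreover have "lookup (wmon S) v \<le> lookup (\<alpha> - face_mon \<sigma>) v"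
          "lookup (\<alpha> - face_mon \<sigma>) v < lookup (wmon S) v + w v" using L v by auto
        ultimately show ?thesis
          using v vals[OF v] wp[OF v] unfolding \<tau> l by (cases "v \<in> \<sigma>") auto
      qed
      then show ?R using \<tau>N by blast
    next
      assume R: ?R
      then have mem: "v \<in> \<sigma> \<longleftrightarrow> lookup \<alpha> v = lookup (wmon S) v + w v" if "v \<in> nbhd S" for v
        using that unfolding \<tau> by blast
      have "\<sigma> \<inter> nbhd S \<subseteq> keys \<alpha>" using mem wp by (auto simp: in_keys_iff)
      moreover have "lookup (wmon S) v \<le> lookup (\<alpha> - face_mon \<sigma>) v \<and> lookup (\<alpha> - face_mon \<sigma>) v < lookup (wmon S) v + w v"
        if v: "v \<in> nbhd S" for v
        using mem[OF v] vals[OF v] wp[OF v] unfolding l by (cases "v \<in> \<sigma>") auto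
      ultimately show ?L by blast
    qed
    have keys: "keys (\<alpha> - face_mon \<sigma>) \<subseteq> V" using keys_minus_nat \<alpha> by (rule subset_trans)
    have sub_keys: "\<sigma> \<subseteq> keys \<alpha> \<longleftrightarrow> \<sigma> \<inter> nbhd S \<subseteq> keys \<alpha> \<and> \<sigma> - nbhd S \<subseteq> keys (outer S \<alpha>)"
      unfolding keys_outer using sub by blast
    have "\<sigma> \<in> faces V (summand S) \<alpha> \<longleftrightarrow> (\<sigma> \<inter> nbhd S \<subseteq> keys \<alpha> \<and> (\<forall>v\<in>nbhd S. lookup (wmon S) v \<le> lookup (\<alpha> - face_mon \<sigma>) v \<and>
        lookup (\<alpha> - face_mon \<sigma>) v < lookup (wmon S) v + w v)) \<and> \<sigma> - nbhd S \<subseteq> keys (outer S \<alpha>) \<and>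
        \<not> (\<exists>u\<in>V - nbhd S. \<exists>v\<in>V - nbhd S. adj u v \<and> w u \<le> lookup (\<alpha> - face_mon \<sigma>) u \<and> w v \<le> lookup (\<alpha> - face_mon \<sigma>) v)"
      unfolding faces_def summand_def mem_Collect_eq sub_keys using sub keys by blast
    then show ?thesis unfolding N in_outer_faces[OF ok] using l' by (metis (no_types, lifting))
  qed
  show ?thesis
  proof (intro equalityI subsetI)
    fix \<sigma> assume \<sigma>: "\<sigma> \<in> faces V (summand S) \<alpha>"
    then have "\<sigma> \<inter> nbhd S = \<tau>" "\<sigma> - nbhd S \<in> outer_faces S (outer S \<alpha>)" using split[of \<sigma>] by (auto simp: faces_def)
    moreover from this have "\<sigma> = \<tau> \<union> (\<sigma> - nbhd S)" by blast
    ultimately show "\<sigma> \<in> (\<union>) \<tau> ` outer_faces S (outer S \<alpha>)" by blast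
  next
    fix \<sigma> assume "\<sigma> \<in> (\<union>) \<tau> ` outer_faces S (outer S \<alpha>)"
    then obtain \<rho> where \<rho>: "\<rho> \<in> outer_faces S (outer S \<alpha>)" "\<sigma> = \<tau> \<union> \<rho>" by blast
    then have "\<rho> \<subseteq> V - nbhd S" using in_outer_faces[OF ok] ok by blast
    then have "\<sigma> \<subseteq> V" "\<sigma> \<inter> nbhd S = \<tau>" "\<sigma> - nbhd S = \<rho>" using \<rho>(2) \<tau>N NV by blast+
    then show "\<sigma> \<in> faces V (summand S) \<alpha>" using split \<rho>(1) by simp
  qed
qed

definition reg_term :: "'k::field itself \<Rightarrow> 'v set \<Rightarrow> int" where
  "reg_term K S = reg (V - nbhd S) (edge_ideal (delete_verts D (nbhd S)) :: ('v, 'k) mpoly set)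
     + (\<Sum>x\<in>nbhd S. int (w x)) - int (card (nbhd S)) + (\<Sum>x\<in>S. int (w x))"

lemma edge_mons_nonzero: "0 \<notin> edge_mons X"
proof
  assume "0 \<in> edge_mons X"
  then obtain u v where uv: "adj u v" "wmon {u, v} = 0" by (auto simp: edge_mons_def)
  then have "lookup (wmon {u, v}) u = 0" by simp
  then show False using w_pos[OF adj_V(1)[OF uv(1)]] by (simp add: lookup_wmon)
qed

lemma outer_upper:
  assumes "keys \<gamma> \<subseteq> V - nbhd S" "\<not> exact_at TYPE('k::field) (V - nbhd S) (outer_faces S \<gamma>) k"
  shows "int (mdeg \<gamma>) - int k \<le> reg (V - nbhd S) (edge_ideal (delete_verts D (nbhd S)) :: ('v, 'k) mpoly set) - 1"
  unfolding edge_ideal_delete_verts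
  by (rule finite_vars.quot_faces_upper[OF finite_vars_outer finite_mons(1) edge_mons_keys edge_mons_nonzero assms[unfolded outer_faces_def]])

lemma outer_attained:
  "\<exists>\<gamma> k. keys \<gamma> \<subseteq> V - nbhd S \<and> \<not> exact_at TYPE('k::field) (V - nbhd S) (outer_faces S \<gamma>) k \<and>
    int (mdeg \<gamma>) - int k = reg (V - nbhd S) (edge_ideal (delete_verts D (nbhd S)) :: ('v, 'k) mpoly set) - 1"
  unfolding edge_ideal_delete_verts outer_faces_def
  by (rule finite_vars.quot_faces_attained[OF finite_vars_outer finite_mons(1) edge_mons_keys edge_mons_nonzero])

lemma mdeg_outer:
  assumes "S \<in> triangles D" "keys \<alpha> \<subseteq> V"
  shows "mdeg \<alpha> = sum (lookup \<alpha>) (nbhd S) + mdeg (outer S \<alpha>)"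
proof -
  have NV: "nbhd S \<subseteq> V" by (rule nbhd_V(1)[OF assms(1)])
  have "mdeg \<alpha> = sum (lookup \<alpha>) (nbhd S) + sum (lookup \<alpha>) (V - nbhd S)"
    using mdeg_eq_sum[OF finite_V assms(2)] sum.subset_diff[OF NV finite_V, of "lookup \<alpha>"] by simp
  moreover have "mdeg (outer S \<alpha>) = sum (lookup (outer S \<alpha>)) (V - nbhd S)"
    using finite_V by (intro mdeg_eq_sum) (auto simp: keys_outer)
  moreover have "\<dots> = sum (lookup \<alpha>) (V - nbhd S)" by (rule sum.cong) (auto simp: lookup_outer)
  ultimately show ?thesis by simp
qed

lemma sum_wmon_nbhd:
  assumes "S \<in> triangles D" shows "(\<Sum>v\<in>nbhd S. lookup (wmon S) v) = sum w S"
proof -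
  have "finite (nbhd S)" using nbhd_V(1)[OF assms] finite_V by (rule finite_subset)
  moreover have "nbhd S \<inter> S = S" using nbhd_V(2) by blast
  ultimately show ?thesis by (simp add: lookup_wmon_triangle[OF assms] sum.If_cases)
qed

text \<open>Homology forces \<alpha> to sit at one of the two ends at every v \<in> N[S]. A vertex
  of \<tau> contributes w v to the degree of \<alpha> and 1 to the size of the face, so the bound is
  the one for the outer strand plus the sum of w v - 1 over \<tau> and the degree of x^S.\<close>

lemma summand_upper:
  assumes S: "S \<in> triangles D" and ne: "\<not> exact_at TYPE('k::field) V (faces V (summand S) \<alpha>) i"
  shows "int (mdeg \<alpha>) - int i \<le> reg_term TYPE('k) S - 1"
proof -
  let ?X = "faces V (summand S) \<alpha>" and ?N = "nbhd S"
  have NV: "?N \<subseteq> V" by (rule nbhd_V(1)[OF S])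
  have finN: "finite ?N" using NV finite_V by (rule finite_subset)
  obtain \<sigma> where \<sigma>: "\<sigma> \<in> ?X" "card \<sigma> = i" using exact_at_no_faces ne by metis
  then have \<sigma>': "\<sigma> \<subseteq> V" "\<sigma> \<subseteq> keys \<alpha>" "\<alpha> - face_mon \<sigma> \<in> summand S" by (auto simp: faces_def)
  have fin: "finite \<sigma>" using \<sigma>'(1) finite_V by (rule finite_subset)
  have l: "lookup (\<alpha> - face_mon \<rho>) v = lookup \<alpha> v - of_bool (v \<in> \<rho>)" if "\<rho> \<subseteq> V" for v \<rho>
    using that finite_V by (simp add: lookup_minus lookup_face_mon finite_subset)
  have \<alpha>: "keys \<alpha> \<subseteq> V"
  proof
    fix v assume "v \<in> keys \<alpha>"
    then have "v \<in> \<sigma> \<or> v \<in> keys (\<alpha> - face_mon \<sigma>)" using l[OF \<sigma>'(1), of v] by (auto simp: in_keys_iff)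
    then show "v \<in> V" using \<sigma>'(1) summandD(1)[OF S \<sigma>'(3)] by blast
  qed
  have vals: "lookup \<alpha> v = lookup (wmon S) v \<or> lookup \<alpha> v = lookup (wmon S) v + w v" if v: "v \<in> ?N" for v
  proof (rule ccontr)
    assume neq: "\<not> ?thesis"
    have "lookup (wmon S) v \<le> lookup (\<alpha> - face_mon \<sigma>) v" "lookup (\<alpha> - face_mon \<sigma>) v < lookup (wmon S) v + w v"
      using \<sigma>'(3) v by (auto simp: summand_def)
    then have between: "lookup (wmon S) v < lookup \<alpha> v" "lookup \<alpha> v < lookup (wmon S) v + w v"
      using neq unfolding l[OF \<sigma>'(1)] by (auto split: if_splits simp: of_bool_def)
    have vV: "v \<in> V" using v NV by blast
    \<comment> \<open>Strictly between the ends, v may be put into or taken out of any face without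
      leaving the summand; the complex is a cone with apex v.\<close>
    have toggle: "\<rho>' \<in> ?X" if \<rho>: "\<rho> \<in> ?X" and \<rho>': "\<rho> - {v} = \<rho>' - {v}" for \<rho> \<rho>'
    proof -
      have "\<rho>' \<subseteq> insert v \<rho>" using \<rho>' by blast
      moreover have "v \<in> keys \<alpha>" using between(1) by (simp add: in_keys_iff)
      ultimately have sub: "\<rho> \<subseteq> V" "\<rho>' \<subseteq> V" "\<rho>' \<subseteq> keys \<alpha>" using \<rho> vV by (auto simp: faces_def)
      have eq: "lookup (\<alpha> - face_mon \<rho>') z = lookup (\<alpha> - face_mon \<rho>) z" if "z \<noteq> v" for z
      proof -
        have "z \<in> \<rho>' \<longleftrightarrow> z \<in> \<rho>" using \<rho>' that by blast
        then show ?thesis by (simp add: l sub)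
      qed
      have "keys (\<alpha> - face_mon \<rho>') \<subseteq> V" using keys_minus_nat \<alpha> by (rule subset_trans)
      moreover have "lookup (wmon S) z \<le> lookup (\<alpha> - face_mon \<rho>') z \<and> lookup (\<alpha> - face_mon \<rho>') z < lookup (wmon S) z + w z"
        if z: "z \<in> ?N" for z
      proof (cases "z = v")
        case True
        then show ?thesis using between by (simp add: l sub of_bool_def) linarith
      next
        case False
        then show ?thesis using \<rho> z eq[OF False] by (auto simp: faces_def summand_def)
      qed
      moreover have "\<not> (\<exists>x\<in>V - ?N. \<exists>y\<in>V - ?N. adj x y \<and> w x \<le> lookup (\<alpha> - face_mon \<rho>') x \<and> w y \<le> lookup (\<alpha> - face_mon \<rho>') y)"
      proof -
        have same: "lookup (\<alpha> - face_mon \<rho>') x = lookup (\<alpha> - face_mon \<rho>) x" if "x \<in> V - ?N" for x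
          by (rule eq) (use that v in blast)
        have none: "\<not> (adj x y \<and> w x \<le> lookup (\<alpha> - face_mon \<rho>) x \<and> w y \<le> lookup (\<alpha> - face_mon \<rho>) y)"
          if "x \<in> V - ?N" "y \<in> V - ?N" for x y
          using \<rho> that unfolding faces_def summand_def by blast
        show ?thesis
        proof (intro notI, elim bexE)
          fix x y assume xy: "x \<in> V - ?N" "y \<in> V - ?N"
            and "adj x y \<and> w x \<le> lookup (\<alpha> - face_mon \<rho>') x \<and> w y \<le> lookup (\<alpha> - face_mon \<rho>') y"
          then show False using none[OF xy] unfolding same[OF xy(1)] same[OF xy(2)] by blast
        qed
      qed
      ultimately show ?thesis using sub unfolding faces_def summand_def by blast
    qed
    have "exact_at TYPE('k) V ?X i"
    proof (rule exact_at_cone[OF finite_V vV])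
      show "?X \<subseteq> Pow V" by (auto simp: faces_def)
      show "insert v \<rho> \<in> ?X" if "\<rho> \<in> ?X" for \<rho> by (rule toggle[OF that]) blast
      show "\<rho> - {v} \<in> ?X" if "\<rho> \<in> ?X" for \<rho> by (rule toggle[OF that]) blast
    qed
    then show False using ne by blast
  qed
  define \<tau> where "\<tau> = {v \<in> ?N. lookup \<alpha> v = lookup (wmon S) v + w v}"
  let ?\<gamma> = "outer S \<alpha>"
  have X: "?X = (\<union>) \<tau> ` outer_faces S ?\<gamma>" by (rule faces_summand_join[OF S \<alpha> vals \<tau>_def])
  have ok: "keys ?\<gamma> \<subseteq> V - ?N" by (simp add: keys_outer)
  have Y: "outer_faces S ?\<gamma> \<subseteq> Pow (V - ?N)" using in_outer_faces[OF ok] ok by blast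
  have \<tau>N: "\<tau> \<subseteq> ?N" by (auto simp: \<tau>_def)
  have fin\<tau>: "finite \<tau>" using \<tau>N finN by (rule finite_subset)
  obtain \<rho> where \<rho>: "\<rho> \<in> outer_faces S ?\<gamma>" "\<sigma> = \<tau> \<union> \<rho>" using \<sigma>(1) X by blast
  define k where "k = i - card \<tau>"
  have "card \<tau> \<le> card \<sigma>" using \<rho>(2) fin by (intro card_mono) auto
  then have i: "i = card \<tau> + k" using \<sigma>(2) by (simp add: k_def)
  have "\<not> exact_at TYPE('k) (V - ?N) (outer_faces S ?\<gamma>) k"
  proof
    assume "exact_at TYPE('k) (V - ?N) (outer_faces S ?\<gamma>) k"
    then have "exact_at TYPE('k) (V - \<tau>) (outer_faces S ?\<gamma>) k"
      using exact_at_enlarge[OF Y, of "V - \<tau>" k, where 'k = 'k] \<tau>N finite_V by auto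
    then have "exact_at TYPE('k) V ?X i"
      unfolding X i using \<tau>N NV Y by (intro exact_at_join[OF finite_V]) auto
    then show False using ne by blast
  qed
  then have outer: "int (mdeg ?\<gamma>) - int k \<le> reg (V - ?N) (edge_ideal (delete_verts D ?N) :: ('v, 'k) mpoly set) - 1"
    by (rule outer_upper[OF ok])
  have "sum (lookup \<alpha>) ?N = (\<Sum>v\<in>?N. lookup (wmon S) v + (if v \<in> \<tau> then w v else 0))"
    by (rule sum.cong) (use vals in \<open>auto simp: \<tau>_def\<close>)
  also have "\<dots> = sum w S + sum w \<tau>"
    unfolding sum.distrib sum_wmon_nbhd[OF S] using finN \<tau>N by (simp add: sum.If_cases Int_absorb1)
  finally have deg: "mdeg \<alpha> = sum w S + sum w \<tau> + mdeg ?\<gamma>" using mdeg_outer[OF S \<alpha>] by simp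
  \<comment> \<open>Weights are positive, so all terms w v - 1 are nonnegative and the worst case is
    \<tau> = N[S].\<close>
  have "(\<Sum>v\<in>\<tau>. int (w v) - 1) \<le> (\<Sum>v\<in>?N. int (w v) - 1)"
    using finN \<tau>N NV w_pos by (intro sum_mono2) (auto simp: Suc_le_eq int_one_le_iff_zero_less)
  then have "int (sum w \<tau>) - int (card \<tau>) \<le> (\<Sum>v\<in>?N. int (w v)) - int (card ?N)"
    by (simp add: sum_subtractf)
  then show ?thesis using outer deg i unfolding reg_term_def by simp
qed

section \<open>The connecting homomorphism and the comparison of regularities\<close>

lemma face_pair_square: "face_pair V (faces V (upset V square_mons) \<alpha>) (faces V (upset V sym_mons) \<alpha>)"
proof
  show "finite V" by (rule finite_V)
  show "face_closed (faces V (upset V square_mons) \<alpha>)" "face_closed (faces V (upset V sym_mons) \<alpha>)"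
    by (rule face_closed_faces[OF up_closed_upset])+
  show "faces V (upset V sym_mons) \<alpha> \<subseteq> Pow V" unfolding faces_def by blast
  show "faces V (upset V square_mons) \<alpha> \<subseteq> faces V (upset V sym_mons) \<alpha>"
    unfolding faces_def using sym_upset_iff by blast
qed

text \<open>In the top degree on \<open>N[S]\<close> no relative cycle can lift to a cycle of \<open>I\<^sup>(\<^sup>2\<^sup>)\<close>: as
  \<open>x\<^sub>a\<^bsup>w a\<^esup> x\<^sup>S \<in> I\<^sup>2\<close> for \<open>a \<in> S\<close>, the coefficients of the lift at the faces not containing \<open>a\<close> would
  exhibit it as a boundary.\<close>

lemma square_lower:
  assumes S: "S \<in> triangles D"
  shows "\<exists>\<alpha> i. \<not> exact_at TYPE('k::field) V (faces V (upset V square_mons) \<alpha>) i \<and>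
    int (mdeg \<alpha>) - int i = reg_term TYPE('k) S"
proof -
  let ?N = "nbhd S"
  have NV: "?N \<subseteq> V" by (rule nbhd_V(1)[OF S])
  have finN: "finite ?N" using NV finite_V by (rule finite_subset)
  obtain \<gamma> k where \<gamma>: "keys \<gamma> \<subseteq> V - ?N" and ne: "\<not> exact_at TYPE('k) (V - ?N) (outer_faces S \<gamma>) k"
    and deg\<gamma>: "int (mdeg \<gamma>) - int k = reg (V - ?N) (edge_ideal (delete_verts D ?N) :: ('v, 'k) mpoly set) - 1"
    using outer_attained by blast
  let ?Y = "outer_faces S \<gamma>"
  have Y: "?Y \<subseteq> Pow (V - ?N)" using in_outer_faces[OF \<gamma>] \<gamma> by blast
  \<comment> \<open>Every v \<in> N[S] is put at the upper end, so N[S] is contained in every face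
    of the summand and the bound of \<open>summand_upper\<close> is attained with \<tau> =
    N[S].\<close>
  define \<alpha> where "\<alpha> = wmon ?N + wmon S + \<gamma>"
  have \<gamma>0: "lookup \<gamma> v = 0" if "v \<in> ?N" for v
  proof -
    have "v \<notin> keys \<gamma>" using \<gamma> that by blast
    then show ?thesis by (simp add: in_keys_iff)
  qed
  have \<alpha>N: "lookup \<alpha> v = lookup (wmon S) v + w v" if "v \<in> ?N" for v
    using that \<gamma>0 finN by (simp add: \<alpha>_def lookup_add lookup_wmon)
  have \<alpha>out: "lookup \<alpha> v = lookup \<gamma> v" if "v \<notin> ?N" for v
    using that finN nbhd_V(2)[of S] by (auto simp: \<alpha>_def lookup_add lookup_wmon lookup_wmon_triangle[OF S])
  have keys\<alpha>: "keys \<alpha> \<subseteq> V"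
  proof
    fix v assume v: "v \<in> keys \<alpha>"
    show "v \<in> V"
    proof (cases "v \<in> ?N")
      case False
      then have "v \<in> keys \<gamma>" using v \<alpha>out by (simp add: in_keys_iff)
      then show ?thesis using \<gamma> by blast
    qed (use NV in blast)
  qed
  have outer: "outer S \<alpha> = \<gamma>"
  proof (rule poly_mapping_eqI)
    fix v
    have "v \<notin> V \<Longrightarrow> v \<notin> keys \<gamma>" using \<gamma> by blast
    then show "lookup (outer S \<alpha>) v = lookup \<gamma> v"
      using \<alpha>out[of v] \<gamma>0[of v] by (auto simp: lookup_outer in_keys_iff)
  qed
  let ?A = "faces V (upset V square_mons) \<alpha>" and ?B = "faces V (upset V sym_mons) \<alpha>"
  interpret face_pair "TYPE('k)" V ?A ?B by (rule face_pair_square)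
  have "faces V (summand S) \<alpha> = (\<union>) ?N ` outer_faces S (outer S \<alpha>)"
    by (rule faces_summand_join[OF S keys\<alpha>]) (use \<alpha>N in auto)
  then have X: "faces V (summand S) \<alpha> = (\<union>) ?N ` ?Y" by (simp add: outer)
  have XQ: "faces V (summand S) \<alpha> \<subseteq> ?B - ?A"
    using sym_minus_square S unfolding faces_def by blast
  obtain c :: "'v set \<Rightarrow> 'k" where c: "c \<in> kchains ?Y k" "\<And>\<rho>. \<rho> \<in> ?Y \<Longrightarrow> bd (V - ?N) c \<rho> = 0"
    and nb: "\<And>b. b \<in> kchains ?Y (Suc k) \<Longrightarrow> \<exists>\<rho>\<in>?Y. bd (V - ?N) b \<rho> \<noteq> c \<rho>"
    using ne unfolding exact_at_def by blast
  define q where "q \<sigma> = (if ?N \<subseteq> \<sigma> \<and> \<sigma> \<subseteq> V then join_sgn ?N (\<sigma> - ?N) * c (\<sigma> - ?N) else 0)" for \<sigma>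
  have q: "q (?N \<union> \<rho>) = join_sgn ?N \<rho> * c \<rho>" if "\<rho> \<subseteq> V - ?N" for \<rho>
  proof -
    have "?N \<union> \<rho> - ?N = \<rho>" "?N \<union> \<rho> \<subseteq> V" using that NV by blast+
    then show ?thesis by (simp add: q_def)
  qed
  have card: "card (?N \<union> \<rho>) = card ?N + card \<rho>" if "\<rho> \<subseteq> V - ?N" for \<rho>
    using that finN finite_V by (intro card_Un_disjoint) (auto intro: finite_subset)
  obtain a where a: "a \<in> S" using S by (auto simp: triangles_iff)
  then have aN: "a \<in> ?N" using nbhd_V(2) by blast
  \<comment> \<open>The connecting homomorphism lowers the face size by one, which cancels the -1 in
    the regularity of the quotient ring. The subtraction on naturals is exact, as N[S] contains
    a.\<close>
  define i where "i = card ?N + k - 1"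
  have i: "Suc i = card ?N + k" using aN finN by (cases "card ?N") (auto simp: i_def)
  have q_supp: "q \<in> kchains (faces V (summand S) \<alpha>) (Suc i)" unfolding kchains_def
  proof (intro CollectI allI impI)
    fix \<sigma> assume "q \<sigma> \<noteq> 0"
    then have \<sigma>: "?N \<subseteq> \<sigma>" "\<sigma> \<subseteq> V" "c (\<sigma> - ?N) \<noteq> 0" by (auto simp: q_def split: if_splits)
    then have *: "\<sigma> - ?N \<in> ?Y" "card (\<sigma> - ?N) = k" using kchainsD[OF c(1)] by blast+
    have **: "\<sigma> = ?N \<union> (\<sigma> - ?N)" using \<sigma>(1) by blast
    have "\<sigma> - ?N \<subseteq> V - ?N" using \<sigma>(2) by blast
    then have "card \<sigma> = Suc i" using card[of "\<sigma> - ?N"] * ** i by simp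
    then show "\<sigma> \<in> faces V (summand S) \<alpha> \<and> card \<sigma> = Suc i" unfolding X using * ** by blast
  qed
  then have qQ: "q \<in> kchains (?B - ?A) (Suc i)" using XQ by (rule kchains_mono)
  \<comment> \<open>A face in the boundary that lacks one v \<in> N[S] has a monomial divisible by
    x_v^(w v) x^S, hence lies in the complex of I^2. On faces that contain N[S] the boundary of q
    is, up to sign, that of c.\<close>
  have q_cycle: "bd V q \<sigma> = 0" if \<sigma>: "\<sigma> \<in> ?B - ?A" for \<sigma>
  proof (cases "?N \<subseteq> \<sigma>")
    case False
    show ?thesis
    proof (rule ccontr)
      assume "bd V q \<sigma> \<noteq> 0"
      then obtain v where v: "v \<in> V - \<sigma>" "q (insert v \<sigma>) \<noteq> 0" using kbd_nonzero by blast
      then have "insert v \<sigma> \<in> faces V (summand S) \<alpha>" using kchainsD[OF q_supp] by blast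
      then have top: "\<alpha> - face_mon (insert v \<sigma>) \<in> summand S" and sub: "insert v \<sigma> \<subseteq> V" "insert v \<sigma> \<subseteq> keys \<alpha>"
        by (auto simp: faces_def)
      have fin: "finite \<sigma>" using sub(1) finite_V by (auto intro: finite_subset)
      have vN: "v \<in> ?N" using False v(2) by (auto simp: q_def split: if_splits)
      have "\<alpha> - face_mon \<sigma> \<in> upset V square_mons"
      proof (rule triangle_times_neighbour[OF S vN])
        show "keys (\<alpha> - face_mon \<sigma>) \<subseteq> V" using keys_minus_nat keys\<alpha> by (rule subset_trans)
        fix z
        show "lookup (wmon S) z + lookup (wmon {v}) z \<le> lookup (\<alpha> - face_mon \<sigma>) z"
        proof (cases "z = v")
          case True
          then show ?thesis using \<alpha>N[OF vN] v(1) fin by (simp add: lookup_minus lookup_face_mon lookup_wmon)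
        next
          case False
          then show ?thesis using summandD(3)[OF S top, of z] fin
            by (simp add: lookup_minus lookup_face_mon lookup_wmon)
        qed
      qed
      then have "\<sigma> \<in> ?A" using sub by (auto simp: faces_def)
      then show False using \<sigma> by blast
    qed
  next
    case True
    define \<rho> where "\<rho> = \<sigma> - ?N"
    have \<sigma>V: "\<sigma> \<subseteq> V" using \<sigma> by (auto simp: faces_def)
    have \<rho>: "\<sigma> = ?N \<union> \<rho>" "\<rho> \<subseteq> V - ?N" using True \<sigma>V by (auto simp: \<rho>_def)
    have "\<rho> \<in> ?Y"
    proof -
      have "\<rho> \<subseteq> keys \<gamma>"
      proof
        fix v assume v: "v \<in> \<rho>"
        then have "v \<in> keys \<alpha>" "v \<notin> ?N" using \<sigma> \<rho> by (auto simp: faces_def)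
        then show "v \<in> keys \<gamma>" using \<alpha>out by (simp add: in_keys_iff)
      qed
      moreover have False if uv: "u \<in> V - ?N" "v \<in> V - ?N" "adj u v"
        "w u \<le> lookup (\<gamma> - face_mon \<rho>) u" "w v \<le> lookup (\<gamma> - face_mon \<rho>) v" for u v
      proof -
        obtain x y z where xyz: "S = {x, y, z}" "adj x y" using S unfolding triangles_iff by blast
        have fin: "finite \<sigma>" "finite \<rho>" using \<sigma>V \<rho> finite_V by (auto intro: finite_subset)
        have disj: "{x, y} \<inter> {u, v} = {}" using uv xyz(1) nbhd_V(2)[of S] by blast
        have "\<alpha> - face_mon \<sigma> \<in> upset V square_mons"
        proof (rule disjoint_edges_square[OF _ xyz(2) uv(3) disj])
          show "keys (\<alpha> - face_mon \<sigma>) \<subseteq> V" using keys_minus_nat keys\<alpha> by (rule subset_trans)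
          fix t assume t: "t \<in> {x, y, u, v}"
          show "w t \<le> lookup (\<alpha> - face_mon \<sigma>) t"
          proof (cases "t \<in> S")
            case True
            then have "t \<in> ?N" using nbhd_V(2) by blast
            then show ?thesis using \<alpha>N[of t] True w_pos[of t] NV fin
              by (auto simp: lookup_minus lookup_face_mon lookup_wmon_triangle[OF S] of_bool_def)
          next
            case False
            then have "t \<in> {u, v}" using t xyz(1) by auto
            then show ?thesis using uv \<rho> fin \<alpha>out[of t] by (auto simp: lookup_minus lookup_face_mon)
          qed
        qed
        then have "\<sigma> \<in> ?A" using \<sigma> by (auto simp: faces_def)
        then show False using \<sigma> by blast
      qed
      ultimately show ?thesis unfolding in_outer_faces[OF \<gamma>] by blast
    qed
    have "join_sgn ?N \<rho> * bd V q (?N \<union> \<rho>) = bd (V - ?N) (\<lambda>\<rho>. join_sgn ?N \<rho> * q (?N \<union> \<rho>)) \<rho>"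
      using bd_join[OF finite_V NV \<rho>(2), of q] by simp
    also have "\<dots> = bd (V - ?N) c \<rho>" using \<rho>(2) by (intro kbd_cong) (simp add: q del: Un_insert_right)
    also have "\<dots> = 0" using c(2)[OF \<open>\<rho> \<in> ?Y\<close>] .
    finally have zero: "join_sgn ?N \<rho> * bd V q (?N \<union> \<rho>) = 0" .
    have "bd V q \<sigma> = join_sgn ?N \<rho> * (join_sgn ?N \<rho> * bd V q (?N \<union> \<rho>))"
      by (simp only: join_sgn_square \<rho>(1))
    then show ?thesis by (simp only: zero mult_zero_right)
  qed
  have "\<not> exact_at TYPE('k) V ?A i"
  proof
    assume "exact_at TYPE('k) V ?A i"
    then obtain b where b: "b \<in> kchains ?B (Suc i)" "\<And>\<rho>. \<rho> \<in> ?B \<Longrightarrow> bd V b \<rho> = 0"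
      "\<And>\<sigma>. \<sigma> \<in> ?B - ?A \<Longrightarrow> b \<sigma> = q \<sigma>" using lift_relative_cycle[OF _ qQ q_cycle] by blast
    \<comment> \<open>The cycle condition for b at N1 \<union> \<rho> has one term at N[S] \<union>
      \<rho>, where b agrees with q, while its other terms form the boundary of f at \<rho>. Solved
      for c, it reads c = \<epsilon> * bd f.\<close>
    define N1 where "N1 = ?N - {a}"
    have N1: "N1 \<subseteq> V" "finite N1" "a \<notin> N1" "?N = insert a N1" "card ?N = Suc (card N1)"
      using NV finN aN card.remove[OF finN aN] unfolding N1_def by blast+
    define f where "f = (\<lambda>\<rho>. join_sgn N1 \<rho> * b (N1 \<union> \<rho>))"
    \<comment> \<open>The sign for moving a past N1 and past \<rho>; it is the same for all \<rho>
      in the support of c, since these have k elements.\<close>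
    define \<epsilon> :: 'k where "\<epsilon> = - (ksgn a N1 * (- 1) ^ k)"
    have \<epsilon>: "\<epsilon> * (\<epsilon> * x) = x" for x
    proof -
      have "(- 1 :: 'k) ^ k * (- 1) ^ k = 1" by (simp flip: power_mult_distrib)
      then have "\<epsilon> * \<epsilon> = 1" using ksgn_square(1)[of a N1, where 'a = 'k] by (simp add: \<epsilon>_def algebra_simps)
      then show ?thesis by (simp flip: mult.assoc)
    qed
    have f_bd: "bd (V - ?N) f \<rho> = \<epsilon> * c \<rho>" if \<rho>: "\<rho> \<in> ?Y" for \<rho>
    proof -
      have sub: "\<rho> \<subseteq> V - ?N" using \<rho> Y by blast
      then have sub1: "\<rho> \<subseteq> V - N1" using N1 by blast
      have fin: "finite \<rho>" using sub finite_V by (auto intro: finite_subset)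
      have a\<rho>: "a \<notin> \<rho>" using sub aN by blast
      have N\<rho>: "?N \<union> \<rho> \<in> ?B - ?A" using X XQ \<rho> by blast
      then have "N1 \<union> \<rho> \<in> ?B" using subfaceB[of "?N \<union> \<rho>" "N1 \<union> \<rho>"] N1(4) by blast
      then have "0 = bd (V - N1) f \<rho>" using bd_join[OF finite_V N1(1) sub1, of b] b(2) by (simp add: f_def)
      also have "\<dots> = ksgn a \<rho> * f (insert a \<rho>) + bd (V - ?N) f \<rho>"
      proof -
        have "V - N1 - \<rho> = insert a (V - ?N - \<rho>)" using N1 NV aN a\<rho> by blast
        moreover have "a \<notin> V - ?N - \<rho>" using aN by blast
        ultimately show ?thesis using finite_V by (simp add: kbd_def)
      qed
      also have "f (insert a \<rho>) = ksgn a N1 * (join_sgn N1 \<rho> * b (?N \<union> \<rho>))"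
        using join_sgn_insert[OF fin a\<rho>, of N1, where 'b = 'k] N1(4) by (simp add: f_def algebra_simps)
      also have "b (?N \<union> \<rho>) = join_sgn N1 \<rho> * (join_sgn {a} \<rho> * c \<rho>)"
      proof -
        have "join_sgn ?N \<rho> = join_sgn N1 \<rho> * (join_sgn {a} \<rho> :: 'k)"
          using join_sgn_Un[of N1 "{a}" \<rho>, where 'k = 'k] N1 by simp
        then show ?thesis using b(3)[OF N\<rho>] q[OF sub] by (simp add: mult.assoc)
      qed
      also have "ksgn a \<rho> * (ksgn a N1 * (join_sgn N1 \<rho> * (join_sgn N1 \<rho> * (join_sgn {a} \<rho> * c \<rho>))))
          = ksgn a N1 * ((ksgn a \<rho> * join_sgn {a} \<rho>) * c \<rho>)"
        by (simp add: algebra_simps)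
      also have "ksgn a \<rho> * join_sgn {a} \<rho> = ((- 1) ^ card \<rho> :: 'k)" by (rule ksgn_join_sgn[OF fin a\<rho>])
      also have "(- 1) ^ card \<rho> * c \<rho> = (- 1) ^ k * c \<rho>" using kchainsD[OF c(1), of \<rho>] by (cases "c \<rho> = 0") auto
      finally show ?thesis by (simp add: \<epsilon>_def algebra_simps eq_neg_iff_add_eq_0)
    qed
    \<comment> \<open>Cutting f down to the outer strand does not disturb the boundary there: if
      insert v \<rho> is not in the strand, then v is not in \<alpha>, and b vanishes at N1 \<union>
      insert v \<rho>.\<close>
    define f' where "f' \<rho> = (if \<rho> \<in> ?Y then \<epsilon> * f \<rho> else 0)" for \<rho>
    have "f' \<in> kchains ?Y (Suc k)" unfolding kchains_def
    proof (intro CollectI allI impI)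
      fix \<rho> assume "f' \<rho> \<noteq> 0"
      then have \<rho>: "\<rho> \<in> ?Y" "b (N1 \<union> \<rho>) \<noteq> 0" by (auto simp: f'_def f_def split: if_splits)
      have sub: "\<rho> \<subseteq> V - ?N" using \<rho>(1) Y by blast
      have "card (N1 \<union> \<rho>) = card N1 + card \<rho>"
        using sub N1 finite_V by (intro card_Un_disjoint) (auto intro: finite_subset)
      moreover have "card (N1 \<union> \<rho>) = Suc i" using kchainsD[OF b(1) \<rho>(2)] by blast
      ultimately show "\<rho> \<in> ?Y \<and> card \<rho> = Suc k" using i N1(5) \<rho>(1) by simp
    qed
    moreover have "bd (V - ?N) f' \<rho> = c \<rho>" if \<rho>: "\<rho> \<in> ?Y" for \<rho>
    proof -
      have "bd (V - ?N) f' \<rho> = bd (V - ?N) (\<lambda>\<rho>. \<epsilon> * f \<rho>) \<rho>"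
      proof (rule kbd_cong)
        fix v assume v: "v \<in> V - ?N - \<rho>"
        show "f' (insert v \<rho>) = \<epsilon> * f (insert v \<rho>)"
        proof (cases "insert v \<rho> \<in> ?Y")
          case False
          have sub: "\<rho> \<subseteq> V - ?N" "\<rho> \<subseteq> keys \<gamma>" using \<rho> Y in_outer_faces[OF \<gamma>] by blast+
          have fin: "finite \<rho>" using sub finite_V by (auto intro: finite_subset)
          have mono: "lookup (\<gamma> - face_mon (insert v \<rho>)) u \<le> lookup (\<gamma> - face_mon \<rho>) u" for u
            using fin by (simp add: lookup_minus lookup_face_mon)
          have "v \<notin> keys \<gamma>"
          proof
            assume "v \<in> keys \<gamma>"
            then have "insert v \<rho> \<in> ?Y"
              using \<rho> mono unfolding in_outer_faces[OF \<gamma>] by (meson insert_subsetI le_trans)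
            then show False using False by blast
          qed
          then have "v \<notin> keys \<alpha>" using v \<alpha>out[of v] by (simp add: in_keys_iff)
          then have "N1 \<union> insert v \<rho> \<notin> ?B" by (auto simp: faces_def)
          then have "b (N1 \<union> insert v \<rho>) = 0" using kchainsD[OF b(1)] by blast
          then show ?thesis using False by (simp add: f'_def f_def del: Un_insert_right)
        qed (simp add: f'_def)
      qed
      also have "\<dots> = \<epsilon> * bd (V - ?N) f \<rho>" by (rule kbd_mult)
      finally show ?thesis using f_bd[OF \<rho>] \<epsilon> by simp
    qed
    ultimately show False using nb by blast
  qed
  moreover have "int (mdeg \<alpha>) - int i = reg_term TYPE('k) S"
  proof -
    have "sum (lookup \<alpha>) ?N = sum w S + sum w ?N"
      using \<alpha>N by (simp add: sum.distrib sum_wmon_nbhd[OF S])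
    then have "mdeg \<alpha> = sum w S + sum w ?N + mdeg \<gamma>" using mdeg_outer[OF S keys\<alpha>] outer by simp
    then show ?thesis using deg\<gamma> i unfolding reg_term_def by simp
  qed
  ultimately show ?thesis by blast
qed

text \<open>Extremal homology of I^2, and then of I^(2), is traced through the exact sequence. The
  quotient reaches at most M - 1, and M itself is attained by I^2 through the triangle of the
  maximal term.\<close>

lemma reg_square_cases:
  assumes tri: "triangles D \<noteq> {}"
  defines "M \<equiv> Max (reg_term TYPE('k::field) ` triangles D)"
  shows "reg V (mono_ideal (upset V square_mons) :: ('v, 'k) mpoly set) \<in>
    {reg V (mono_ideal (upset V sym_mons) :: ('v, 'k) mpoly set), M}"
proof -
  obtain S0 where S0: "S0 \<in> triangles D" using tri by blast
  then obtain a b c where "adj a b" unfolding triangles_iff by blast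
  then have "wmon {a, b} \<in> edge_mons V" using adj_V unfolding edge_mons_def by blast
  then have ne: "square_mons \<noteq> {}" "sym_mons \<noteq> {}" unfolding sym_mons_def square_mons_def by blast+
  let ?EA = "shifted_degs TYPE('k) (upset V square_mons)" and ?EB = "shifted_degs TYPE('k) (upset V sym_mons)"
  have keys: "\<forall>g\<in>square_mons. keys g \<subseteq> V" "\<forall>g\<in>sym_mons. keys g \<subseteq> V"
    using sym_mons_keys by (auto simp only: sym_mons_def Un_iff)
  note A = reg_mono_ideal[OF finite_mons(2) ne(1) keys(1), where 'k = 'k]
  note B = reg_mono_ideal[OF finite_mons(3) ne(2) keys(2), where 'k = 'k]
  have fin: "finite (reg_term TYPE('k) ` triangles D)" using finite_triangles by simp
  have quot: "int (mdeg \<alpha>) - int i \<le> M - 1"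
    if nx: "\<not> exact_at TYPE('k) V (faces V (upset V sym_mons) \<alpha> - faces V (upset V square_mons) \<alpha>) i" for \<alpha> i
  proof -
    obtain S where S: "S \<in> triangles D" "\<not> exact_at TYPE('k) V (faces V (summand S) \<alpha>) i"
      using quot_summands[of \<alpha> i, where 'k = 'k] nx by blast
    have "reg_term TYPE('k) S \<le> M" unfolding M_def using fin S(1) by (intro Max_ge) auto
    then show ?thesis using summand_upper[OF S] by linarith
  qed
  have "M \<in> reg_term TYPE('k) ` triangles D" unfolding M_def using fin tri by (intro Max_in) auto
  then obtain S where S: "S \<in> triangles D" "M = reg_term TYPE('k) S" by blast
  obtain \<alpha> i where "\<not> exact_at TYPE('k) V (faces V (upset V square_mons) \<alpha>) i"
    "int (mdeg \<alpha>) - int i = M" using square_lower[OF S(1), where 'k = 'k] S(2) by blast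
  then have "M \<in> ?EA" unfolding shifted_degs_def by blast
  then have M_le: "M \<le> Max ?EA" using A(1) by (intro Max_ge)
  have "Max ?EA \<in> ?EA" using A(1,2) by (rule Max_in)
  then obtain \<alpha> i where \<alpha>: "Max ?EA = int (mdeg \<alpha>) - int i" "\<not> exact_at TYPE('k) V (faces V (upset V square_mons) \<alpha>) i"
    unfolding shifted_degs_def by blast
  \<comment> \<open>Homology of I^2 at i that dies in I^(2) comes from the quotient at i + 1. This
    shift turns the bound M - 1 into M.\<close>
  have A_le: "Max ?EA \<le> Max ?EB \<or> Max ?EA \<le> M"
  proof (cases "exact_at TYPE('k) V (faces V (upset V sym_mons) \<alpha>) i")
    case True
    then have "\<not> exact_at TYPE('k) V (faces V (upset V sym_mons) \<alpha> - faces V (upset V square_mons) \<alpha>) (Suc i)"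
      using face_pair.exact_at_sub[OF face_pair_square, of \<alpha> i, where 'k = 'k] \<alpha>(2) by blast
    then have "int (mdeg \<alpha>) - int (Suc i) \<le> M - 1" by (rule quot)
    then show ?thesis using \<alpha>(1) by simp
  next
    case False
    then have "int (mdeg \<alpha>) - int i \<in> ?EB" unfolding shifted_degs_def by blast
    then have "Max ?EA \<le> Max ?EB" using B(1) \<alpha>(1) by simp
    then show ?thesis by blast
  qed
  have "Max ?EB \<in> ?EB" using B(1,2) by (rule Max_in)
  then obtain \<beta> j where \<beta>: "Max ?EB = int (mdeg \<beta>) - int j" "\<not> exact_at TYPE('k) V (faces V (upset V sym_mons) \<beta>) j"
    unfolding shifted_degs_def by blast
  \<comment> \<open>Here the quotient enters at the same i, so that the bound stays M - 1 and is
    covered by M \<le> reg I^2.\<close>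
  have B_le: "Max ?EB \<le> Max ?EA"
  proof (cases "exact_at TYPE('k) V (faces V (upset V square_mons) \<beta>) j")
    case True
    then have "\<not> exact_at TYPE('k) V (faces V (upset V sym_mons) \<beta> - faces V (upset V square_mons) \<beta>) j"
      using face_pair.exact_at_total[OF face_pair_square, of \<beta> j, where 'k = 'k] \<beta>(2) by blast
    then have "int (mdeg \<beta>) - int j \<le> M - 1" by (rule quot)
    then show ?thesis using \<beta>(1) M_le by simp
  next
    case False
    then have "int (mdeg \<beta>) - int j \<in> ?EA" unfolding shifted_degs_def by blast
    then show ?thesis using A(1) \<beta>(1) by simp
  qed
  show ?thesis unfolding A(3) B(3) using A_le B_le M_le by auto
qed

end

theorem theorem4p5:
  fixes D :: "'v wograph" and I :: "('v, 'k::field) mpoly set"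
  assumes "weighted_oriented_graph D"
    and "\<forall>v \<in> Vplus D. is_sink D v"
    and "I = edge_ideal D"
  shows "reg (verts D) (ideal_power (poly_ring (verts D)) I 2) \<in>
    {reg (verts D) (symbolic_power (poly_ring (verts D)) I 2)} \<union>
    (if triangles D = {} then {}
     else {Max ((\<lambda>S.
        let N = closed_nbhd D S; D' = delete_verts D N in
          reg (verts D') (edge_ideal D' :: ('v, 'k) mpoly set)
          + (\<Sum>x \<in> N. int (weight D x)) - int (card N) + (\<Sum>x \<in> S. int (weight D x)))
        ` triangles D)})"
proof -
  interpret sink_weighted_graph D using assms(1,2) by unfold_locales
  have I2: "ideal_power (poly_ring (verts D)) I 2 = mono_ideal (upset (verts D) square_mons)"
    unfolding assms(3) by (rule edge_ideal_square)
  have Isym: "symbolic_power (poly_ring (verts D)) I 2 = mono_ideal (upset (verts D) sym_mons)"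
    unfolding assms(3) by (rule symbolic_square)
  show ?thesis
  proof (cases "triangles D = {}")
    case True
    \<comment> \<open>Without triangles I^(2) = I^2, and the first value is the only one
      offered.\<close>
    then have "sym_mons = square_mons" by (simp add: sym_mons_def)
    then show ?thesis unfolding I2 Isym by simp
  next
    case False
    have terms: "(\<lambda>S. let N = closed_nbhd D S; D' = delete_verts D N in
          reg (verts D') (edge_ideal D' :: ('v, 'k) mpoly set)
          + (\<Sum>x \<in> N. int (weight D x)) - int (card N) + (\<Sum>x \<in> S. int (weight D x)))
        = reg_term TYPE('k)"
      by (simp add: fun_eq_iff reg_term_def Let_def delete_verts_def)
    show ?thesis unfolding I2 Isym terms using reg_square_cases[OF False, where 'k = 'k] by (simp add: False) blast
  qed
qed

end
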